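(* Let $T\subset\mathbb{R}^3$ be a nondegenerate tetrahedron with Alfeld split $T^z$ and let $r\ge5$. Then a function $\omega\in M_{r-2}^2(T^z)$ is uniquely determined by the following degrees of freedom (DOFs): (a) $\omega(a)$ for all $a\in\Delta_0(T)$ ($12$ DOFs); (b) $\int_e\omega\cdot\kappa\,ds$ for all $\kappa\in[\mathcal{P}_{r-4}(e)]^3$, $e\in\Delta_1(T)$ ($18(r-3)$ DOFs); (c) $\int_F\omega\cdot\kappa\,dA$ for all $\kappa\in[\mathcal{P}_{r-5}(F)]^3$, $F\in\Delta_2(T)$ ($6(r-4)(r-3)$ DOFs); (d) $\int_T\omega\cdot\kappa\,dx$ for all $\kappa\in\operatorname{curl}\mathring{M}_{d,r-1}^1(T^z)$ ($\frac{(r-4)(r-3)(4r-11)}3$ DOFs); (e) $\int_T(\operatorname{div}\omega)\kappa\,dx$ for all $\kappa\in\mathring{V}_{d,r-3}^3(T^z)$ ($\frac{2(r-2)(r-1)r}3-1$ DOFs).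
   Context: Let $T=[x_0,x_1,x_2,x_3]\subset\mathbb{R}^3$ be a nondegenerate tetrahedron with barycenter $z$. The Alfeld split is $T^z=\{T_0,\dots,T_3\}$, where $T_i$ is obtained from $T$ by replacing the vertex $x_i$ by $z$. $\Delta_s(T)$ is the set of $s$-dimensional subsimplices of $T$ (vertices, edges, faces for $s=0,1,2$). $\mathcal{P}_r(S)$ denotes polynomials of total degree at most $r$ on a simplex $S$, $\{0\}$ if $r<0$. $C^0(T)$ means continuous on the closed tetrahedron. $M_r^0(T^z)=\{\omega\in C^0(T):\omega|_{T_i}\in\mathcal{P}_r(T_i),\ 0\le i\le3\}$; $M_r^1(T^z)=M_r^2(T^z)=[M_r^0(T^z)]^3$; $\mathring{M}_{d,r}^1(T^z)=\{\omega\in M_r^1(T^z):\operatorname{curl}\omega\in[C^0(T)]^3,\ \omega=0\text{ and }\operatorname{curl}\omega=0\text{ on }\partial T\}$; $\mathring{V}_{d,r}^3(T^z)=\{\omega\in L^2(T):\omega|_{T_i}\in\mathcal{P}_r(T_i),\ 0\le i\le3,\ \int_T\omega\,dx=0\}$. "($N$ DOFs)" is the number of scalar conditions when test functions run through a basis. "Uniquely determined" means that two elements of the space with the same values of all the DOFs coincide. *)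

theory Defs
  imports "HOL-Analysis.Analysis" "HOL-Library.Function_Algebras"
begin

text \<open>
  Pointwise scalar multiplication, so that the library constants \<^const>\<open>span\<close> and
  \<^const>\<open>dim\<close> apply to spaces of functions.
\<close>

instantiation "fun" :: (type, real_vector) real_vector
begin

definition scaleR_fun :: "real \<Rightarrow> ('a \<Rightarrow> 'b) \<Rightarrow> 'a \<Rightarrow> 'b"
  where "scaleR_fun c f = (\<lambda>y. c *\<^sub>R f y)"

instance
  by standard (simp_all add: scaleR_fun_def fun_eq_iff scaleR_add_right scaleR_add_left)

end


subsection \<open>Tetrahedra and the Alfeld split\<close>

text \<open>
  A tetrahedron is given by its vertices \<open>x 0, x 1, x 2, x 3\<close>; other values of \<open>x\<close> are
  irrelevant.
\<close>

definition nondegenerate :: "(nat \<Rightarrow> real^3) \<Rightarrow> bool"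
  where "nondegenerate x \<longleftrightarrow> inj_on x {..3} \<and> \<not> affine_dependent (x ` {..3})"

definition tetra :: "(nat \<Rightarrow> real^3) \<Rightarrow> (real^3) set"
  where "tetra x = convex hull (x ` {..3})"

definition barycenter :: "(nat \<Rightarrow> real^3) \<Rightarrow> real^3"
  where "barycenter x = (1/4) *\<^sub>R (\<Sum>i\<le>3. x i)"

definition alfeld :: "(nat \<Rightarrow> real^3) \<Rightarrow> nat \<Rightarrow> (real^3) set"
  where "alfeld x i = tetra (x(i := barycenter x))"

definition open_cells :: "(nat \<Rightarrow> real^3) \<Rightarrow> (real^3) set"
  where "open_cells x = (\<Union>i\<le>3. interior (alfeld x i))"


subsection \<open>Polynomial and piecewise polynomial spaces\<close>

text \<open>
  A function on a set \<open>S\<close> is encoded as a function on the whole space vanishing off \<open>S\<close>.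
  Thus equality of encodings is equality on \<open>S\<close>, and \<^const>\<open>dim\<close> is the dimension of
  the space of functions on \<open>S\<close>.
\<close>

definition restr :: "(real^3) set \<Rightarrow> (real^3 \<Rightarrow> 'a::zero) \<Rightarrow> real^3 \<Rightarrow> 'a"
  where "restr S f = (\<lambda>y. if y \<in> S then f y else 0)"

definition polys :: "nat \<Rightarrow> (real^3 \<Rightarrow> real) set"
  where "polys r = {p. \<exists>c :: (3 \<Rightarrow> nat) \<Rightarrow> real.
    p = (\<lambda>y. \<Sum>\<alpha> | (\<Sum>i\<in>UNIV. \<alpha> i) \<le> r. c \<alpha> * (\<Prod>i\<in>UNIV. (y $ i) ^ \<alpha> i))}"

definition Pol :: "nat \<Rightarrow> (real^3) set \<Rightarrow> (real^3 \<Rightarrow> real) set"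
  where "Pol r S = restr S ` polys r"

definition vec3 :: "(real^3 \<Rightarrow> real) set \<Rightarrow> (real^3 \<Rightarrow> real^3) set"
  where "vec3 X = {f. \<forall>i. (\<lambda>y. f y $ i) \<in> X}"

definition M0 :: "nat \<Rightarrow> (nat \<Rightarrow> real^3) \<Rightarrow> (real^3 \<Rightarrow> real) set"
  where "M0 r x = {w. restr (tetra x) w = w \<and> continuous_on (tetra x) w \<and>
    (\<forall>i\<le>3. restr (alfeld x i) w \<in> Pol r (alfeld x i))}"

definition M1 :: "nat \<Rightarrow> (nat \<Rightarrow> real^3) \<Rightarrow> (real^3 \<Rightarrow> real^3) set"
  where "M1 r x = vec3 (M0 r x)"

definition M2 :: "nat \<Rightarrow> (nat \<Rightarrow> real^3) \<Rightarrow> (real^3 \<Rightarrow> real^3) set"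
  where "M2 r x = vec3 (M0 r x)"


subsection \<open>Piecewise differential operators\<close>

definition pd :: "3 \<Rightarrow> (real^3 \<Rightarrow> real) \<Rightarrow> real^3 \<Rightarrow> real"
  where "pd j f y = frechet_derivative f (at y) (axis j 1)"

text \<open>
  For a continuous piecewise polynomial field the weak curl and divergence are given almost
  everywhere by the classical ones on the open cells. The class is represented by its member
  vanishing off the open cells (whose complement in the tetrahedron is a null set).
\<close>

definition curl :: "(nat \<Rightarrow> real^3) \<Rightarrow> (real^3 \<Rightarrow> real^3) \<Rightarrow> real^3 \<Rightarrow> real^3"
  where "curl x w = restr (open_cells x) (\<lambda>y. vector
    [pd 2 (\<lambda>u. w u $ 3) y - pd 3 (\<lambda>u. w u $ 2) y,
     pd 3 (\<lambda>u. w u $ 1) y - pd 1 (\<lambda>u. w u $ 3) y,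
     pd 1 (\<lambda>u. w u $ 2) y - pd 2 (\<lambda>u. w u $ 1) y])"

definition div3 :: "(nat \<Rightarrow> real^3) \<Rightarrow> (real^3 \<Rightarrow> real^3) \<Rightarrow> real^3 \<Rightarrow> real"
  where "div3 x w = restr (open_cells x) (\<lambda>y. \<Sum>i\<in>UNIV. pd i (\<lambda>u. w u $ i) y)"

text \<open>
  The field \<open>g\<close> is the continuous representative of the curl; it is unique on the
  tetrahedron, since the open cells are dense there.
\<close>

definition M1d_bubble :: "nat \<Rightarrow> (nat \<Rightarrow> real^3) \<Rightarrow> (real^3 \<Rightarrow> real^3) set"
  where "M1d_bubble r x = {w \<in> M1 r x. \<exists>g.
    continuous_on (tetra x) g \<and> (\<forall>y\<in>open_cells x. g y = curl x w y) \<and>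
    (\<forall>y\<in>frontier (tetra x). w y = 0) \<and> (\<forall>y\<in>frontier (tetra x). g y = 0)}"

definition L2 :: "(real^3) set \<Rightarrow> (real^3 \<Rightarrow> real) set"
  where "L2 S = {f. f \<in> borel_measurable (lebesgue_on S) \<and>
    integrable (lebesgue_on S) (\<lambda>y. (f y)\<^sup>2)}"

text \<open>
  Every class of square integrable functions that are polynomial on each cell has exactly one
  representative that is polynomial on each open cell and vanishes off the open cells.
\<close>

definition V3d_bubble :: "nat \<Rightarrow> (nat \<Rightarrow> real^3) \<Rightarrow> (real^3 \<Rightarrow> real) set"
  where "V3d_bubble r x = {v \<in> L2 (tetra x). restr (open_cells x) v = v \<and>
    (\<forall>i\<le>3. restr (interior (alfeld x i)) v \<in> Pol r (interior (alfeld x i))) \<and>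
    (LINT y:tetra x|lebesgue. v y) = 0}"


subsection \<open>Edge and face integrals\<close>

text \<open>
  Arc length and surface integrals through the affine parametrization of the simplex; they do
  not depend on the order of its vertices.
\<close>

definition edge_integral :: "real^3 \<Rightarrow> real^3 \<Rightarrow> (real^3 \<Rightarrow> real) \<Rightarrow> real"
  where "edge_integral a b f =
    norm (b - a) * (LINT t:{0..1}|lborel. f (a + t *\<^sub>R (b - a)))"

definition face_integral :: "real^3 \<Rightarrow> real^3 \<Rightarrow> real^3 \<Rightarrow> (real^3 \<Rightarrow> real) \<Rightarrow> real"
  where "face_integral a b c f =
    norm (cross3 (b - a) (c - a)) *
    (LINT p:{p. 0 \<le> fst p \<and> 0 \<le> snd p \<and> fst p + snd p \<le> 1}|lborel.
       f (a + fst p *\<^sub>R (b - a) + snd p *\<^sub>R (c - a)))"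

text \<open>
  The edges \<open>[x i, x j]\<close> with \<open>i < j\<close> and the faces \<open>[x i, x j, x k]\<close> with \<open>i < j < k\<close>.
\<close>

definition edges :: "(nat \<times> nat) set"
  where "edges = {(i, j). i < j \<and> j \<le> 3}"

definition faces :: "(nat \<times> nat \<times> nat) set"
  where "faces = {(i, j, k). i < j \<and> j < k \<and> k \<le> 3}"

definition edge :: "(nat \<Rightarrow> real^3) \<Rightarrow> nat \<Rightarrow> nat \<Rightarrow> (real^3) set"
  where "edge x i j = convex hull {x i, x j}"

definition face :: "(nat \<Rightarrow> real^3) \<Rightarrow> nat \<Rightarrow> nat \<Rightarrow> nat \<Rightarrow> (real^3) set"
  where "face x i j k = convex hull {x i, x j, x k}"

end

theory Submission
  imports Defs "HOL-Computational_Algebra.Polynomial"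
begin

text \<open>
  Let \<open>\<lambda>\<^sub>0, \<dots>, \<lambda>\<^sub>3\<close> be the barycentric coordinates of the tetrahedron. Cell \<open>i\<close> of the Alfeld split is the part where
  \<open>\<lambda>\<^sub>i\<close> is the smallest of them, so the function \<open>\<mu> = min\<^sub>i \<lambda>\<^sub>i\<close> is \<open>\<lambda>\<^sub>i\<close> on cell \<open>i\<close>, and it vanishes on the boundary. A
  continuous piecewise polynomial is a family of four polynomials \<open>p\<^sub>i\<close> on the whole space with \<open>p\<^sub>i = p\<^sub>j\<close> on the
  plane \<open>\<lambda>\<^sub>i = \<lambda>\<^sub>j\<close>. It vanishes on the boundary (is a bubble) if and only if \<open>p\<^sub>i = \<lambda>\<^sub>i q\<^sub>i\<close> with another such family \<open>q\<close>.

  Unisolvence. Let \<open>u\<close> be the difference of two fields with equal degrees of freedom. A component of \<open>u\<close> vanishes at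
  the vertices, so on the edge between vertices \<open>a\<close> and \<open>b\<close> it has the form \<open>\<lambda>\<^sub>a \<lambda>\<^sub>b d\<close> with \<open>d\<close> of degree at most \<open>r - 4\<close>, and testing
  with \<open>d\<close> shows that it is zero there; the same argument applies to the faces (\<open>zero_on_edge\<close>, \<open>zero_on_face\<close>). So \<open>u\<close> is a bubble,
  and its divergence has mean zero and may be used as the test function in (e); hence \<open>div u = 0\<close>. By \<open>exactness\<close>, \<open>u\<close> is then the
  curl of a bubble, so \<open>u\<close> may be used as the test function in (d), and \<open>u = 0\<close>.

  Exactness (\<open>curl_onto\<close>). Powers of \<open>\<mu>\<close> are removed one at a time. Let \<open>\<mu>\<^sup>j p\<close> be divergence-free with \<open>j \<ge> 1\<close> and with
  continuous normal components across the interior faces; then \<open>p\<close> is tangential on the boundary. Suppose that a polynomial field \<open>v\<close>, the same on all cells, satisfies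
  \<open>(j + 1) \<nabla>\<lambda>\<^sub>i \<times> v = p\<^sub>i\<close> on face \<open>i\<close> for every \<open>i\<close>. Then \<open>\<mu>\<^sup>j p - curl (\<mu>\<^sup>j\<^sup>+\<^sup>1 v)\<close> is divisible by \<open>\<mu>\<^sup>j\<^sup>+\<^sup>1\<close>, and the degree of the
  quotient is smaller. To find \<open>v\<close> amounts to finding an antisymmetric matrix of polynomials of size four with zero row
  sums whose \<open>i\<close>-th row is prescribed modulo \<open>\<lambda>\<^sub>i\<close>. Continuity of the normal components makes the rows compatible on the
  edges, and a solution exists because the Koszul complex of the four coordinates is exact
  (\<open>tangential_lift\<close>, \<open>koszul\<close>).

  Dimensions. The same iteration shows that the divergence maps the bubbles onto the piecewise polynomials of mean zero
  (\<open>div_onto\<close>, \<open>div3_surjective\<close>): normal components on the four faces can be prescribed by one polynomial field if their sum is zero, and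
  every form of positive degree in the coordinates lies in the ideal generated by them. The curls in (d) are the
  divergence-free bubbles, so their dimension is the difference of two known ones. The dimension of the bubbles comes from Newton
  interpolation at the nodes \<open>\<lambda>\<^sub>0, \<dots>, \<lambda>\<^sub>3\<close> (\<open>bubbles_newton\<close>), and that of the polynomial spaces from Pascal's recursion.
\<close>

section \<open>Polynomials of bounded degree\<close>

text \<open>
  The polynomials of degree less than \<open>n\<close>. With this shift of the degree, the zero space is
  the case \<open>n = 0\<close>, and division by an affine function is always \<open>n\<close> to \<open>n - 1\<close> with truncated
  subtraction. The closure conditions give inductions that never mention coefficients.
\<close>

inductive plt :: "nat \<Rightarrow> (real^3 \<Rightarrow> real) \<Rightarrow> bool" where
  plt_zero: "plt n (\<lambda>y. 0)"
| plt_const: "plt (Suc n) (\<lambda>y. c)"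
| plt_add: "plt n p \<Longrightarrow> plt n q \<Longrightarrow> plt n (\<lambda>y. p y + q y)"
| plt_coord: "plt n p \<Longrightarrow> plt (Suc n) (\<lambda>y. y $ k * p y)"

lemma plt_0: "plt 0 p \<Longrightarrow> p y = 0"
proof -
  have "plt n p \<Longrightarrow> n = 0 \<Longrightarrow> p y = 0" for n
    by (induction rule: plt.induct) auto
  then show "plt 0 p \<Longrightarrow> p y = 0" by simp
qed

lemma plt_Suc: "plt n p \<Longrightarrow> plt (Suc n) p"
  by (induction rule: plt.induct) (auto intro: plt.intros)

lemma plt_mono: "plt m p \<Longrightarrow> m \<le> n \<Longrightarrow> plt n p"
  by (induction n) (auto simp: le_Suc_eq intro: plt_Suc)

lemma plt_cmult: "plt n p \<Longrightarrow> plt n (\<lambda>y. c * p y)"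
proof (induction rule: plt.induct)
  case (plt_add n p q)
  then show ?case using plt.plt_add by (simp add: distrib_left)
next
  case (plt_coord n p k)
  then show ?case using plt.plt_coord[of n "\<lambda>y. c * p y" k] by (simp add: mult.left_commute)
qed (auto intro: plt.intros)

lemma plt_minus: "plt n p \<Longrightarrow> plt n (\<lambda>y. - p y)"
  using plt_cmult[of n p "-1"] by simp

lemma plt_diff: "plt n p \<Longrightarrow> plt n q \<Longrightarrow> plt n (\<lambda>y. p y - q y)"
  using plt_add[OF _ plt_minus] by simp

lemma plt_sum: "(\<And>i. i \<in> I \<Longrightarrow> plt n (f i)) \<Longrightarrow> plt n (\<lambda>y. \<Sum>i\<in>I. f i y)"
  by (induction I rule: infinite_finite_induct) (auto intro: plt.intros)

lemma plt_mult_Suc: "plt m p \<Longrightarrow> plt (Suc n) q \<Longrightarrow> plt (m + n) (\<lambda>y. p y * q y)"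
proof (induction rule: plt.induct)
  case (plt_const m c)
  then show ?case using plt_mono[OF plt_cmult[of "Suc n" q c], of "Suc m + n"] by simp
next
  case (plt_add m p p')
  then show ?case using plt.plt_add[of "m+n" "\<lambda>y. p y * q y" "\<lambda>y. p' y * q y"]
    by (simp add: distrib_right)
next
  case (plt_coord m p k)
  then show ?case using plt.plt_coord[of "m+n" "\<lambda>y. p y * q y" k]
    by (simp add: mult.assoc)
qed (auto intro: plt.intros)

lemma plt_mult: "plt m p \<Longrightarrow> plt n q \<Longrightarrow> plt (m + n) (\<lambda>y. p y * q y)"
  using plt_mult_Suc[OF _ plt_Suc] by blast

definition affn :: "(real^3 \<Rightarrow> real) \<Rightarrow> bool"
  where "affn l \<longleftrightarrow> (\<exists>g c. l = (\<lambda>y. g \<bullet> y + c))"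

lemma inner_3: "(a::real^3) \<bullet> b = a$1*b$1 + a$2*b$2 + a$3*b$3"
  by (simp add: inner_vec_def sum_3)

lemma affn_plt_mult: assumes "affn l" "plt n p" shows "plt (Suc n) (\<lambda>y. l y * p y)"
proof -
  obtain g c where l: "l = (\<lambda>y. g \<bullet> y + c)" using assms(1) affn_def by auto
  have "plt (Suc n) (\<lambda>y. g$k * (y$k * p y))" for k
    by (intro plt_cmult plt_coord assms)
  from plt_add[OF plt_add[OF plt_add[OF this[of 1] this[of 2]] this[of 3]]
      plt_cmult[OF plt_Suc[OF assms(2)], of c]]
  show ?thesis unfolding l inner_3 by (simp add: algebra_simps)
qed

lemma affn_plt_mult': assumes "affn l" "plt (n - 1) p" shows "plt n (\<lambda>y. l y * p y)"
proof (cases n)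
  case 0
  then have "(\<lambda>y. l y * p y) = (\<lambda>y. 0)" using assms(2) plt_0 by auto
  then show ?thesis using plt_zero by simp
next
  case (Suc m) then show ?thesis using assms affn_plt_mult by simp
qed

lemma affn_plt: "affn l \<Longrightarrow> plt 2 l"
  using affn_plt_mult[of l 1 "\<lambda>y. 1"] plt_const[of 0 1] by (simp add: numeral_2_eq_2)

lemma affn_diff: "affn a \<Longrightarrow> affn b \<Longrightarrow> affn (\<lambda>y. a y - b y)"
proof -
  assume "affn a" "affn b"
  then obtain g c g' c' where e: "a = (\<lambda>y. g \<bullet> y + c)" "b = (\<lambda>y. g' \<bullet> y + c')"
    unfolding affn_def by blast
  have "(\<lambda>y. a y - b y) = (\<lambda>y. (g - g') \<bullet> y + (c - c'))"
    by (auto simp: e inner_diff_left)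
  then show ?thesis unfolding affn_def by blast
qed

lemma affn_cmult: "affn a \<Longrightarrow> affn (\<lambda>y. c * a y)"
  unfolding affn_def by (metis inner_scaleR_left distrib_left)

lemma affn_coord: "affn (\<lambda>y. y $ k)"
  unfolding affn_def by (metis add.right_neutral inner_axis' inner_real_def mult_1)

lemma affn_comb: "affn l \<Longrightarrow> l (a + t *\<^sub>R (b - a)) = l a + t * (l b - l a)"
  unfolding affn_def by (auto simp: inner_add_right inner_diff_right algebra_simps)

lemma continuous_affn: "affn l \<Longrightarrow> continuous_on S l"
  unfolding affn_def by (auto intro!: continuous_intros)

lemma plt_subst: "plt n p \<Longrightarrow> affn l \<Longrightarrow> plt n (\<lambda>y. p (y - l y *\<^sub>R d))"
proof (induction rule: plt.induct)
  case (plt_coord n p k)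
  have "affn (\<lambda>y. y $ k - d $ k * l y)"
    using affn_diff affn_coord affn_cmult plt_coord.prems by blast
  from affn_plt_mult[OF this plt_coord.IH[OF plt_coord.prems]]
  show ?case by (simp add: mult.commute)
qed (auto intro: plt.intros)

text \<open>
  The workhorse of all divisibility arguments: the value of a polynomial changes by a multiple of
  \<open>l y\<close> when the point is displaced by \<open>l y\<close> along \<open>d\<close>. If \<open>d\<close> is chosen so that the displaced point lies
  where \<open>p\<close> vanishes, this exhibits \<open>l\<close> as a factor of \<open>p\<close>.
\<close>

lemma plt_divide:
  "plt n p \<Longrightarrow> affn l \<Longrightarrow> \<exists>c. plt (n - 1) c \<and> (\<forall>y. p y - p (y - l y *\<^sub>R d) = l y * c y)"
proof (induction rule: plt.induct)
  case (plt_add n p q)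
  from plt_add.IH(1)[OF plt_add.prems]
  obtain c where c: "plt (n - 1) c" "\<And>y. p y - p (y - l y *\<^sub>R d) = l y * c y" by blast
  from plt_add.IH(2)[OF plt_add.prems]
  obtain c' where c': "plt (n - 1) c'" "\<And>y. q y - q (y - l y *\<^sub>R d) = l y * c' y" by blast
  have "p y + q y - (p (y - l y *\<^sub>R d) + q (y - l y *\<^sub>R d)) = l y * (c y + c' y)" for y
    unfolding distrib_left c(2)[symmetric] c'(2)[symmetric] by simp
  with plt.plt_add[OF c(1) c'(1)] show ?case by blast
next
  case (plt_coord n p k)
  then obtain c where c: "plt (n - 1) c" "\<And>y. p y - p (y - l y *\<^sub>R d) = l y * c y" by blast
  have "plt n (\<lambda>y. y $ k * c y + d $ k * p (y - l y *\<^sub>R d))"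
    by (intro plt.plt_add affn_plt_mult'[OF affn_coord] c plt_cmult plt_subst plt_coord)
  moreover have "y $ k * p y - (y - l y *\<^sub>R d) $ k * p (y - l y *\<^sub>R d)
     = l y * (y $ k * c y + d $ k * p (y - l y *\<^sub>R d))" for y
  proof -
    have "y $ k * p y - (y - l y *\<^sub>R d) $ k * p (y - l y *\<^sub>R d)
      = y $ k * (p y - p (y - l y *\<^sub>R d)) + l y * d $ k * p (y - l y *\<^sub>R d)"
      by (simp add: algebra_simps)
    then show ?thesis by (simp add: c algebra_simps)
  qed
  ultimately show ?case by auto
qed (simp_all add: exI[of _ "\<lambda>y. 0"] plt_zero)

lemma plt_line: "plt n p \<Longrightarrow> \<exists>q::real poly. \<forall>t. p (a + t *\<^sub>R b) = poly q t"
proof (induction rule: plt.induct)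
  case (plt_add n p q)
  then obtain f g where "\<forall>t. p (a + t *\<^sub>R b) = poly f t" "\<forall>t. q (a + t *\<^sub>R b) = poly g t" by blast
  then show ?case by (intro exI[of _ "f + g"]) auto
next
  case (plt_coord n p k)
  then obtain f where "\<forall>t. p (a + t *\<^sub>R b) = poly f t" by blast
  then show ?case by (intro exI[of _ "[:a$k, b$k:] * f"]) (auto simp: algebra_simps)
qed (auto intro: exI[of _ 0] exI[of _ "[:c:]" for c])

text \<open>
  On a line the polynomial becomes univariate, so infinitely many zeros suffice.
\<close>

lemma plt_zero_extend:
  assumes p: "plt n p" and e: "0 < e"
    and z: "\<And>t. 0 < t \<Longrightarrow> t < e \<Longrightarrow> p (a + t *\<^sub>R (y - a)) = 0"
  shows "p y = 0"
proof -
  obtain q :: "real poly" where q: "\<And>t. p (a + t *\<^sub>R (y - a)) = poly q t"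
    using plt_line[OF p] by blast
  have "{0<..<e} \<subseteq> {t. poly q t = 0}" using q z by auto
  moreover have "infinite {0<..<e}" using e by (simp add: infinite_Ioo)
  ultimately have "q = 0" using poly_roots_finite finite_subset by blast
  then show ?thesis using q[of 1] by simp
qed

text \<open>
  The factor \<open>l\<close> can vanish at most at the end point of the segment from \<open>a\<close>, so \<open>p\<close> vanishes on
  the rest of the segment. Only the line through \<open>a\<close> and \<open>y\<close> enters, so the lemma also applies on affine
  subspaces.
\<close>

lemma plt_cancel:
  assumes "plt n p" "affn l" "l a \<noteq> 0"
    and z: "\<And>t. l (a + t *\<^sub>R (y - a)) * p (a + t *\<^sub>R (y - a)) = 0"
  shows "p y = 0"
proof (cases "l y = 0")
  case True
  show ?thesis
  proof (rule plt_zero_extend[OF assms(1) zero_less_one])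
    fix t :: real assume "0 < t" "t < 1"
    moreover have "l (a + t *\<^sub>R (y - a)) = (1 - t) * l a"
      using affn_comb[OF assms(2)] True by (simp add: algebra_simps)
    ultimately show "p (a + t *\<^sub>R (y - a)) = 0"
      using z[of t] assms(3) by simp
  qed
qed (use z[of 1] in simp)

section \<open>Derivatives of polynomials\<close>

definition grad :: "(real^3 \<Rightarrow> real) \<Rightarrow> real^3 \<Rightarrow> real^3"
  where "grad f y = (\<chi> k. pd k f y)"

lemma pd_eqI: "(f has_derivative f') (at y) \<Longrightarrow> pd k f y = f' (axis k 1)"
  unfolding pd_def using frechet_derivative_at by metis

lemma pd_const [simp]: "pd k (\<lambda>y. c) y = 0"
  by (rule trans[OF pd_eqI[OF has_derivative_const]]) simp

lemma pd_const_fun: "pd k (\<lambda>y. c) = (\<lambda>y. 0)"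
  by auto

lemma pd_add: "f differentiable at y \<Longrightarrow> g differentiable at y \<Longrightarrow>
   pd k (\<lambda>y. f y + g y) y = pd k f y + pd k g y"
  by (subst pd_eqI[OF has_derivative_add[OF iffD1[OF frechet_derivative_works]
      iffD1[OF frechet_derivative_works]]]) (simp_all add: pd_def)

lemma pd_mult: "f differentiable at y \<Longrightarrow> g differentiable at y \<Longrightarrow>
   pd k (\<lambda>y. f y * g y) y = pd k f y * g y + f y * pd k g y"
  by (subst pd_eqI[OF has_derivative_mult[OF iffD1[OF frechet_derivative_works]
      iffD1[OF frechet_derivative_works]]]) (simp_all add: pd_def)

lemma pd_affn: "pd k (\<lambda>y. g \<bullet> y + c) y = g $ k"
  by (subst pd_eqI[of _ "\<lambda>y. g \<bullet> y"]) (auto intro!: derivative_eq_intros simp: inner_axis)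

lemma pd_coord: "pd k (\<lambda>y. y $ j) y = (if j = k then 1 else 0)"
proof -
  have "((\<lambda>y. y $ j) has_derivative (\<lambda>y. y $ j)) (at y)"
    by (simp add: bounded_linear_vec_nth bounded_linear_imp_has_derivative)
  from pd_eqI[OF this] show ?thesis by (auto simp: axis_def)
qed

lemma differentiable_coord: "(\<lambda>y::real^3. y $ k) differentiable at y"
  using bounded_linear_vec_nth bounded_linear_imp_differentiable by blast

lemma plt_differentiable: "plt n p \<Longrightarrow> p differentiable at y"
  by (induction rule: plt.induct) (auto intro: differentiable_coord differentiable_mult)

lemma plt_continuous: "plt n p \<Longrightarrow> continuous_on S p"
  by (intro continuous_at_imp_continuous_on ballI differentiable_imp_continuous_within
      plt_differentiable)

lemma plt_pd: "plt n p \<Longrightarrow> plt (n - 1) (pd k p)"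
proof (induction rule: plt.induct)
  case (plt_add n p q)
  then have "pd k (\<lambda>y. p y + q y) = (\<lambda>y. pd k p y + pd k q y)"
    by (auto simp: pd_add plt_differentiable)
  then show ?case using plt_add plt.plt_add by simp
next
  case (plt_coord n p j)
  then have "pd k (\<lambda>y. y $ j * p y) = (\<lambda>y. (if j = k then 1 else 0) * p y + y $ j * pd k p y)"
    by (auto simp: pd_mult pd_coord plt_differentiable differentiable_coord)
  then show ?case
    using plt_add[OF plt_cmult[OF plt_coord.hyps] affn_plt_mult'[OF affn_coord plt_coord.IH]] by simp
qed (simp_all add: pd_const_fun plt_zero)

text \<open>
  Needed for the identity that the divergence of a curl vanishes.
\<close>

lemma plt_pd_commute: "plt n p \<Longrightarrow> pd j (pd k p) y = pd k (pd j p) y"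
proof (induction arbitrary: y rule: plt.induct)
  case (plt_add n p q)
  then have e: "pd k (\<lambda>y. p y + q y) = (\<lambda>y. pd k p y + pd k q y)" for k
    by (auto simp: pd_add plt_differentiable)
  show ?case using plt_add
    by (simp add: e pd_add plt_differentiable[OF plt_pd])
next
  case (plt_coord n p i)
  then have e: "pd k (\<lambda>y. y $ i * p y) = (\<lambda>y. (if i = k then 1 else 0) * p y + y $ i * pd k p y)" for k
    by (auto simp: pd_mult pd_coord plt_differentiable differentiable_coord)
  have d: "p differentiable at y" "pd k p differentiable at y" for k y
    using plt_coord plt_differentiable plt_pd by blast+
  show ?case using plt_coord
    by (simp add: e pd_add pd_mult d differentiable_coord pd_coord)
qed (simp_all add: pd_const_fun)

section \<open>Polynomials given by coefficients\<close>

lemma finite_exponents: "finite {\<alpha> :: 3 \<Rightarrow> nat. (\<Sum>i\<in>UNIV. \<alpha> i) \<le> r}"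
proof (rule finite_subset)
  show "{\<alpha> :: 3 \<Rightarrow> nat. (\<Sum>i\<in>UNIV. \<alpha> i) \<le> r} \<subseteq> PiE UNIV (\<lambda>_. {..r})"
  proof
    fix \<alpha> :: "3 \<Rightarrow> nat" assume *: "\<alpha> \<in> {\<alpha>. (\<Sum>i\<in>UNIV. \<alpha> i) \<le> r}"
    have "\<alpha> i \<le> r" for i
      using member_le_sum[of i UNIV \<alpha>] * by simp
    then show "\<alpha> \<in> PiE UNIV (\<lambda>_. {..r})" by auto
  qed
  show "finite (PiE (UNIV :: 3 set) (\<lambda>_. {..r}))" by (intro finite_PiE) auto
qed

lemma plt_monomial: "plt (Suc (\<Sum>i\<in>UNIV. \<alpha> i)) (\<lambda>y. \<Prod>i\<in>UNIV. (y $ i) ^ \<alpha> i)"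
proof -
  have pw: "plt (Suc m) (\<lambda>y. (y $ k) ^ m)" for k m
    by (induction m) (auto intro: plt.intros)
  have "plt (Suc (\<alpha> 1) + \<alpha> 2 + \<alpha> 3) (\<lambda>y. (y $ 1) ^ \<alpha> 1 * (y $ 2) ^ \<alpha> 2 * (y $ 3) ^ \<alpha> 3)"
    by (intro plt_mult_Suc pw)
  moreover have "(\<Prod>i\<in>UNIV. (y $ i) ^ \<alpha> i) = (y $ 1) ^ \<alpha> 1 * (y $ 2) ^ \<alpha> 2 * (y $ 3) ^ \<alpha> 3" for y :: "real^3"
    unfolding UNIV_3 by (simp add: mult.assoc)
  ultimately show ?thesis by (simp add: sum_3)
qed

lemma plt_imp_polys: "plt n p \<Longrightarrow> n \<le> Suc r \<Longrightarrow> p \<in> polys r"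
proof (induction arbitrary: r rule: plt.induct)
  case (plt_const n c)
  let ?z = "\<lambda>i::3. 0::nat"
  have "(\<Sum>\<alpha> | (\<Sum>i\<in>UNIV. \<alpha> i) \<le> r. (if \<alpha> = ?z then c else 0) * (\<Prod>i\<in>UNIV. (y $ i) ^ \<alpha> i)) = c"
    for y :: "real^3"
    by (subst sum.remove[OF finite_exponents, of ?z]) (auto intro!: sum.neutral)
  then have "(\<lambda>y. c) = (\<lambda>y. \<Sum>\<alpha> | (\<Sum>i\<in>UNIV. \<alpha> i) \<le> r. (if \<alpha> = ?z then c else 0) * (\<Prod>i\<in>UNIV. (y $ i) ^ \<alpha> i))"
    by simp
  then show ?case unfolding polys_def by (intro CollectI exI)
next
  case (plt_add n p q)
  then obtain c d where "p = (\<lambda>y. \<Sum>\<alpha> | (\<Sum>i\<in>UNIV. \<alpha> i) \<le> r. c \<alpha> * (\<Prod>i\<in>UNIV. (y $ i) ^ \<alpha> i))"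
    "q = (\<lambda>y. \<Sum>\<alpha> | (\<Sum>i\<in>UNIV. \<alpha> i) \<le> r. d \<alpha> * (\<Prod>i\<in>UNIV. (y $ i) ^ \<alpha> i))"
    unfolding polys_def by blast
  then have "(\<lambda>y. p y + q y) = (\<lambda>y. \<Sum>\<alpha> | (\<Sum>i\<in>UNIV. \<alpha> i) \<le> r. (c \<alpha> + d \<alpha>) * (\<Prod>i\<in>UNIV. (y $ i) ^ \<alpha> i))"
    by (auto simp: distrib_right sum.distrib)
  then show ?case unfolding polys_def by (intro CollectI exI[of _ "\<lambda>\<alpha>. c \<alpha> + d \<alpha>"])
next
  case (plt_coord n p k)
  show ?case
  proof (cases r)
    case 0
    then have "(\<lambda>y. y $ k * p y) = (\<lambda>y. 0)" using plt_coord plt_0 by auto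
    moreover have "(\<lambda>y. 0) \<in> polys r" unfolding polys_def
      by (intro CollectI exI[of _ "\<lambda>_. 0"]) simp
    ultimately show ?thesis by simp
  next
    case (Suc s)
    then obtain c where c: "p = (\<lambda>y. \<Sum>\<alpha> | (\<Sum>i\<in>UNIV. \<alpha> i) \<le> s. c \<alpha> * (\<Prod>i\<in>UNIV. (y $ i) ^ \<alpha> i))"
      using plt_coord.IH[of s] plt_coord.prems unfolding polys_def by auto
    let ?up = "\<lambda>\<alpha>::3\<Rightarrow>nat. \<alpha>(k := Suc (\<alpha> k))"
    let ?c = "\<lambda>\<alpha>::3\<Rightarrow>nat. if \<alpha> k = 0 then 0 else c (\<alpha>(k := \<alpha> k - 1))"
    have s1: "(\<Sum>i\<in>UNIV. (?up \<alpha>) i) = Suc (\<Sum>i\<in>UNIV. \<alpha> i)" for \<alpha>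
      by (simp add: sum.remove[of UNIV k])
    have m1: "(\<Prod>i\<in>UNIV. (y $ i) ^ (?up \<alpha>) i) = y $ k * (\<Prod>i\<in>UNIV. (y $ i) ^ \<alpha> i)" for \<alpha> and y :: "real^3"
      by (simp add: prod.remove[of UNIV k] mult.assoc)
    have inj: "inj_on ?up A" for A
      by (rule inj_onI) (metis Suc_inject fun_upd_idem_iff fun_upd_same fun_upd_triv fun_upd_upd)
    have "y $ k * p y = (\<Sum>\<alpha> | (\<Sum>i\<in>UNIV. \<alpha> i) \<le> r. ?c \<alpha> * (\<Prod>i\<in>UNIV. (y $ i) ^ \<alpha> i))" for y
    proof -
      have "y $ k * p y = (\<Sum>\<alpha> | (\<Sum>i\<in>UNIV. \<alpha> i) \<le> s. ?c (?up \<alpha>) * (\<Prod>i\<in>UNIV. (y $ i) ^ (?up \<alpha>) i))"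
        unfolding m1 by (simp add: c sum_distrib_left mult.left_commute)
      also have "\<dots> = (\<Sum>\<alpha>\<in>?up ` {\<alpha>. (\<Sum>i\<in>UNIV. \<alpha> i) \<le> s}. ?c \<alpha> * (\<Prod>i\<in>UNIV. (y $ i) ^ \<alpha> i))"
        by (subst sum.reindex[OF inj]) simp
      also have "\<dots> = (\<Sum>\<alpha> | (\<Sum>i\<in>UNIV. \<alpha> i) \<le> r. ?c \<alpha> * (\<Prod>i\<in>UNIV. (y $ i) ^ \<alpha> i))"
      proof (rule sum.mono_neutral_left[OF finite_exponents])
        show "?up ` {\<alpha>. (\<Sum>i\<in>UNIV. \<alpha> i) \<le> s} \<subseteq> {\<alpha>. (\<Sum>i\<in>UNIV. \<alpha> i) \<le> r}"
          using s1 Suc by auto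
        have "?c \<alpha> = 0" if "(\<Sum>i\<in>UNIV. \<alpha> i) \<le> r" "\<alpha> \<notin> ?up ` {\<alpha>. (\<Sum>i\<in>UNIV. \<alpha> i) \<le> s}" for \<alpha>
        proof (rule ccontr)
          assume "\<not> ?thesis"
          then have k: "\<alpha> k \<noteq> 0" by (auto split: if_splits)
          then have e: "?up (\<alpha>(k := \<alpha> k - 1)) = \<alpha>" by (auto simp: fun_eq_iff)
          have "Suc (\<Sum>i\<in>UNIV. (\<alpha>(k := \<alpha> k - 1)) i) \<le> Suc s"
            using s1[of "\<alpha>(k := \<alpha> k - 1)"] that(1) Suc unfolding e by simp
          then have "(\<Sum>i\<in>UNIV. (\<alpha>(k := \<alpha> k - 1)) i) \<le> s" by simp
          then have "?up (\<alpha>(k := \<alpha> k - 1)) \<in> ?up ` {\<alpha>. (\<Sum>i\<in>UNIV. \<alpha> i) \<le> s}" by (intro imageI CollectI)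
          with e that(2) show False by simp
        qed
        then show "\<forall>\<alpha>\<in>{\<alpha>. (\<Sum>i\<in>UNIV. \<alpha> i) \<le> r} - ?up ` {\<alpha>. (\<Sum>i\<in>UNIV. \<alpha> i) \<le> s}.
            ?c \<alpha> * (\<Prod>i\<in>UNIV. (y $ i) ^ \<alpha> i) = 0" by simp
      qed
      finally show ?thesis .
    qed
    from ext[OF this] show ?thesis unfolding polys_def by (intro CollectI exI[of _ ?c])
  qed
next
  case (plt_zero n)
  show ?case unfolding polys_def by (intro CollectI exI[of _ "\<lambda>_. 0"]) simp
qed

text \<open>
  The inductive description agrees with the one by coefficients: the monomials of degree at most
  \<open>r\<close> are built by multiplication with coordinates, and conversely multiplication by a coordinate is a
  shift of the exponents.
\<close>

lemma polys_iff_plt: "p \<in> polys r \<longleftrightarrow> plt (Suc r) p"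
proof
  assume "p \<in> polys r"
  then obtain c where c: "p = (\<lambda>y. \<Sum>\<alpha> | (\<Sum>i\<in>UNIV. \<alpha> i) \<le> r. c \<alpha> * (\<Prod>i\<in>UNIV. (y $ i) ^ \<alpha> i))"
    unfolding polys_def by blast
  show "plt (Suc r) p" unfolding c
    by (intro plt_sum plt_cmult plt_mono[OF plt_monomial]) auto
qed (simp add: plt_imp_polys)

section \<open>Dimensions of function spaces\<close>

text \<open>
  A basis is kept as a sequence, which makes rank and nullity a matter of concatenation. The spaces
  in question are subspaces of the infinite-dimensional space of all functions, where finite
  dimension has to be part of the statement.
\<close>

definition has_dim :: "'v::real_vector set \<Rightarrow> nat \<Rightarrow> bool"
  where "has_dim S n \<longleftrightarrow> (\<exists>b. S = {\<Sum>i<n. c i *\<^sub>R b i | c :: nat \<Rightarrow> real. True} \<and>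
    (\<forall>c. (\<Sum>i<n. c i *\<^sub>R b i) = 0 \<longrightarrow> (\<forall>i<n. c i = (0::real))))"

lemma has_dim_basis:
  assumes "has_dim S n"
  obtains B where "finite B" "card B = n" "independent B" "span B = S"
proof -
  obtain b where S: "S = {\<Sum>i<n. c i *\<^sub>R b i | c :: nat \<Rightarrow> real. True}"
    and ind: "\<And>c i. (\<Sum>i<n. c i *\<^sub>R b i) = 0 \<Longrightarrow> i < n \<Longrightarrow> c i = (0::real)"
    using assms unfolding has_dim_def by blast
  have inj: "inj_on b {..<n}"
  proof (rule inj_onI)
    fix i j assume ij: "i \<in> {..<n}" "j \<in> {..<n}" "b i = b j"
    show "i = j"
    proof (rule ccontr)
      assume "i \<noteq> j"
      let ?c = "\<lambda>k. if k = i then 1 else if k = j then -1 else 0 :: real"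
      have "(\<Sum>k<n. ?c k *\<^sub>R b k) = (\<Sum>k\<in>{i, j}. ?c k *\<^sub>R b k)"
        using ij by (intro sum.mono_neutral_right) auto
      also have "\<dots> = 0" using \<open>i \<noteq> j\<close> ij by simp
      finally have "?c i = 0" using ind[of ?c i] ij by blast
      then show False by simp
    qed
  qed
  have s: "(\<Sum>v\<in>b ` {..<n}. u v *\<^sub>R v) = (\<Sum>i<n. u (b i) *\<^sub>R b i)" for u :: "'a \<Rightarrow> real"
    by (subst sum.reindex[OF inj]) simp
  have "independent (b ` {..<n})"
    by (rule independent_if_scalars_zero) (auto simp: s dest: ind)
  moreover have "span (b ` {..<n}) = S"
  proof -
    have "\<exists>u. (\<Sum>i<n. c i *\<^sub>R b i) = (\<Sum>i<n. u (b i) *\<^sub>R b i)" for c :: "nat \<Rightarrow> real"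
      by (rule exI[of _ "\<lambda>v. c (the_inv_into {..<n} b v)"], rule sum.cong)
        (auto simp: the_inv_into_f_f[OF inj])
    then show ?thesis unfolding S span_finite[OF finite_imageI[OF finite_lessThan]] s by (auto; metis)
  qed
  ultimately show ?thesis using that[of "b ` {..<n}"] card_image[OF inj] by simp
qed

lemma has_dim_dim: "has_dim S n \<Longrightarrow> dim S = n"
  by (metis has_dim_basis dim_span_eq_card_independent)

lemma has_dim_unique: "has_dim S m \<Longrightarrow> has_dim S n \<Longrightarrow> m = n"
  using has_dim_dim by blast

lemma has_dim_span: assumes "finite B" "independent B" shows "has_dim (span B) (card B)"
proof -
  obtain b where b: "bij_betw b {0..<card B} B" using ex_bij_betw_nat_finite[OF assms(1)] by blast
  then have b: "bij_betw b {..<card B} B" by (simp add: lessThan_atLeast0)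
  then have inj: "inj_on b {..<card B}" and im: "b ` {..<card B} = B" by (auto simp: bij_betw_def)
  have s: "(\<Sum>v\<in>B. u v *\<^sub>R v) = (\<Sum>i<card B. u (b i) *\<^sub>R b i)" for u :: "'a \<Rightarrow> real"
    using sum.reindex[OF inj, of "\<lambda>v. u v *\<^sub>R v"] im by simp
  have t: "\<exists>u. (\<forall>i<card B. u (b i) = c i)" for c :: "nat \<Rightarrow> real"
    by (rule exI[of _ "\<lambda>v. c (the_inv_into {..<card B} b v)"]) (auto simp: the_inv_into_f_f[OF inj])
  have t': "\<exists>u. (\<Sum>i<card B. c i *\<^sub>R b i) = (\<Sum>v\<in>B. u v *\<^sub>R v) \<and> (\<forall>i<card B. u (b i) = c i)"
    for c :: "nat \<Rightarrow> real"
  proof -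
    obtain u where "\<forall>i<card B. u (b i) = c i" using t by blast
    then show ?thesis unfolding s by (intro exI[of _ u]) auto
  qed
  have "span B = {\<Sum>i<card B. c i *\<^sub>R b i | c :: nat \<Rightarrow> real. True}"
  proof (intro equalityI subsetI)
    fix v assume "v \<in> span B"
    then show "v \<in> {\<Sum>i<card B. c i *\<^sub>R b i | c :: nat \<Rightarrow> real. True}"
      unfolding span_finite[OF assms(1)] s by auto
  next
    fix v assume "v \<in> {\<Sum>i<card B. c i *\<^sub>R b i | c :: nat \<Rightarrow> real. True}"
    then obtain c where "v = (\<Sum>i<card B. c i *\<^sub>R b i)" by blast
    with t'[of c] show "v \<in> span B" unfolding span_finite[OF assms(1)] by auto
  qed
  moreover have "c i = 0" if "(\<Sum>i<card B. c i *\<^sub>R b i) = 0" "i < card B" for c :: "nat \<Rightarrow> real" and i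
  proof -
    obtain u where u': "(\<Sum>i<card B. c i *\<^sub>R b i) = (\<Sum>v\<in>B. u v *\<^sub>R v) \<and> (\<forall>i<card B. u (b i) = c i)"
      using t'[of c] ..
    then have u: "(\<Sum>v\<in>B. u v *\<^sub>R v) = 0" "\<forall>i<card B. u (b i) = c i" using that(1) by auto
    have "b i \<in> B" using im that(2) by auto
    then have "u (b i) = 0" using independentD[OF assms(2) assms(1) order_refl u(1)] by blast
    then show ?thesis using u(2) that(2) by simp
  qed
  ultimately show ?thesis unfolding has_dim_def by blast
qed

lemma has_dim_subspace:
  assumes "has_dim S n" "subspace K" "K \<subseteq> S" obtains m where "has_dim K m"
proof -
  obtain A where A: "finite A" "span A = S" using has_dim_basis[OF assms(1)] by metis
  obtain B where B: "B \<subseteq> K" "independent B" "K \<subseteq> span B"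
    using maximal_independent_subset by blast
  have "finite B" using independent_span_bound[OF A(1) B(2)] A(2) B(1) assms(3) by blast
  moreover have "span B = K" using B assms(2) span_minimal by blast
  ultimately show ?thesis using has_dim_span[OF _ B(2)] that by metis
qed

text \<open>
  Differentiation and integration are linear only where derivatives and integrals exist, so
  linearity is required on a subspace only.
\<close>

definition linear_on :: "'v::real_vector set \<Rightarrow> ('v \<Rightarrow> 'w::real_vector) \<Rightarrow> bool"
  where "linear_on S f \<longleftrightarrow> subspace S \<and> (\<forall>u\<in>S. \<forall>v\<in>S. f (u + v) = f u + f v) \<and>
    (\<forall>u\<in>S. \<forall>c. f (c *\<^sub>R u) = c *\<^sub>R f u)"

lemma linear_on_zero: "linear_on S f \<Longrightarrow> f 0 = 0"
  unfolding linear_on_def by (metis scaleR_zero_left subspace_0)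

lemma linear_on_sum:
  fixes n :: nat
  assumes "linear_on S f" "\<And>i. i < n \<Longrightarrow> b i \<in> S"
  shows "(\<Sum>i<n. c i *\<^sub>R b i) \<in> S \<and> f (\<Sum>i<n. c i *\<^sub>R b i) = (\<Sum>i<n. c i *\<^sub>R f (b i))"
  using assms(2)
proof (induction n)
  case 0 then show ?case using linear_on_zero[OF assms(1)] assms(1) by (simp add: linear_on_def subspace_0)
next
  case (Suc n)
  then have "(\<Sum>i<n. c i *\<^sub>R b i) \<in> S" "c n *\<^sub>R b n \<in> S" "b n \<in> S"
    using assms(1) by (auto simp: linear_on_def subspace_scale)
  then show ?case using Suc assms(1) by (simp add: linear_on_def subspace_add)
qed

lemma has_dim_member:
  fixes b :: "nat \<Rightarrow> 'v::real_vector"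
  assumes "S = {\<Sum>i<n. c i *\<^sub>R b i | c :: nat \<Rightarrow> real. True}" "i < n" shows "b i \<in> S"
proof -
  have "(\<Sum>j<n. (if j = i then 1 else 0) *\<^sub>R b j) = (\<Sum>j\<in>{i}. (if j = i then 1 else 0::real) *\<^sub>R b j)"
    using assms(2) by (intro sum.mono_neutral_right) auto
  then have "b i = (\<Sum>j<n. (if j = i then 1 else 0) *\<^sub>R b j)" by simp
  then show ?thesis unfolding assms(1)
    by (intro CollectI exI[of _ "\<lambda>j. if j = i then 1 else 0"] conjI TrueI)
qed

lemma has_dim_image:
  assumes "has_dim S n" "linear_on S f" "\<And>u. u \<in> S \<Longrightarrow> f u = 0 \<Longrightarrow> u = 0"
  shows "has_dim (f ` S) n"
proof -
  obtain b where S: "S = {\<Sum>i<n. c i *\<^sub>R b i | c :: nat \<Rightarrow> real. True}"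
    and ind: "\<And>c i. (\<Sum>i<n. c i *\<^sub>R b i) = 0 \<Longrightarrow> i < n \<Longrightarrow> c i = (0::real)"
    using assms(1) unfolding has_dim_def by blast
  have b: "b i \<in> S" if "i < n" for i using has_dim_member[OF S that] .
  have l: "(\<Sum>i<n. c i *\<^sub>R b i) \<in> S" "f (\<Sum>i<n. c i *\<^sub>R b i) = (\<Sum>i<n. c i *\<^sub>R f (b i))" for c
    using linear_on_sum[OF assms(2), of n b c] b by blast+
  have "f ` S = {\<Sum>i<n. c i *\<^sub>R f (b i) | c :: nat \<Rightarrow> real. True}"
  proof (intro equalityI subsetI)
    fix w assume "w \<in> f ` S"
    then obtain c where "w = f (\<Sum>i<n. c i *\<^sub>R b i)" using S by blast
    then show "w \<in> {\<Sum>i<n. c i *\<^sub>R f (b i) | c :: nat \<Rightarrow> real. True}" using l by blast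
  next
    fix w assume "w \<in> {\<Sum>i<n. c i *\<^sub>R f (b i) | c :: nat \<Rightarrow> real. True}"
    then obtain c where "w = (\<Sum>i<n. c i *\<^sub>R f (b i))" by blast
    then show "w \<in> f ` S" using l by (metis imageI)
  qed
  moreover have "c i = 0" if "(\<Sum>i<n. c i *\<^sub>R f (b i)) = 0" "i < n" for c :: "nat \<Rightarrow> real" and i
    using ind[OF assms(3)[OF l(1)]] l(2) that by metis
  ultimately show ?thesis unfolding has_dim_def by (intro exI[of _ "\<lambda>i. f (b i)"]) blast
qed

lemma sum_lessThan_add: "(\<Sum>i<a+b. g i) = (\<Sum>i<a. g i) + (\<Sum>i<b. g (a + i))"
  for g :: "nat \<Rightarrow> 'a::comm_monoid_add"
  by (induction b) (auto simp: add.assoc)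

text \<open>
  A basis of the kernel followed by preimages of a basis of the image is a basis.
\<close>

lemma has_dim_rank_nullity:
  assumes f: "linear_on S f" and ker: "has_dim {u\<in>S. f u = 0} a" and im: "has_dim (f ` S) b"
  shows "has_dim S (a + b)"
proof -
  obtain k where K: "{u\<in>S. f u = 0} = {\<Sum>i<a. c i *\<^sub>R k i | c :: nat \<Rightarrow> real. True}"
    and k: "\<And>c i. (\<Sum>i<a. c i *\<^sub>R k i) = 0 \<Longrightarrow> i < a \<Longrightarrow> c i = (0::real)"
    using ker unfolding has_dim_def by blast
  obtain w where W: "f ` S = {\<Sum>i<b. c i *\<^sub>R w i | c :: nat \<Rightarrow> real. True}"
    and w: "\<And>c i. (\<Sum>i<b. c i *\<^sub>R w i) = 0 \<Longrightarrow> i < b \<Longrightarrow> c i = (0::real)"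
    using im unfolding has_dim_def by blast
  have "\<forall>i. \<exists>u. i < b \<longrightarrow> u \<in> S \<and> f u = w i"
    using has_dim_member[OF W] by (metis imageE)
  then obtain u where u: "\<And>i. i < b \<Longrightarrow> u i \<in> S" "\<And>i. i < b \<Longrightarrow> f (u i) = w i" by metis
  have kS: "k i \<in> S" "f (k i) = 0" if "i < a" for i using has_dim_member[OF K that] by auto
  define B where "B i = (if i < a then k i else u (i - a))" for i
  have BS: "B i \<in> S" if "i < a + b" for i using that kS u by (auto simp: B_def)
  have l: "(\<Sum>i<a+b. c i *\<^sub>R B i) \<in> S" for c
    using linear_on_sum[OF f, of "a + b" B c] BS by blast
  have split: "(\<Sum>i<a+b. c i *\<^sub>R B i) = (\<Sum>i<a. c i *\<^sub>R k i) + (\<Sum>i<b. c (a + i) *\<^sub>R u i)" for c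
    unfolding sum_lessThan_add by (simp add: B_def)
  have fB: "f (\<Sum>i<a+b. c i *\<^sub>R B i) = (\<Sum>i<b. c (a + i) *\<^sub>R w i)" for c
  proof -
    have "f (\<Sum>i<a+b. c i *\<^sub>R B i) = (\<Sum>i<a+b. c i *\<^sub>R f (B i))"
      using linear_on_sum[OF f, of "a + b" B c] BS by blast
    also have "\<dots> = (\<Sum>i<b. c (a + i) *\<^sub>R w i)"
      unfolding sum_lessThan_add using kS u by (simp add: B_def)
    finally show ?thesis .
  qed
  have "S = {\<Sum>i<a+b. c i *\<^sub>R B i | c :: nat \<Rightarrow> real. True}"
  proof (intro equalityI subsetI)
    fix v assume v: "v \<in> S"
    then have "f v \<in> f ` S" by blast
    then obtain c where c: "f v = (\<Sum>i<b. c i *\<^sub>R w i)" unfolding W by blast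
    define v' where "v' = (\<Sum>i<b. c i *\<^sub>R u i)"
    have v': "v' \<in> S" "f v' = f v" using linear_on_sum[OF f, of b u c] u by (auto simp: v'_def c)
    have m: "(-1) *\<^sub>R v' \<in> S" using f v' subspace_scale unfolding linear_on_def by blast
    then have "v + (-1) *\<^sub>R v' \<in> S" using f v subspace_add unfolding linear_on_def by blast
    moreover have "f (v + (-1) *\<^sub>R v') = f v + (-1) *\<^sub>R f v'"
      using f v v'(1) m unfolding linear_on_def by metis
    then have "f (v + (-1) *\<^sub>R v') = 0" using v'(2) by simp
    ultimately have "v - v' \<in> {u\<in>S. f u = 0}" by simp
    then obtain d where d: "v - v' = (\<Sum>i<a. d i *\<^sub>R k i)" unfolding K by blast
    have "v = (\<Sum>i<a+b. (if i < a then d i else c (i - a)) *\<^sub>R B i)"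
      unfolding split using d by (simp add: v'_def diff_eq_eq)
    then show "v \<in> {\<Sum>i<a+b. c i *\<^sub>R B i | c :: nat \<Rightarrow> real. True}"
      by (intro CollectI exI[of _ "\<lambda>i. if i < a then d i else c (i - a)"] conjI TrueI)
  qed (use l in blast)
  moreover have "c i = 0" if z: "(\<Sum>i<a+b. c i *\<^sub>R B i) = 0" and i: "i < a + b" for c :: "nat \<Rightarrow> real" and i
  proof -
    have "(\<Sum>i<b. c (a + i) *\<^sub>R w i) = 0" using fB[of c] z linear_on_zero[OF f] by simp
    then have cb: "c (a + i) = 0" if "i < b" for i using w[of "\<lambda>i. c (a + i)"] that by blast
    then have "(\<Sum>i<a. c i *\<^sub>R k i) = 0" using z unfolding split by simp
    then have "c i = 0" if "i < a" for i using k that by blast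
    then show ?thesis using cb[of "i - a"] i by (cases "i < a") auto
  qed
  ultimately show ?thesis unfolding has_dim_def by blast
qed

lemma has_dim_0: "has_dim {0} 0"
  unfolding has_dim_def by auto

lemma has_dim_subspace_of: "has_dim S n \<Longrightarrow> subspace S"
  by (metis has_dim_basis subspace_span)

lemma has_dim_kernel:
  assumes f: "linear_on S f" and "has_dim S n" "has_dim (f ` S) b"
  shows "has_dim {u\<in>S. f u = 0} (n - b)" "b \<le> n"
proof -
  have "subspace {u\<in>S. f u = 0}"
    using f linear_on_zero[OF f] unfolding linear_on_def subspace_def by auto
  then obtain m where m: "has_dim {u\<in>S. f u = 0} m"
    using has_dim_subspace[OF assms(2), of "{u\<in>S. f u = 0}"] by blast
  have "n = m + b" using has_dim_unique[OF assms(2) has_dim_rank_nullity[OF f m assms(3)]] .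
  then show "has_dim {u\<in>S. f u = 0} (n - b)" "b \<le> n" using m by auto
qed

lemma has_dim_Times:
  assumes "has_dim S a" "has_dim T b" shows "has_dim (S \<times> T) (b + a)"
proof (rule has_dim_rank_nullity[where f = fst])
  have S: "subspace S" and T: "subspace T" using assms has_dim_subspace_of by blast+
  then show "linear_on (S \<times> T) fst"
    unfolding linear_on_def by (auto simp: subspace_Times)
  have "fst ` (S \<times> T) = S" using subspace_0[OF T] by auto
  then show "has_dim (fst ` (S \<times> T)) a" using assms by simp
  have "{u \<in> S \<times> T. fst u = 0} = (\<lambda>t. (0, t)) ` T" using subspace_0[OF S] by auto
  moreover have "has_dim ((\<lambda>t. (0::'a, t)) ` T) b"
    by (rule has_dim_image[OF assms(2)]) (auto simp: linear_on_def T zero_prod_def)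
  ultimately show "has_dim {u \<in> S \<times> T. fst u = 0} b" by simp
qed

section \<open>Polynomial vector fields\<close>

declare One_nat_def [simp del]

definition vplt :: "nat \<Rightarrow> (real^3 \<Rightarrow> real^3) \<Rightarrow> bool"
  where "vplt n v \<longleftrightarrow> (\<forall>k. plt n (\<lambda>y. v y $ k))"

definition vcurl :: "(real^3 \<Rightarrow> real^3) \<Rightarrow> real^3 \<Rightarrow> real^3"
  where "vcurl w y = vector
    [pd 2 (\<lambda>u. w u $ 3) y - pd 3 (\<lambda>u. w u $ 2) y,
     pd 3 (\<lambda>u. w u $ 1) y - pd 1 (\<lambda>u. w u $ 3) y,
     pd 1 (\<lambda>u. w u $ 2) y - pd 2 (\<lambda>u. w u $ 1) y]"

definition vdiv :: "(real^3 \<Rightarrow> real^3) \<Rightarrow> real^3 \<Rightarrow> real"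
  where "vdiv w y = (\<Sum>i\<in>UNIV. pd i (\<lambda>u. w u $ i) y)"

lemma vplt_add: "vplt n v \<Longrightarrow> vplt n w \<Longrightarrow> vplt n (\<lambda>y. v y + w y)"
  unfolding vplt_def by (simp add: plt_add)

lemma vplt_diff: "vplt n v \<Longrightarrow> vplt n w \<Longrightarrow> vplt n (\<lambda>y. v y - w y)"
  unfolding vplt_def by (simp add: plt_diff)

lemma vplt_scaleR_const: "plt n p \<Longrightarrow> vplt n (\<lambda>y. p y *\<^sub>R d)"
  unfolding vplt_def using plt_cmult[of n p "d $ k" for k] by (simp add: mult.commute)

lemma vplt_affn: "affn l \<Longrightarrow> vplt (n - 1) v \<Longrightarrow> vplt n (\<lambda>y. l y *\<^sub>R v y)"
  unfolding vplt_def by (simp add: affn_plt_mult')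

lemma vplt_cmult: "vplt n v \<Longrightarrow> vplt n (\<lambda>y. c *\<^sub>R v y)"
  unfolding vplt_def by (simp add: plt_cmult)

lemma plt_inner: "vplt n v \<Longrightarrow> plt n (\<lambda>y. g \<bullet> v y)"
  unfolding vplt_def inner_3 by (intro plt_add plt_cmult) auto

lemma vplt_zero: "vplt n (\<lambda>y. 0)"
  unfolding vplt_def by (simp add: plt_zero)

lemma vplt_0: "vplt 0 v \<Longrightarrow> v y = 0"
  unfolding vplt_def vec_eq_iff using plt_0 by auto

lemma vplt_cross: "vplt n v \<Longrightarrow> vplt n (\<lambda>y. cross3 g (v y))"
  unfolding vplt_def forall_3 cross3_def by (simp add: plt_diff plt_cmult)

lemma vplt_vdiv: "vplt n v \<Longrightarrow> plt (n - 1) (vdiv v)"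
proof -
  assume "vplt n v"
  then have "plt (n - 1) (\<lambda>y. vdiv v y)"
    unfolding vplt_def vdiv_def by (intro plt_sum plt_pd) auto
  then show ?thesis by simp
qed

lemma vplt_vcurl: "vplt n v \<Longrightarrow> vplt (n - 1) (vcurl v)"
  unfolding vplt_def forall_3 vcurl_def by (auto intro!: plt_diff plt_pd)

lemma vplt_differentiable: "vplt n v \<Longrightarrow> (\<lambda>y. v y $ k) differentiable (at y)"
  unfolding vplt_def using plt_differentiable by blast

lemma vdiv_scaleR:
  assumes "f differentiable at y" "\<And>k. (\<lambda>y. v y $ k) differentiable (at y)"
  shows "vdiv (\<lambda>y. f y *\<^sub>R v y) y = grad f y \<bullet> v y + f y * vdiv v y"
  using assms by (simp add: vdiv_def grad_def pd_mult inner_vec_def sum.distrib sum_distrib_left)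

lemma vcurl_scaleR:
  assumes "f differentiable at y" "\<And>k. (\<lambda>y. v y $ k) differentiable (at y)"
  shows "vcurl (\<lambda>y. f y *\<^sub>R v y) y = cross3 (grad f y) (v y) + f y *\<^sub>R vcurl v y"
  using assms by (simp add: vcurl_def grad_def pd_mult cross3_def vec_eq_iff forall_3 algebra_simps)

lemma pd_cmult: "f differentiable at y \<Longrightarrow> pd k (\<lambda>y. c * f y) y = c * pd k f y"
  by (simp add: pd_mult)

lemma pd_diff: "f differentiable at y \<Longrightarrow> g differentiable at y \<Longrightarrow>
   pd k (\<lambda>y. f y - g y) y = pd k f y - pd k g y"
  using pd_add[of f y "\<lambda>y. (-1) * g y" k] pd_cmult[of g y k "-1"] by simp

lemma vdiv_add:
  assumes "\<And>k. (\<lambda>y. v y $ k) differentiable (at y)" "\<And>k. (\<lambda>y. w y $ k) differentiable (at y)"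
  shows "vdiv (\<lambda>y. v y + w y) y = vdiv v y + vdiv w y"
  using assms by (simp add: vdiv_def pd_add sum.distrib)

lemma vdiv_diff:
  assumes "\<And>k. (\<lambda>y. v y $ k) differentiable (at y)" "\<And>k. (\<lambda>y. w y $ k) differentiable (at y)"
  shows "vdiv (\<lambda>y. v y - w y) y = vdiv v y - vdiv w y"
  using assms by (simp add: vdiv_def pd_diff sum_subtractf)

lemma vcurl_add:
  assumes "\<And>k. (\<lambda>y. v y $ k) differentiable (at y)" "\<And>k. (\<lambda>y. w y $ k) differentiable (at y)"
  shows "vcurl (\<lambda>y. v y + w y) y = vcurl v y + vcurl w y"
  using assms by (simp add: vcurl_def pd_add vec_eq_iff forall_3)

lemma vdiv_vcurl: assumes "vplt n v" shows "vdiv (vcurl v) y = 0"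
proof -
  have p: "plt n (\<lambda>y. v y $ k)" for k using assms unfolding vplt_def by blast
  have d: "pd j (\<lambda>y. v y $ k) differentiable at y" for j k y
    using plt_differentiable[OF plt_pd[OF p]] .
  have c: "pd i (pd j (\<lambda>y. v y $ k)) y = pd j (pd i (\<lambda>y. v y $ k)) y" for i j k
    using plt_pd_commute[OF p] .
  show ?thesis unfolding vdiv_def sum_3 vcurl_def
    by (simp add: pd_diff d c[of 2 1] c[of 3 1] c[of 3 2])
qed

section \<open>Barycentric coordinates\<close>

lemma sum_le3: "(\<Sum>i\<le>(3::nat). f i) = f 0 + f 1 + f 2 + (f 3 :: 'a::comm_monoid_add)"
  by (simp add: numeral_3_eq_3 numeral_2_eq_2 One_nat_def add.assoc)

lemma le3_cases: "i \<le> (3::nat) \<Longrightarrow> i = 0 \<or> i = 1 \<or> i = 2 \<or> i = 3"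
  by auto

lemma all_le3: "(\<forall>i\<le>(3::nat). P i) \<longleftrightarrow> P 0 \<and> P 1 \<and> P 2 \<and> P 3"
  by (auto dest!: le3_cases)

text \<open>
  Indices of vertices are the numbers up to 3. The vectors \<open>h i\<close> are the gradients of the
  barycentric coordinates \<open>lam i\<close>; up to the factor \<open>1 / vol\<close> they are the face normals, whence the cross
  products. The constant \<open>vol\<close> is six times the oriented volume.
\<close>

locale tetrahedron =
  fixes x :: "nat \<Rightarrow> real^3"
  assumes nondegenerate: "nondegenerate x"
begin

definition vol :: real
  where "vol = (x 1 - x 0) \<bullet> cross3 (x 2 - x 0) (x 3 - x 0)"

definition h :: "nat \<Rightarrow> real^3"
  where "h i = (let u = x 1 - x 0; v = x 2 - x 0; w = x 3 - x 0 in (1 / vol) *\<^sub>R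
    (if i = 1 then cross3 v w else if i = 2 then cross3 w u else if i = 3 then cross3 u v
     else - (cross3 v w + cross3 w u + cross3 u v)))"

definition lam :: "nat \<Rightarrow> real^3 \<Rightarrow> real"
  where "lam i y = h i \<bullet> (y - x 0) + (if i = 0 then 1 else 0)"

text \<open>
  Otherwise a vector orthogonal to all three edges at \<open>x 0\<close> vanishes, which makes two of these edges
  parallel.
\<close>

lemma vol_nonzero: "vol \<noteq> 0"
proof
  assume "vol = 0"
  let ?D = "{x 1 - x 0, x 2 - x 0, x 3 - x 0}"
  have im: "x ` {..3} = {x 0, x 1, x 2, x 3}"
    by (auto simp: numeral_3_eq_3 numeral_2_eq_2 One_nat_def atMost_Suc)
  have inj: "inj_on x {..3}" and aff: "\<not> affine_dependent {x 0, x 1, x 2, x 3}"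
    using nondegenerate im unfolding nondegenerate_def by auto
  have ne: "x 0 \<noteq> x 1" "x 0 \<noteq> x 2" "x 0 \<noteq> x 3" "x 1 \<noteq> x 2" "x 1 \<noteq> x 3" "x 2 \<noteq> x 3"
    by (auto dest!: inj_onD[OF inj])
  have ind: "independent ?D"
  proof
    assume "dependent ?D"
    moreover have "{z - x 0 | z. z \<in> {x 1, x 2, x 3}} = ?D" by auto
    ultimately have "affine_dependent (insert (x 0) {x 1, x 2, x 3})"
      using dependent_imp_affine_dependent[of "x 0" "{x 1, x 2, x 3}"] ne by simp
    then show False using aff by simp
  qed
  have card: "card ?D = 3" using ne by simp
  define c where "c = cross3 (x 2 - x 0) (x 3 - x 0)"
  have "c \<bullet> z = 0" if "z \<in> ?D" for z
    using that \<open>vol = 0\<close> by (auto simp: vol_def c_def dot_cross_self inner_commute)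
  then have "?D \<subseteq> {z. c \<bullet> z = 0}" by blast
  then have "span ?D \<subseteq> {z. c \<bullet> z = 0}" using subspace_hyperplane span_minimal by blast
  moreover have "span ?D = UNIV"
    using card_eq_dim[of ?D UNIV] ind card by auto
  ultimately have "c \<bullet> c = 0" by blast
  then have "collinear {0, x 2 - x 0, x 3 - x 0}" by (simp add: c_def cross_eq_0)
  moreover have "x 2 - x 0 \<noteq> 0" "x 3 - x 0 \<noteq> 0" using ne by auto
  ultimately obtain k where "x 3 - x 0 = k *\<^sub>R (x 2 - x 0)" unfolding collinear_lemma by blast
  then have e: "k *\<^sub>R (x 2 - x 0) = x 3 - x 0" by simp
  have "x 2 - x 0 \<in> ?D - {x 3 - x 0}" using ne by auto
  from span_scale[OF span_base[OF this], of k] have "x 3 - x 0 \<in> span (?D - {x 3 - x 0})"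
    unfolding e .
  then show False using ind unfolding dependent_def by blast
qed

lemma h_simps:
  "h 1 = (1 / vol) *\<^sub>R cross3 (x 2 - x 0) (x 3 - x 0)"
  "h 2 = (1 / vol) *\<^sub>R cross3 (x 3 - x 0) (x 1 - x 0)"
  "h 3 = (1 / vol) *\<^sub>R cross3 (x 1 - x 0) (x 2 - x 0)"
  "h 0 = - (h 1 + h 2 + h 3)"
  by (simp_all add: h_def Let_def scaleR_add_right scaleR_diff_right)

lemma h_sum: "(\<Sum>i\<le>3. h i) = 0"
  by (simp add: sum_le3 h_simps(4))

lemma lam_sum: "(\<Sum>i\<le>3. lam i y) = 1"
proof -
  have "(\<Sum>i\<le>3. lam i y) = (\<Sum>i\<le>3. h i) \<bullet> (y - x 0) + 1"
    by (simp add: sum_le3 lam_def inner_add_left)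
  then show ?thesis by (simp add: h_sum)
qed

lemma cramer: "(u \<bullet> cross3 v w) *\<^sub>R z
    = (z \<bullet> cross3 v w) *\<^sub>R u + (z \<bullet> cross3 w u) *\<^sub>R v + (z \<bullet> cross3 u v) *\<^sub>R w"
  by (simp add: vec_eq_iff forall_3 cross3_def inner_3 algebra_simps)

lemma h_expand: "z = (\<Sum>i\<le>3. (h i \<bullet> z) *\<^sub>R x i)"
proof -
  let ?u = "x 1 - x 0" and ?v = "x 2 - x 0" and ?w = "x 3 - x 0"
  have "vol *\<^sub>R z = vol *\<^sub>R ((h 1 \<bullet> z) *\<^sub>R ?u + (h 2 \<bullet> z) *\<^sub>R ?v + (h 3 \<bullet> z) *\<^sub>R ?w)"
    using cramer[of ?u ?v ?w z] vol_nonzero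
    unfolding h_simps scaleR_add_right vol_def[symmetric] by (simp add: inner_commute)
  then have "z = (h 1 \<bullet> z) *\<^sub>R ?u + (h 2 \<bullet> z) *\<^sub>R ?v + (h 3 \<bullet> z) *\<^sub>R ?w"
    using vol_nonzero by simp
  also have "\<dots> = (\<Sum>i\<le>3. (h i \<bullet> z) *\<^sub>R x i)"
    by (simp add: sum_le3 h_simps(4) inner_add_left algebra_simps)
  finally show ?thesis .
qed

lemma h_edge: "i \<le> 3 \<Longrightarrow> j \<le> 3 \<Longrightarrow> k \<le> 3 \<Longrightarrow>
  h i \<bullet> (x j - x k) = (if i = j then 1 else 0) - (if i = k then 1 else 0)"
proof -
  have e: "h i \<bullet> (x j - x 0) = (if i = j then 1 else 0) - (if i = 0 then 1 else 0)"
    if "i \<le> 3" "j \<le> 3" for i j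
  proof -
    have t: "cross3 (x 3 - x 0) (x 1 - x 0) \<bullet> (x 2 - x 0) = vol"
      "cross3 (x 1 - x 0) (x 2 - x 0) \<bullet> (x 3 - x 0) = vol"
      "cross3 (x 2 - x 0) (x 3 - x 0) \<bullet> (x 1 - x 0) = vol"
      unfolding vol_def cross3_def by (simp_all add: inner_3 algebra_simps)
    show ?thesis using le3_cases[OF that(1)] le3_cases[OF that(2)] vol_nonzero
      by (elim disjE) (simp_all add: h_simps inner_add_left inner_diff_left t dot_cross_self)
  qed
  assume "i \<le> 3" "j \<le> 3" "k \<le> 3"
  then show ?thesis using e[of i j] e[of i k] by (simp add: inner_diff_right)
qed

lemma lam_vertex: "i \<le> 3 \<Longrightarrow> j \<le> 3 \<Longrightarrow> lam i (x j) = (if i = j then 1 else 0)"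
  unfolding lam_def using h_edge[of i j 0] by simp

lemma lam_diff: "lam i (y + z) = lam i y + h i \<bullet> z"
  by (simp add: lam_def inner_diff_right inner_add_right)

lemma affn_lam: "affn (lam i)"
proof -
  have "lam i = (\<lambda>y. h i \<bullet> y + (- (h i \<bullet> x 0) + (if i = 0 then 1 else 0)))"
    by (auto simp: lam_def inner_diff_right)
  then show ?thesis unfolding affn_def by blast
qed

lemma lam_expand: "y = (\<Sum>i\<le>3. lam i y *\<^sub>R x i)"
proof -
  have "(\<Sum>i\<le>3. lam i y *\<^sub>R x i) = (\<Sum>i\<le>3. (h i \<bullet> (y - x 0)) *\<^sub>R x i) + x 0"
    by (simp add: sum_le3 lam_def scaleR_add_left)
  then show ?thesis using h_expand[of "y - x 0"] by simp
qed

text \<open>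
  The numbers \<open>h i \<bullet> w\<close> are coordinates of the vector \<open>w\<close>, and their only constraint is that they add up
  to zero. Fields with prescribed normal components on the four faces are built this way.
\<close>

lemma h_comb: assumes "(\<Sum>j\<le>3. W j) = 0" "i \<le> 3" shows "h i \<bullet> (\<Sum>j\<le>3. W j *\<^sub>R x j) = W i"
proof -
  have "(\<Sum>j\<le>3. W j *\<^sub>R x j) = (\<Sum>j\<le>3. W j *\<^sub>R (x j - x 0)) + (\<Sum>j\<le>3. W j) *\<^sub>R x 0"
    by (simp add: scaleR_diff_right sum_subtractf scaleR_left.sum)
  then have "h i \<bullet> (\<Sum>j\<le>3. W j *\<^sub>R x j) = (\<Sum>j\<le>3. W j * (h i \<bullet> (x j - x 0)))"
    using assms(1) by (simp add: inner_sum_right)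
  also have "\<dots> = W i"
    using assms(1) le3_cases[OF assms(2)] h_edge[OF assms(2)] by (elim disjE) (simp_all add: sum_le3)
  finally show ?thesis .
qed

lemma plt_lam: "plt 2 (lam i)" using affn_plt[OF affn_lam] .

lemma lam_differentiable: "lam i differentiable at y"
  using plt_differentiable[OF plt_lam] .

lemma pd_lam: "pd k (lam i) y = h i $ k"
proof -
  have "lam i = (\<lambda>y. h i \<bullet> y + (- (h i \<bullet> x 0) + (if i = 0 then 1 else 0)))"
    by (auto simp: lam_def inner_diff_right)
  then show ?thesis using pd_affn by metis
qed

lemma lam_power_differentiable: "(\<lambda>y. lam i y ^ n) differentiable at y"
  by (induction n) (auto intro: differentiable_mult lam_differentiable)

lemma grad_lam_power: "grad (\<lambda>y. lam i y ^ Suc n) y = (real (Suc n) * lam i y ^ n) *\<^sub>R h i"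
proof (induction n)
  case 0
  then show ?case by (simp add: grad_def pd_lam vec_eq_iff)
next
  case (Suc n)
  have "pd k (\<lambda>y. lam i y * lam i y ^ Suc n) y = h i $ k * lam i y ^ Suc n + lam i y * pd k (\<lambda>y. lam i y ^ Suc n) y" for k
    by (subst pd_mult[OF lam_differentiable lam_power_differentiable]) (simp add: pd_lam)
  moreover have "pd k (\<lambda>y. lam i y ^ Suc n) y = (real (Suc n) * lam i y ^ n) * h i $ k" for k
    using arg_cong[OF Suc, of "\<lambda>v. v $ k"] unfolding grad_def by simp
  ultimately show ?case by (simp add: grad_def vec_eq_iff algebra_simps)
qed

end

section \<open>Divisibility by barycentric coordinates\<close>

text \<open>
  Continuity of a piecewise polynomial in algebraic form: cells \<open>i\<close> and \<open>j\<close> meet inside the plane where the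
  two coordinates agree, and polynomials that agree on a piece of this plane agree on all of it.
\<close>

definition glued :: "(nat \<Rightarrow> real^3 \<Rightarrow> real) \<Rightarrow> (nat \<Rightarrow> real^3 \<Rightarrow> 'a) \<Rightarrow> bool"
  where "glued L w \<longleftrightarrow> (\<forall>i\<le>3. \<forall>j\<le>3. \<forall>y. L i y = L j y \<longrightarrow> w i y = w j y)"

lemma glued_step:
  fixes w :: "nat \<Rightarrow> real^3 \<Rightarrow> real^3"
  assumes "glued L w" shows "glued L (\<lambda>i y. v y + L i y *\<^sub>R w i y)"
  unfolding glued_def
proof (intro allI impI)
  fix i j :: nat and y assume *: "i \<le> 3" "j \<le> 3" "L i y = L j y"
  then have "w i y = w j y" using assms unfolding glued_def by blast
  then show "v y + L i y *\<^sub>R w i y = v y + L j y *\<^sub>R w j y" unfolding *(3) by simp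
qed

context tetrahedron
begin

lemma lam_plt_mult: "plt (n - 1) p \<Longrightarrow> plt n (\<lambda>y. lam i y * p y)"
  using affn_plt_mult'[OF affn_lam] .

lemma lam_line: "lam i (a + t *\<^sub>R (b - a)) = lam i a + t * (lam i b - lam i a)"
  using affn_comb[OF affn_lam] .

text \<open>
  Moving from \<open>y\<close> by \<open>lam a y\<close> in the direction \<open>x b - x a\<close> makes coordinate \<open>a\<close> zero and
  changes only coordinate \<open>b\<close> besides, so the point stays in the flat cut out by \<open>Z\<close>.
\<close>

lemma flat_divide:
  assumes p: "plt n p" and Z: "Z \<subseteq> {..3}" and a: "a \<le> 3" "a \<notin> Z" and b: "b \<le> 3" "b \<notin> Z" "b \<noteq> a"
    and z: "\<And>y. lam a y = 0 \<Longrightarrow> (\<And>i. i \<in> Z \<Longrightarrow> lam i y = 0) \<Longrightarrow> p y = 0"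
  obtains c where "plt (n - 1) c" "\<And>y. (\<And>i. i \<in> Z \<Longrightarrow> lam i y = 0) \<Longrightarrow> p y = lam a y * c y"
proof -
  obtain c where c: "plt (n - 1) c" "\<And>y. p y - p (y - lam a y *\<^sub>R (x a - x b)) = lam a y * c y"
    using plt_divide[OF p affn_lam] by blast
  have "p y = lam a y * c y" if y: "\<And>i. i \<in> Z \<Longrightarrow> lam i y = 0" for y
  proof -
    have l: "lam i (y - lam a y *\<^sub>R (x a - x b)) = lam i y - lam a y * ((if i = a then 1 else 0) - (if i = b then 1 else 0))"
      if "i \<le> 3" for i
      using lam_diff[of i y "- lam a y *\<^sub>R (x a - x b)"] h_edge[OF that a(1) b(1)] by simp
    have "p (y - lam a y *\<^sub>R (x a - x b)) = 0"
    proof (rule z)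
      show "lam a (y - lam a y *\<^sub>R (x a - x b)) = 0" using l[OF a(1)] b by simp
      fix i assume "i \<in> Z"
      then have "i \<noteq> a" "i \<noteq> b" "i \<le> 3" using a b Z by auto
      then show "lam i (y - lam a y *\<^sub>R (x a - x b)) = 0" using l[of i] y[OF \<open>i \<in> Z\<close>] by simp
    qed
    then show ?thesis using c(2)[of y] by simp
  qed
  then show ?thesis using c(1) that by blast
qed

lemma ex_other: "a \<le> 3 \<Longrightarrow> b \<le> 3 \<Longrightarrow> c \<le> 3 \<Longrightarrow> \<exists>d\<le>3. d \<noteq> a \<and> d \<noteq> b \<and> d \<noteq> (c::nat)"
  by presburger

lemma plane_divide:
  assumes p: "plt n p" and a: "a \<le> 3" and z: "\<And>y. lam a y = 0 \<Longrightarrow> p y = 0"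
  obtains c where "plt (n - 1) c" "\<And>y. p y = lam a y * c y"
proof -
  obtain b where b: "b \<le> 3" "b \<noteq> a" using ex_other[OF a a a] by blast
  show ?thesis
    by (rule flat_divide[OF p, of "{}" a b]) (use a b z that in auto)
qed

lemma line_divide:
  assumes p: "plt n p" and a: "a \<le> 3" "b \<le> 3" "a \<noteq> b"
    and z: "\<And>y. lam a y = 0 \<Longrightarrow> lam b y = 0 \<Longrightarrow> p y = 0"
  obtains c d where "plt (n - 1) c" "plt (n - 1) d" "\<And>y. p y = lam a y * c y + lam b y * d y"
proof -
  obtain e where e: "e \<le> 3" "e \<noteq> a" "e \<noteq> b" using ex_other[OF a(1) a(1) a(2)] by blast
  obtain c where c: "plt (n - 1) c" "\<And>y. lam b y = 0 \<Longrightarrow> p y = lam a y * c y"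
    by (rule flat_divide[OF p, of "{b}" a e]) (use a e z in auto)
  have "plt n (\<lambda>y. p y - lam a y * c y)" by (intro plt_diff p lam_plt_mult c)
  from plane_divide[OF this a(2)] c(2)
  obtain d where "plt (n - 1) d" "\<And>y. p y - lam a y * c y = lam b y * d y" by auto
  then show ?thesis using that[of c d] c(1) by (simp add: algebra_simps)
qed

lemma vertex_divide:
  assumes p: "plt n p" and z: "p (x 3) = 0"
  obtains c0 c1 c2 where "plt (n - 1) c0" "plt (n - 1) c1" "plt (n - 1) c2"
    "\<And>y. p y = lam 0 y * c0 y + lam 1 y * c1 y + lam 2 y * c2 y"
proof -
  have v: "y = x 3" if "lam 0 y = 0" "lam 1 y = 0" "lam 2 y = 0" for y
    using lam_expand[of y] lam_sum[of y] that by (simp add: sum_le3)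
  obtain c where c: "plt (n - 1) c" "\<And>y. lam 1 y = 0 \<Longrightarrow> lam 2 y = 0 \<Longrightarrow> p y = lam 0 y * c y"
    by (rule flat_divide[OF p, of "{1, 2}" 0 3]) (use z v in auto)
  have "plt n (\<lambda>y. p y - lam 0 y * c y)" by (intro plt_diff p lam_plt_mult c)
  then obtain d e where "plt (n - 1) d" "plt (n - 1) e" "\<And>y. p y - lam 0 y * c y = lam 1 y * d y + lam 2 y * e y"
    by (rule line_divide[of n _ 1 2]) (use c in auto)
  then show ?thesis using that[of c d e] c(1) by (simp add: algebra_simps)
qed

text \<open>
  Moving along the edge between vertices \<open>a\<close> and \<open>b\<close> equalises the two coordinates.
\<close>

lemma diagonal_divide:
  assumes p: "plt n p" and a: "a \<le> 3" "b \<le> 3" "a \<noteq> b" and z: "\<And>y. lam a y = lam b y \<Longrightarrow> p y = 0"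
  obtains c where "plt (n - 1) c" "\<And>y. p y = (lam a y - lam b y) * c y"
proof -
  let ?d = "(1/2) *\<^sub>R (x a - x b)"
  obtain c where c: "plt (n - 1) c"
    "\<And>y. p y - p (y - (lam a y - lam b y) *\<^sub>R ?d) = (lam a y - lam b y) * c y"
    using plt_divide[OF p affn_diff[OF affn_lam affn_lam], of a b ?d] by blast
  have "p (y - (lam a y - lam b y) *\<^sub>R ?d) = 0" for y
  proof (rule z)
    have "lam i (y - (lam a y - lam b y) *\<^sub>R ?d) = lam i y - (lam a y - lam b y) / 2 * (h i \<bullet> (x a - x b))" for i
      by (simp add: lam_def inner_diff_right)
    then show "lam a (y - (lam a y - lam b y) *\<^sub>R ?d) = lam b (y - (lam a y - lam b y) *\<^sub>R ?d)"
      using h_edge[of a a b] h_edge[of b a b] a by (simp only:) (simp add: field_simps)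
  qed
  then show ?thesis using c that by auto
qed

lemma flat_cancel:
  assumes p: "plt n p" and Z: "Z \<subseteq> {..3}" and a: "a \<le> 3" "a \<notin> Z"
    and z: "\<And>y. (\<And>i. i \<in> Z \<Longrightarrow> lam i y = 0) \<Longrightarrow> lam a y * p y = 0"
    and y: "\<And>i. i \<in> Z \<Longrightarrow> lam i y = 0"
  shows "p y = 0"
proof (rule plt_cancel[OF p affn_lam, of a "x a"])
  show "lam a (x a) \<noteq> 0" using lam_vertex a by simp
  fix t
  have "lam i (x a + t *\<^sub>R (y - x a)) = 0" if "i \<in> Z" for i
    using lam_line[of i "x a" t y] lam_vertex[of i a] y[OF that] that a Z by auto
  then show "lam a (x a + t *\<^sub>R (y - x a)) * p (x a + t *\<^sub>R (y - x a)) = 0" using z by blast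
qed

lemma lam_cancel: "plt n p \<Longrightarrow> a \<le> 3 \<Longrightarrow> (\<And>y. lam a y * p y = 0) \<Longrightarrow> p y = 0"
  using flat_cancel[of n p "{}" a y] by simp

lemma lam_power_cancel: "plt n p \<Longrightarrow> a \<le> 3 \<Longrightarrow> (\<And>y. lam a y ^ m * p y = 0) \<Longrightarrow> p y = 0"
proof (induction m arbitrary: y)
  case (Suc m)
  have "plt (m + n) (\<lambda>y. lam a y ^ m * p y)"
  proof (induction m)
    case (Suc m)
    then show ?case using lam_plt_mult[of "Suc m + n"] by (simp add: mult.assoc)
  qed (use Suc in simp)
  then have "lam a y ^ m * p y = 0" for y
    using lam_cancel[of "m + n" "\<lambda>y. lam a y ^ m * p y" a y] Suc.prems by (simp add: mult.assoc)
  then show ?case using Suc by blast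
qed simp

lemma diagonal_cancel:
  assumes p: "plt n p" and l: "affn l" and q: "lam a q = lam b q" "l q \<noteq> 0"
    and z: "\<And>y. lam a y = lam b y \<Longrightarrow> l y * p y = 0" and y: "lam a y = lam b y"
  shows "p y = 0"
  by (rule plt_cancel[OF p l q(2)], rule z) (simp add: lam_line q(1) y)

lemma diagonal_cancel_lam:
  assumes p: "plt n p" and a: "a \<le> 3" "b \<le> 3" "a \<noteq> b" "c \<le> 3"
    and z: "\<And>y. lam a y = lam b y \<Longrightarrow> lam c y * p y = 0" and y: "lam a y = lam b y"
  shows "p y = 0"
proof (cases "c = a \<or> c = b")
  case True
  let ?m = "x a + (1/2) *\<^sub>R (x b - x a)"
  have "lam a ?m = 1/2" "lam b ?m = 1/2" using lam_vertex a by (simp_all add: lam_line)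
  then show ?thesis using True diagonal_cancel[OF p affn_lam, of a ?m b c, OF _ _ z y] by auto
next
  case False
  then show ?thesis using lam_vertex a diagonal_cancel[OF p affn_lam, of a "x c" b c, OF _ _ z y] by simp
qed

lemma vector_choice:
  assumes "\<And>k::3. \<exists>c. P k c" obtains v :: "real^3 \<Rightarrow> real^3" where "\<And>k. P k (\<lambda>y. v y $ k)"
proof -
  obtain f where "\<And>k. P k (f k)" using assms by metis
  then show ?thesis using that[of "\<lambda>y. \<chi> k. f k y"] by simp
qed

lemma plane_divide_vector:
  assumes p: "vplt n p" and a: "a \<le> 3" and z: "\<And>y. lam a y = 0 \<Longrightarrow> p y = 0"
  obtains c where "vplt (n - 1) c" "\<And>y. p y = lam a y *\<^sub>R c y"
proof -
  have "\<exists>c. plt (n - 1) c \<and> (\<forall>y. p y $ k = lam a y * c y)" for k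
    using plane_divide[of n "\<lambda>y. p y $ k" a] p a z unfolding vplt_def by (metis zero_index)
  from vector_choice[of "\<lambda>k c. plt (n - 1) c \<and> (\<forall>y. p y $ k = lam a y * c y)", OF this]
  obtain v :: "real^3 \<Rightarrow> real^3" where "\<And>k. plt (n - 1) (\<lambda>y. v y $ k) \<and> (\<forall>y. p y $ k = lam a y * v y $ k)" by blast
  then show ?thesis using that[of v] by (simp add: vplt_def vec_eq_iff)
qed

section \<open>The divergence equation for powers of the coordinates\<close>

text \<open>
  Since the coordinates add up to one, a polynomial of degree less than \<open>n\<close> is a form of degree
  \<open>n - 1\<close> in the four coordinates; for \<open>n \<ge> 2\<close> each monomial of this form has some coordinate as a factor.
\<close>

lemma homogeneous_split:
  assumes "plt n p" "2 \<le> n"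
  obtains b where "\<And>i. plt (n - 1) (b i)" "\<And>y. p y = (\<Sum>i\<le>3. lam i y * b i y)"
proof -
  have "2 \<le> n \<longrightarrow> (\<exists>b. (\<forall>i. plt (n - 1) (b i)) \<and> (\<forall>y. p y = (\<Sum>i\<le>3. lam i y * b i y)))"
    using assms(1)
  proof (induction rule: plt.induct)
    case (plt_zero n)
    then show ?case by (intro impI exI[of _ "\<lambda>i y. 0"]) (simp add: plt.plt_zero)
  next
    case (plt_const n c)
    have "c = (\<Sum>i\<le>3. lam i y * c)" for y using lam_sum[of y] by (simp add: sum_distrib_right[symmetric])
    moreover have "2 \<le> Suc n \<Longrightarrow> plt n (\<lambda>y. c)" by (rule plt_mono[of 1]) (use plt.plt_const[of 0 c] in \<open>auto simp: One_nat_def\<close>)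
    ultimately show ?case by (intro impI exI[of _ "\<lambda>i y. c"]) simp
  next
    case (plt_add n p q)
    show ?case
    proof
      assume "2 \<le> n"
      then obtain b c where "\<forall>i. plt (n - 1) (b i)" "\<forall>y. p y = (\<Sum>i\<le>3. lam i y * b i y)"
        "\<forall>i. plt (n - 1) (c i)" "\<forall>y. q y = (\<Sum>i\<le>3. lam i y * c i y)" using plt_add.IH by auto
      then show "\<exists>b. (\<forall>i. plt (n - 1) (b i)) \<and> (\<forall>y. p y + q y = (\<Sum>i\<le>3. lam i y * b i y))"
        by (intro exI[of _ "\<lambda>i y. b i y + c i y"]) (simp add: plt.plt_add distrib_left sum.distrib)
    qed
  next
    case (plt_coord n p k)
    have "y $ k = (\<Sum>i\<le>3. lam i y * x i $ k)" for y
      using arg_cong[OF lam_expand[of y], of "\<lambda>v. v $ k"] by (simp add: sum_le3)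
    then have "y $ k * p y = (\<Sum>i\<le>3. lam i y * (x i $ k * p y))" for y
      by (metis (no_types, lifting) mult.assoc sum.cong sum_distrib_right)
    moreover have "plt (Suc n - 1) (\<lambda>y. x i $ k * p y)" for i using plt_cmult[OF plt_coord.hyps] by simp
    ultimately show ?case by (intro impI exI[of _ "\<lambda>i y. x i $ k * p y"]) blast
  qed
  then show ?thesis using assms(2) that by blast
qed

lemma vdiv_lam_power:
  assumes "vplt n w"
  shows "vdiv (\<lambda>y. lam i y ^ Suc j *\<^sub>R w y) y
    = lam i y ^ j * (real (Suc j) * (h i \<bullet> w y) + lam i y * vdiv w y)"
  by (subst vdiv_scaleR[OF lam_power_differentiable vplt_differentiable[OF assms]])
    (simp add: grad_lam_power[unfolded power_Suc] algebra_simps)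

lemma vcurl_lam_power:
  assumes "vplt n w"
  shows "vcurl (\<lambda>y. lam i y ^ Suc j *\<^sub>R w y) y
    = lam i y ^ j *\<^sub>R (real (Suc j) *\<^sub>R cross3 (h i) (w y) + lam i y *\<^sub>R vcurl w y)"
  by (subst vcurl_scaleR[OF lam_power_differentiable vplt_differentiable[OF assms]])
    (simp only: grad_lam_power cross_mult_left, simp add: algebra_simps)

lemma vplt_lam_power: "vplt n w \<Longrightarrow> vplt (m + n) (\<lambda>y. lam i y ^ m *\<^sub>R w y)"
proof (induction m)
  case (Suc m)
  then have "vplt (Suc m + n) (\<lambda>y. lam i y *\<^sub>R (lam i y ^ m *\<^sub>R w y))"
    by (intro vplt_affn[OF affn_lam]) simp
  then show ?case by simp
qed simp

text \<open>
  The divergence equation, solved one power of \<open>lam i\<close> at a time. The lowest order part of the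
  divergence of \<open>lam i ^ Suc j *\<^sub>R w\<close> is \<open>lam i ^ j\<close> times the normal component of \<open>w\<close>. A polynomial field \<open>w\<close> that is
  the same on all cells can have any four normal components \<open>W i\<close> with sum zero; and the given data can be
  brought to sum zero by adding multiples of \<open>lam i\<close>, which only affects higher orders. Each step raises
  \<open>j\<close> and lowers the degree. Constants at the end cannot be corrected any more: their sum \<open>c\<close> is an
  obstruction, put into cell 0.
\<close>

theorem div_onto:
  assumes "\<And>i. i \<le> 3 \<Longrightarrow> plt n (f i)"
  obtains w c where "\<And>i. i \<le> 3 \<Longrightarrow> vplt n (w i)" "glued lam w"
    "\<And>i y. i \<le> 3 \<Longrightarrow> vdiv (\<lambda>y. lam i y ^ Suc j *\<^sub>R w i y) y
        = lam i y ^ j * f i y - (if i = 0 then c * lam 0 y ^ (j + n - 1) else 0)"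
proof -
  have "\<exists>w c. (\<forall>i\<le>3. vplt n (w i)) \<and> glued lam w \<and> (\<forall>i\<le>3. \<forall>y. vdiv (\<lambda>y. lam i y ^ Suc j *\<^sub>R w i y) y
        = lam i y ^ j * f i y - (if i = 0 then c * lam 0 y ^ (j + n - 1) else 0))"
    using assms
  proof (induction n arbitrary: j f)
    case 0
    then have "f i y = 0" if "i \<le> 3" for i y using plt_0 that by blast
    then show ?case
      by (intro exI[of _ "\<lambda>i y. 0"] exI[of _ 0]) (simp add: vplt_zero glued_def vdiv_def)
  next
    case (Suc n)
    show ?case
    proof (cases "n = 0")
      case True
      have "\<exists>c. f i = (\<lambda>y. c)" if "i \<le> 3" for i
      proof -
        have "f i y = f i 0" for y
        proof -
          have "affn (\<lambda>y. 1)" unfolding affn_def by (intro exI[of _ 0] exI[of _ 1]) simp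
          from plt_divide[OF Suc.prems[OF that] this, of y] True
          obtain c where c: "plt 0 c" "\<And>z. f i z - f i (z - 1 *\<^sub>R y) = 1 * c z" by auto
          from c(2)[of y] plt_0[OF c(1)] show ?thesis by simp
        qed
        then show ?thesis by blast
      qed
      then obtain F where F: "\<And>i. i \<le> 3 \<Longrightarrow> f i = (\<lambda>y. F i)" by metis
      \<comment> \<open>the obstruction, removed from cell 0 so that the constants \<open>G i\<close> have sum zero\<close>
      define c where "c = (\<Sum>i\<le>3. F i)"
      define G where "G i = F i - (if i = 0 then c else 0)" for i
      have G: "(\<Sum>i\<le>3. G i) = 0" by (simp add: sum_le3 G_def c_def)
      define d where "d = (1 / real (Suc j)) *\<^sub>R (\<Sum>i\<le>3. G i *\<^sub>R x i)"
      have d: "vplt 1 (\<lambda>y. d)" unfolding vplt_def One_nat_def by (simp add: plt_const)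
      have hd: "real (Suc j) * (h i \<bullet> d) = G i" if "i \<le> 3" for i
        unfolding d_def inner_scaleR_right h_comb[OF G that] by simp
      have dv: "vdiv (\<lambda>y. lam i y ^ Suc j *\<^sub>R d) y = lam i y ^ j * G i" if "i \<le> 3" for i y
        using vdiv_lam_power[OF d, of i j y] hd[OF that] by (simp add: vdiv_def)
      show ?thesis
        by (rule exI[of _ "\<lambda>i y. d"], rule exI[of _ c])
          (use True d in \<open>auto simp: glued_def One_nat_def dv F G_def algebra_simps simp del: of_nat_Suc power_Suc\<close>)
    next
      case False
      have "plt (Suc n) (\<lambda>y. - (\<Sum>i\<le>3. f i y))" using Suc.prems by (intro plt_minus plt_sum) auto
      then obtain b where b: "\<And>i. plt n (b i)" "\<And>y. - (\<Sum>i\<le>3. f i y) = (\<Sum>i\<le>3. lam i y * b i y)"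
        by (rule homogeneous_split) (use False in auto)
      \<comment> \<open>the data with sum zero, unchanged on face \<open>i\<close>\<close>
      define W where "W i y = f i y + lam i y * b i y" for i y
      have W: "(\<Sum>i\<le>3. W i y) = 0" for y using b(2)[of y] by (simp add: W_def sum.distrib)
      have Wp: "plt (Suc n) (W i)" if "i \<le> 3" for i
        using plt_add[OF Suc.prems[OF that] lam_plt_mult[of "Suc n" "b i" i]] b(1) by (simp add: W_def[abs_def])
      define d where "d y = (1 / real (Suc j)) *\<^sub>R (\<Sum>i\<le>3. W i y *\<^sub>R x i)" for y
      have d: "vplt (Suc n) d"
      proof -
        have "vplt (Suc n) (\<lambda>y. (1 / real (Suc j)) *\<^sub>R (W 0 y *\<^sub>R x 0 + W 1 y *\<^sub>R x 1 + W 2 y *\<^sub>R x 2 + W 3 y *\<^sub>R x 3))"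
          by (intro vplt_cmult vplt_add vplt_scaleR_const Wp) auto
        then show ?thesis by (simp add: d_def[abs_def] sum_le3)
      qed
      have hd: "real (Suc j) * (h i \<bullet> d y) = W i y" if "i \<le> 3" for i y
        unfolding d_def inner_scaleR_right h_comb[OF W that] by simp
      define f' where "f' i y = - (b i y + vdiv d y)" for i y
      have f': "plt n (f' i)" if "i \<le> 3" for i
        using plt_minus[OF plt_add[OF b(1)]] vplt_vdiv[OF d] by (simp add: f'_def[abs_def])
      have "\<exists>w c. (\<forall>i\<le>3. vplt n (w i)) \<and> glued lam w \<and> (\<forall>i\<le>3. \<forall>y. vdiv (\<lambda>y. lam i y ^ Suc (Suc j) *\<^sub>R w i y) y
        = lam i y ^ Suc j * f' i y - (if i = 0 then c * lam 0 y ^ (Suc j + n - 1) else 0))"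
        by (rule Suc.IH) (rule f')
      then obtain w c where w: "\<forall>i\<le>3. vplt n (w i)" "glued lam w" and wd: "\<forall>i\<le>3. \<forall>y. vdiv (\<lambda>y. lam i y ^ Suc (Suc j) *\<^sub>R w i y) y
        = lam i y ^ Suc j * f' i y - (if i = 0 then c * lam 0 y ^ (Suc j + n - 1) else 0)"
        by (elim exE conjE) (rule that)
      let ?w = "\<lambda>i y. d y + lam i y *\<^sub>R w i y"
      have "vplt (Suc n) (?w i)" if "i \<le> 3" for i
        proof -
        have "vplt (Suc n - 1) (w i)" using w(1) that by simp
        from vplt_add[OF d vplt_affn[OF affn_lam this]] show ?thesis .
      qed
      moreover have "glued lam ?w" by (rule glued_step[OF w(2)])
      moreover have "vdiv (\<lambda>y. lam i y ^ Suc j *\<^sub>R ?w i y) y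
        = lam i y ^ j * f i y - (if i = 0 then c * lam 0 y ^ (j + Suc n - 1) else 0)" if "i \<le> 3" for i y
      proof -
        have wi: "vplt n (w i)" using w(1) that by blast
        have e: "(\<lambda>y. lam i y ^ Suc j *\<^sub>R ?w i y) = (\<lambda>y. lam i y ^ Suc j *\<^sub>R d y + lam i y ^ Suc (Suc j) *\<^sub>R w i y)"
          by (simp add: scaleR_add_right mult.commute)
        have "vdiv (\<lambda>y. lam i y ^ Suc j *\<^sub>R ?w i y) y = vdiv (\<lambda>y. lam i y ^ Suc j *\<^sub>R d y) y + vdiv (\<lambda>y. lam i y ^ Suc (Suc j) *\<^sub>R w i y) y"
          unfolding e by (rule vdiv_add)
            (use vplt_differentiable[OF vplt_lam_power[OF d]] vplt_differentiable[OF vplt_lam_power[OF wi]] in blast)+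
        also have "\<dots> = lam i y ^ j * (W i y + lam i y * vdiv d y) + (lam i y ^ Suc j * f' i y - (if i = 0 then c * lam 0 y ^ (Suc j + n - 1) else 0))"
          unfolding vdiv_lam_power[OF d] hd[OF that] using wd that by simp
        also have "\<dots> = lam i y ^ j * f i y - (if i = 0 then c * lam 0 y ^ (j + Suc n - 1) else 0)"
          by (simp add: W_def f'_def algebra_simps)
        finally show ?thesis .
      qed
      ultimately show ?thesis by (intro exI[of _ ?w] exI[of _ c] conjI allI impI)
    qed
  qed
  then show ?thesis using that by blast
qed

section \<open>The curl equation for powers of the coordinates\<close>

lemma h_cross:
  "cross3 (h 2) (h 3) = (1 / vol) *\<^sub>R (x 1 - x 0)"
  "cross3 (h 3) (h 1) = (1 / vol) *\<^sub>R (x 2 - x 0)"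
  "cross3 (h 1) (h 2) = (1 / vol) *\<^sub>R (x 3 - x 0)"
proof -
  let ?u = "x 1 - x 0" and ?v = "x 2 - x 0" and ?w = "x 3 - x 0"
  have e: "cross3 (cross3 w u) (cross3 u v) = (u \<bullet> cross3 v w) *\<^sub>R u"
    "u \<bullet> cross3 v w = v \<bullet> cross3 w u" for u v w :: "real^3"
    by (simp_all add: vec_eq_iff forall_3 cross3_def inner_3 algebra_simps)
  have t: "?u \<bullet> cross3 ?v ?w = vol" "?v \<bullet> cross3 ?w ?u = vol" "?w \<bullet> cross3 ?u ?v = vol"
    using e(2)[of ?u ?v ?w] e(2)[of ?v ?w ?u] by (simp_all add: vol_def)
  show "cross3 (h 2) (h 3) = (1 / vol) *\<^sub>R ?u" "cross3 (h 3) (h 1) = (1 / vol) *\<^sub>R ?v"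
    "cross3 (h 1) (h 2) = (1 / vol) *\<^sub>R ?w"
    unfolding h_simps(1-3) cross_mult_left cross_mult_right e(1) t using vol_nonzero by simp_all
qed

text \<open>
  For fixed \<open>v\<close> the numbers \<open>h j \<bullet> cross3 (h i) v\<close> form an antisymmetric matrix of size four with
  zero row sums, and every such matrix, having the same three degrees of freedom as \<open>v\<close>, arises.
\<close>

lemma antisymmetric_cross:
  assumes anti: "\<And>i j. i \<le> 3 \<Longrightarrow> j \<le> 3 \<Longrightarrow> A i j = - A j i"
    and rows: "\<And>i. i \<le> 3 \<Longrightarrow> (\<Sum>j\<le>3. A i j) = 0"
    and i: "i \<le> 3" and j: "j \<le> 3"
  shows "h j \<bullet> cross3 (h i) (vol *\<^sub>R (A 1 3 *\<^sub>R h 2 - A 1 2 *\<^sub>R h 3 - A 2 3 *\<^sub>R h 1)) = A i j"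
proof -
  define V where "V = vol *\<^sub>R (A 1 3 *\<^sub>R h 2 - A 1 2 *\<^sub>R h 3 - A 2 3 *\<^sub>R h 1)"
  define T where "T i j = h j \<bullet> cross3 (h i) V" for i j
  have T: "T i j = - (V \<bullet> cross3 (h i) (h j))" "T i j = - T j i" for i j
    unfolding T_def cross3_def by (simp_all add: inner_3 algebra_simps)
  have V: "V \<bullet> (x 1 - x 0) = - vol * A 2 3" "V \<bullet> (x 2 - x 0) = vol * A 1 3" "V \<bullet> (x 3 - x 0) = - vol * A 1 2"
    unfolding V_def by (simp_all add: inner_diff_left h_edge)
  have T12: "T 1 2 = A 1 2" and T13: "T 1 3 = A 1 3" and T23: "T 2 3 = A 2 3"
    using T(1)[of 1 2] T(1)[of 3 1] T(1)[of 2 3] T(2)[of 1 3] V vol_nonzero by (simp_all add: h_cross)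
  have Tii: "T i i = 0" for i using T(2)[of i i] by simp
  have T0: "T 0 j = - (T 1 j + T 2 j + T 3 j)" for j
    unfolding T_def h_simps(4) cross3_def by (simp add: inner_3 algebra_simps)
  have Aii: "A i i = 0" if "i \<le> 3" for i using anti[OF that that] by simp
  have A0: "A 0 1 = - (A 2 1 + A 3 1)" "A 0 2 = - (A 1 2 + A 3 2)" "A 0 3 = - (A 1 3 + A 2 3)"
    using rows[of 1] rows[of 2] rows[of 3] anti[of 0 1] anti[of 0 2] anti[of 0 3]
      anti[of 1 2] anti[of 1 3] anti[of 2 3] Aii by (simp_all add: sum_le3)
  have T01: "T 0 1 = A 0 1" "T 0 2 = A 0 2" "T 0 3 = A 0 3"
    using T0[of 1] T0[of 2] T0[of 3] T12 T13 T23 T(2)[of 2 1] T(2)[of 3 1] T(2)[of 3 2] Tii A0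
      anti[of 1 2] anti[of 1 3] anti[of 2 3] by simp_all
  have "T i j = A i j" if "i < j" "j \<le> 3" for i j
    using that le3_cases[of i] le3_cases[of j] T12 T13 T23 T01 by auto
  then have "T i j = A i j"
    using i j Tii Aii T(2)[of i j] anti[of i j] by (cases i j rule: linorder_cases) auto
  then show ?thesis unfolding T_def V_def .
qed

text \<open>
  Exactness of the Koszul complex of the four coordinates in degree one: a linear relation between
  them is a combination of the trivial relations. The coefficient of the last coordinate vanishes where
  the other coordinates vanish, hence is a combination of them; subtracting trivial relations removes
  it, and the number of terms goes down.
\<close>

lemma koszul:
  assumes r: "\<And>i. i \<le> 3 \<Longrightarrow> plt n (r i)" and z: "\<And>y. (\<Sum>i\<le>3. lam i y * r i y) = 0"
  obtains C where "\<And>i j. plt (n - 1) (C i j)" "\<And>i j y. C i j y = - C j i y"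
    "\<And>i y. i \<le> 3 \<Longrightarrow> r i y = (\<Sum>j\<le>3. lam j y * C i j y)"
proof -
  have r0: "plt n (r 0)" "plt n (r 1)" "plt n (r 2)" "plt n (r 3)" using r by auto
  have "r 3 (x 3) = 0" using z[of "x 3"] lam_vertex[of _ 3] by (simp add: sum_le3)
  then obtain c0 c1 c2 where c: "plt (n - 1) c0" "plt (n - 1) c1" "plt (n - 1) c2"
    and r3: "\<And>y. r 3 y = lam 0 y * c0 y + lam 1 y * c1 y + lam 2 y * c2 y"
    using vertex_divide[OF r0(4)] by metis
  let ?s0 = "\<lambda>y. r 0 y + lam 3 y * c0 y" and ?s1 = "\<lambda>y. r 1 y + lam 3 y * c1 y"
    and ?s2 = "\<lambda>y. r 2 y + lam 3 y * c2 y"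
  have s: "plt n ?s0" "plt n ?s1" "plt n ?s2" by (intro plt_add lam_plt_mult r0 c)+
  have zs: "lam 0 y * ?s0 y + lam 1 y * ?s1 y + lam 2 y * ?s2 y = 0" for y
    using z[of y] by (simp add: sum_le3 r3 algebra_simps)
  have "?s2 y = 0" if "lam 0 y = 0" "lam 1 y = 0" for y
  proof (rule flat_cancel[OF s(3), of "{0, 1}" 2])
    fix y assume "\<And>i. i \<in> {0, 1} \<Longrightarrow> lam i y = 0"
    then show "lam 2 y * ?s2 y = 0" using zs[of y] by simp
  qed (use that in auto)
  then obtain e0 e1 where e: "plt (n - 1) e0" "plt (n - 1) e1" and s2: "\<And>y. ?s2 y = lam 0 y * e0 y + lam 1 y * e1 y"
    using line_divide[OF s(3), of 0 1] by auto
  let ?t0 = "\<lambda>y. ?s0 y + lam 2 y * e0 y" and ?t1 = "\<lambda>y. ?s1 y + lam 2 y * e1 y"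
  have t: "plt n ?t0" "plt n ?t1" by (intro plt_add[OF s(1)] plt_add[OF s(2)] lam_plt_mult e)+
  have zt: "lam 0 y * ?t0 y + lam 1 y * ?t1 y = 0" for y
    using zs[of y] unfolding s2 by (simp add: algebra_simps)
  have "?t1 y = 0" if "lam 0 y = 0" for y
  proof (rule flat_cancel[OF t(2), of "{0}" 1])
    fix y assume "\<And>i. i \<in> {0} \<Longrightarrow> lam i y = 0"
    then show "lam 1 y * ?t1 y = 0" using zt[of y] by simp
  qed (use that in auto)
  then obtain f where f: "plt (n - 1) f" and t1: "\<And>y. ?t1 y = lam 0 y * f y"
    using plane_divide[OF t(2), of 0] by auto
  have t0: "?t0 y + lam 1 y * f y = 0" for y
  proof (rule lam_cancel)
    show "plt n (\<lambda>y. ?t0 y + lam 1 y * f y)" by (intro plt_add[OF t(1)] lam_plt_mult f)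
    show "lam 0 y * (?t0 y + lam 1 y * f y) = 0" for y
      using zt[of y] unfolding t1 by (simp add: algebra_simps)
  qed simp
  define E where "E i j = (if i = 0 \<and> j = 1 then f else if i = 0 \<and> j = 2 then e0 else if i = 0 \<and> j = 3 then c0
    else if i = 1 \<and> j = 2 then e1 else if i = 1 \<and> j = 3 then c1 else if i = 2 \<and> j = 3 then c2 else (\<lambda>y. 0))" for i j :: nat
  define C where "C i j y = E j i y - E i j y" for i j y
  have E: "plt (n - 1) (E i j)" for i j using c e f plt_zero by (auto simp: E_def)
  have "plt (n - 1) (C i j)" for i j using plt_diff[OF E E, of j i i j] by (simp add: C_def[abs_def])
  moreover have "r i y = (\<Sum>j\<le>3. lam j y * C i j y)" if "i \<le> 3" for i y
    using le3_cases[OF that] t0[of y] t1[of y] s2[of y] r3[of y]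
    by (elim disjE) (simp_all add: sum_le3 C_def E_def algebra_simps)
  ultimately show ?thesis using that[of C] by (simp add: C_def)
qed

text \<open>
  A polynomial field \<open>v\<close> with \<open>cross3 (h i) v\<close> prescribed on face \<open>i\<close>, for all four faces at once.
  In terms of \<open>antisymmetric_cross\<close> an antisymmetric matrix \<open>A\<close> with zero row sums is wanted whose row \<open>i\<close> is
  given modulo \<open>lam i\<close>. The condition on edges allows an antisymmetric choice of entries. Its row sum \<open>i\<close> is
  then a multiple of \<open>lam i\<close>, and the total of all entries is zero, so that the Koszul lemma supplies the
  correction of the entries by multiples of \<open>lam i * lam j\<close> that makes the row sums zero.
\<close>

lemma tangential_lift:
  assumes p: "\<And>i. i \<le> 3 \<Longrightarrow> vplt n (p i)"
    and tang: "\<And>i y. i \<le> 3 \<Longrightarrow> lam i y = 0 \<Longrightarrow> h i \<bullet> p i y = 0"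
    and edge: "\<And>i j y. i \<le> 3 \<Longrightarrow> j \<le> 3 \<Longrightarrow> lam i y = 0 \<Longrightarrow> lam j y = 0 \<Longrightarrow> h j \<bullet> p i y + h i \<bullet> p j y = 0"
  obtains v where "vplt n v" "\<And>i y. i \<le> 3 \<Longrightarrow> lam i y = 0 \<Longrightarrow> cross3 (h i) (v y) = p i y"
proof -
  define P where "P i j y = h j \<bullet> p i y" for i j y
  have P: "plt n (P i j)" if "i \<le> 3" for i j
    using plt_inner[OF p[OF that]] by (simp add: P_def[abs_def])
  have "\<exists>b. i < j \<longrightarrow> j \<le> 3 \<longrightarrow> plt (n - 1) b \<and> (\<forall>y. lam j y = 0 \<longrightarrow> P i j y + P j i y = lam i y * b y)" for i j
  proof (cases "i < j \<and> j \<le> 3")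
    case True
    then have ij: "i \<le> 3" "j \<le> 3" "i \<noteq> j" by auto
    obtain b d where "plt (n - 1) b" "plt (n - 1) d" "\<And>y. P i j y + P j i y = lam i y * b y + lam j y * d y"
      using line_divide[OF plt_add[OF P P] ij, of i j j i] edge ij unfolding P_def by metis
    then show ?thesis by (intro exI[of _ b]) auto
  qed auto
  then obtain b where b: "\<And>i j. i < j \<Longrightarrow> j \<le> 3 \<Longrightarrow> plt (n - 1) (b i j)"
    "\<And>i j y. i < j \<Longrightarrow> j \<le> 3 \<Longrightarrow> lam j y = 0 \<Longrightarrow> P i j y + P j i y = lam i y * b i j y" by metis
  \<comment> \<open>row \<open>i\<close> agrees with \<open>P i\<close> on face \<open>i\<close>: by choice for \<open>i < j\<close>, and for \<open>j < i\<close> by the relation on the edge\<close>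
  define A where "A i j y = (if i < j then P i j y - lam i y * b i j y
    else if j < i then - (P j i y - lam j y * b j i y) else 0)" for i j y
  have A: "plt n (A i j)" if "i \<le> 3" "j \<le> 3" for i j
  proof -
    have "plt n (\<lambda>y. P i j y - lam i y * b i j y)" if "i < j" "j \<le> 3" for i j
      using that by (intro plt_diff P lam_plt_mult b) auto
    from this[of i j] plt_minus[OF this[of j i]] show ?thesis
      using that plt_zero by (cases i j rule: linorder_cases) (simp_all add: A_def[abs_def])
  qed
  have anti: "A i j y = - A j i y" for i j y by (simp add: A_def)
  have AP: "A i j y = P i j y" if "i \<le> 3" "j \<le> 3" "lam i y = 0" for i j y
  proof (cases i j rule: linorder_cases)
    case equal
    then show ?thesis using tang[of i y] that by (simp add: A_def P_def)
  next
    case greater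
    then show ?thesis using b(2)[of j i y] that by (simp add: A_def)
  qed (use that in \<open>simp add: A_def\<close>)
  have "\<exists>r. plt (n - 1) r \<and> (\<forall>y. (\<Sum>j\<le>3. A i j y) = lam i y * r y)" if i: "i \<le> 3" for i
  proof -
    have "(\<Sum>j\<le>3. A i j y) = 0" if "lam i y = 0" for y
    proof -
      have "(\<Sum>j\<le>3. A i j y) = (\<Sum>j\<le>3. P i j y)" using AP that i by (intro sum.cong) auto
      also have "\<dots> = (\<Sum>j\<le>3. h j) \<bullet> p i y" by (simp add: P_def inner_sum_left)
      finally show ?thesis by (simp add: h_sum)
    qed
    moreover have "plt n (\<lambda>y. \<Sum>j\<le>3. A i j y)" using A i by (intro plt_sum) auto
    ultimately show ?thesis using plane_divide[OF _ i, of n "\<lambda>y. \<Sum>j\<le>3. A i j y"] by metis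
  qed
  then obtain r where r: "\<And>i. i \<le> 3 \<Longrightarrow> plt (n - 1) (r i)"
    "\<And>i y. i \<le> 3 \<Longrightarrow> (\<Sum>j\<le>3. A i j y) = lam i y * r i y" by metis
  have rz: "(\<Sum>i\<le>3. lam i y * r i y) = 0" for y
  proof -
    have "(\<Sum>i\<le>3. lam i y * r i y) = (\<Sum>i\<le>3. \<Sum>j\<le>3. A i j y)" using r(2) by (intro sum.cong) auto
    also have "\<dots> = 0" using anti[of 1 0 y] anti[of 2 0 y] anti[of 3 0 y] anti[of 2 1 y] anti[of 3 1 y] anti[of 3 2 y]
      anti[of 0 0 y] anti[of 1 1 y] anti[of 2 2 y] anti[of 3 3 y] by (simp add: sum_le3)
    finally show ?thesis .
  qed
  obtain C where C: "\<And>i j. plt (n - 1 - 1) (C i j)" "\<And>i j y. C i j y = - C j i y"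
    "\<And>i y. i \<le> 3 \<Longrightarrow> r i y = (\<Sum>j\<le>3. lam j y * C i j y)"
    using koszul[OF r(1) rz] by blast
  \<comment> \<open>antisymmetry and the values on the faces are kept, and the row sums become zero\<close>
  define B where "B i j y = A i j y - lam i y * (lam j y * C i j y)" for i j y
  have B: "plt n (B i j)" if "i \<le> 3" "j \<le> 3" for i j
    unfolding B_def by (intro plt_diff A that lam_plt_mult C)
  have Banti: "B i j y = - B j i y" for i j y
    using anti[of i j y] C(2)[of i j y] by (simp add: B_def)
  have Brow: "(\<Sum>j\<le>3. B i j y) = 0" if "i \<le> 3" for i y
    using r(2)[OF that, of y] C(3)[OF that, of y] by (simp add: B_def sum_subtractf sum_distrib_left)
  define v where "v y = vol *\<^sub>R (B 1 3 y *\<^sub>R h 2 - B 1 2 y *\<^sub>R h 3 - B 2 3 y *\<^sub>R h 1)" for y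
  have "vplt n v" unfolding v_def by (intro vplt_cmult vplt_diff vplt_scaleR_const B) auto
  moreover have "cross3 (h i) (v y) = p i y" if i: "i \<le> 3" "lam i y = 0" for i y
  proof -
    have "h j \<bullet> cross3 (h i) (v y) = h j \<bullet> p i y" if "j \<le> 3" for j
    proof -
      have "h j \<bullet> cross3 (h i) (v y) = B i j y"
        unfolding v_def by (rule antisymmetric_cross[of "\<lambda>i j. B i j y"]) (rule Banti Brow i that; assumption?)+
      then show ?thesis using AP[OF i(1) that i(2)] i(2) by (simp add: B_def P_def)
    qed
    then show ?thesis
      using h_expand[of "cross3 (h i) (v y)"] h_expand[of "p i y"] by (simp add: sum_le3)
  qed
  ultimately show ?thesis using that by blast
qed

text \<open>
  The curl equation, again one power of \<open>lam i\<close> at a time. The hypotheses say that the field with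
  the values \<open>lam i ^ j *\<^sub>R p i\<close> has continuous normal components across the interior faces, whose normals are
  \<open>h i - h k\<close>, and zero divergence. The latter makes \<open>p i\<close> tangential on face \<open>i\<close> because \<open>j \<ge> 1\<close>, and both
  together give the compatibility on edges. Subtracting the curl of \<open>lam i ^ Suc j *\<^sub>R v\<close> with the
  lifted field \<open>v\<close> leaves a multiple of \<open>lam i ^ Suc j\<close>. As \<open>v\<close> is the same polynomial on all cells, its curl
  drops out of the jump condition, and the remainder satisfies the hypotheses in lower degree.
\<close>

theorem curl_onto:
  assumes "\<And>i. i \<le> 3 \<Longrightarrow> vplt n (p i)" "1 \<le> j"
    and "\<And>i k y. i \<le> 3 \<Longrightarrow> k \<le> 3 \<Longrightarrow> lam i y = lam k y \<Longrightarrow> (h i - h k) \<bullet> (p i y - p k y) = 0"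
    and "\<And>i y. i \<le> 3 \<Longrightarrow> real j * (h i \<bullet> p i y) + lam i y * vdiv (p i) y = 0"
  obtains w where "\<And>i. i \<le> 3 \<Longrightarrow> vplt n (w i)" "glued lam w"
    "\<And>i y. i \<le> 3 \<Longrightarrow> vcurl (\<lambda>y. lam i y ^ Suc j *\<^sub>R w i y) y = lam i y ^ j *\<^sub>R p i y"
proof -
  have "\<exists>w. (\<forall>i\<le>3. vplt n (w i)) \<and> glued lam w \<and>
    (\<forall>i\<le>3. \<forall>y. vcurl (\<lambda>y. lam i y ^ Suc j *\<^sub>R w i y) y = lam i y ^ j *\<^sub>R p i y)"
    using assms
  proof (induction n arbitrary: j p)
    case 0
    then have "p i y = 0" if "i \<le> 3" for i y using vplt_0 that by blast
    then show ?case
      by (intro exI[of _ "\<lambda>i y. 0"]) (simp add: vplt_zero glued_def vcurl_def vec_eq_iff forall_3)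
  next
    case (Suc n)
    note p = Suc.prems(1) and j = Suc.prems(2) and N = Suc.prems(3) and Z = Suc.prems(4)
    have tang: "h i \<bullet> p i y = 0" if "i \<le> 3" "lam i y = 0" for i y
      using Z[OF that(1), of y] that j by simp
    have edge: "h k \<bullet> p i y + h i \<bullet> p k y = 0" if "i \<le> 3" "k \<le> 3" "lam i y = 0" "lam k y = 0" for i k y
      using N[OF that(1,2), of y] tang[of i y] tang[of k y] that
      by (simp add: inner_diff_left inner_diff_right)
    obtain v0 where v0: "vplt (Suc n) v0" "\<And>i y. i \<le> 3 \<Longrightarrow> lam i y = 0 \<Longrightarrow> cross3 (h i) (v0 y) = p i y"
      using tangential_lift[OF p tang edge] by blast
    \<comment> \<open>the factor cancels the exponent produced by differentiating \<open>lam i ^ Suc j\<close>\<close>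
    define v where "v y = (1 / real (Suc j)) *\<^sub>R v0 y" for y
    have v: "vplt (Suc n) v" unfolding v_def by (intro vplt_cmult v0)
    have vc: "vplt n (vcurl v)" using vplt_vcurl[OF v] by simp
    define q where "q i y = p i y - real (Suc j) *\<^sub>R cross3 (h i) (v y) - lam i y *\<^sub>R vcurl v y" for i y
    have q: "vplt (Suc n) (q i)" if "i \<le> 3" for i unfolding q_def
      by (intro vplt_diff p that vplt_cmult vplt_cross v vplt_affn[OF affn_lam]) (simp add: vc)
    have q0: "q i y = 0" if "i \<le> 3" "lam i y = 0" for i y
      using v0(2)[OF that] that by (simp add: q_def v_def cross_mult_right del: of_nat_Suc)
    have "\<exists>c. vplt n c \<and> (\<forall>y. q i y = lam i y *\<^sub>R c y)" if "i \<le> 3" for i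
      using plane_divide_vector[OF q[OF that] that q0[OF that]] by (metis diff_Suc_1)
    then obtain p' where p': "\<And>i. i \<le> 3 \<Longrightarrow> vplt n (p' i)"
      and qp: "\<And>i y. i \<le> 3 \<Longrightarrow> q i y = lam i y *\<^sub>R p' i y" by metis
    have N': "(h i - h k) \<bullet> (p' i y - p' k y) = 0" if ik: "i \<le> 3" "k \<le> 3" and y: "lam i y = lam k y" for i k y
    proof (cases "i = k")
      case False
      show ?thesis
      proof (rule diagonal_cancel_lam[OF plt_inner[OF vplt_diff[OF p'[OF ik(1)] p'[OF ik(2)]]] ik False ik(1) _ y])
        fix y assume y: "lam i y = lam k y"
        have "lam i y * ((h i - h k) \<bullet> (p' i y - p' k y)) = (h i - h k) \<bullet> (q i y - q k y)"
          using y qp ik by (simp add: algebra_simps)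
        also have "q i y - q k y = (p i y - p k y) - real (Suc j) *\<^sub>R cross3 (h i - h k) (v y)"
        proof -
          have "cross3 (h i - h k) (v y) = cross3 (h i) (v y) - cross3 (h k) (v y)"
            unfolding cross3_def by (simp add: vec_eq_iff forall_3 algebra_simps)
          then show ?thesis using y by (simp add: q_def scaleR_diff_right del: of_nat_Suc)
        qed
        also have "(h i - h k) \<bullet> \<dots> = (h i - h k) \<bullet> (p i y - p k y)"
          by (simp add: inner_diff_right dot_cross_self del: of_nat_Suc)
        finally show "lam i y * ((h i - h k) \<bullet> (p' i y - p' k y)) = 0" using N[OF ik y] by simp
      qed
    qed simp
    have Z': "real (Suc j) * (h i \<bullet> p' i y) + lam i y * vdiv (p' i) y = 0" if i: "i \<le> 3" for i y
    proof (rule lam_power_cancel[OF _ i])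
      show "plt n (\<lambda>y. real (Suc j) * (h i \<bullet> p' i y) + lam i y * vdiv (p' i) y)"
        by (intro plt_add plt_cmult plt_inner p' i lam_plt_mult vplt_vdiv)
      fix y
      obtain m where m: "j = Suc m" using j by (cases j) auto
      have e: "(\<lambda>y. lam i y ^ Suc j *\<^sub>R p' i y) = (\<lambda>y. lam i y ^ j *\<^sub>R p i y - vcurl (\<lambda>y. lam i y ^ Suc j *\<^sub>R v y) y)"
      proof
        fix y
        have "lam i y ^ Suc j *\<^sub>R p' i y = lam i y ^ j *\<^sub>R q i y" using qp[OF i] by (simp add: mult.commute)
        then show "lam i y ^ Suc j *\<^sub>R p' i y = lam i y ^ j *\<^sub>R p i y - vcurl (\<lambda>y. lam i y ^ Suc j *\<^sub>R v y) y"
          unfolding vcurl_lam_power[OF v] q_def by (simp add: scaleR_diff_right scaleR_add_right del: of_nat_Suc)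
      qed
      have "lam i y ^ j * (real (Suc j) * (h i \<bullet> p' i y) + lam i y * vdiv (p' i) y) = vdiv (\<lambda>y. lam i y ^ Suc j *\<^sub>R p' i y) y"
        unfolding vdiv_lam_power[OF p'[OF i]] ..
      also have "\<dots> = vdiv (\<lambda>y. lam i y ^ j *\<^sub>R p i y) y - vdiv (vcurl (\<lambda>y. lam i y ^ Suc j *\<^sub>R v y)) y"
        unfolding e by (rule vdiv_diff)
          (use vplt_differentiable[OF vplt_lam_power[OF p[OF i]]] vplt_differentiable[OF vplt_vcurl[OF vplt_lam_power[OF v]]] in blast)+
      also have "\<dots> = 0"
        using vdiv_vcurl[OF vplt_lam_power[OF v]] Z[OF i, of y] unfolding m vdiv_lam_power[OF p[OF i]]
          by (simp del: power_Suc of_nat_Suc)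
      finally show "lam i y ^ j * (real (Suc j) * (h i \<bullet> p' i y) + lam i y * vdiv (p' i) y) = 0" .
    qed
    have "\<exists>w. (\<forall>i\<le>3. vplt n (w i)) \<and> glued lam w \<and>
      (\<forall>i\<le>3. \<forall>y. vcurl (\<lambda>y. lam i y ^ Suc (Suc j) *\<^sub>R w i y) y = lam i y ^ Suc j *\<^sub>R p' i y)"
    proof (rule Suc.IH)
      show "1 \<le> Suc j" by simp
      show "vplt n (p' i)" if "i \<le> 3" for i by (rule p'[OF that])
    qed (rule N' Z'; assumption)+
    then obtain w where w: "\<forall>i\<le>3. vplt n (w i)" "glued lam w"
      "\<forall>i\<le>3. \<forall>y. vcurl (\<lambda>y. lam i y ^ Suc (Suc j) *\<^sub>R w i y) y = lam i y ^ Suc j *\<^sub>R p' i y"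
      by (elim exE conjE) (rule that)
    let ?w = "\<lambda>i y. v y + lam i y *\<^sub>R w i y"
    have "vplt (Suc n) (?w i)" if "i \<le> 3" for i
      proof -
        have "vplt (Suc n - 1) (w i)" using w(1) that by simp
        from vplt_add[OF v vplt_affn[OF affn_lam this]] show ?thesis .
      qed
    moreover have "glued lam ?w" by (rule glued_step[OF w(2)])
    moreover have "vcurl (\<lambda>y. lam i y ^ Suc j *\<^sub>R ?w i y) y = lam i y ^ j *\<^sub>R p i y" if i: "i \<le> 3" for i y
    proof -
      have wi: "vplt n (w i)" using w(1) i by blast
      have e: "(\<lambda>y. lam i y ^ Suc j *\<^sub>R ?w i y) = (\<lambda>y. lam i y ^ Suc j *\<^sub>R v y + lam i y ^ Suc (Suc j) *\<^sub>R w i y)"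
        by (simp add: scaleR_add_right mult.commute)
      have "vcurl (\<lambda>y. lam i y ^ Suc j *\<^sub>R ?w i y) y = vcurl (\<lambda>y. lam i y ^ Suc j *\<^sub>R v y) y + vcurl (\<lambda>y. lam i y ^ Suc (Suc j) *\<^sub>R w i y) y"
        unfolding e by (rule vcurl_add)
          (use vplt_differentiable[OF vplt_lam_power[OF v]] vplt_differentiable[OF vplt_lam_power[OF wi]] in blast)+
      also have "\<dots> = vcurl (\<lambda>y. lam i y ^ Suc j *\<^sub>R v y) y + lam i y ^ j *\<^sub>R q i y"
        using w(3) i qp[OF i] by (simp add: mult.commute)
      also have "\<dots> = lam i y ^ j *\<^sub>R p i y"
        unfolding vcurl_lam_power[OF v] q_def by (simp add: scaleR_diff_right scaleR_add_right del: of_nat_Suc)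
      finally show ?thesis .
    qed
    ultimately show ?case by (intro exI[of _ ?w] conjI allI impI)
  qed
  then show ?thesis using that by blast
qed

end

section \<open>The cells of the Alfeld split\<close>

lemma plt_zero_open:
  assumes p: "plt n p" and U: "open U" "a \<in> U"
    and z: "\<And>t. a + t *\<^sub>R (y - a) \<in> U \<Longrightarrow> p (a + t *\<^sub>R (y - a)) = 0"
  shows "p y = 0"
proof -
  have "open ((\<lambda>t. a + t *\<^sub>R (y - a)) -` U)"
    by (intro open_vimage U continuous_intros)
  moreover have "0 \<in> (\<lambda>t. a + t *\<^sub>R (y - a)) -` U" using U by simp
  ultimately obtain e where e: "e > 0" "ball 0 e \<subseteq> (\<lambda>t. a + t *\<^sub>R (y - a)) -` U"
    by (meson open_contains_ball)
  show ?thesis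
  proof (rule plt_zero_extend[OF p e(1)])
    fix t :: real assume "0 < t" "t < e"
    then have "t \<in> ball 0 e" by (simp add: dist_real_def)
    then show "p (a + t *\<^sub>R (y - a)) = 0" using e z by blast
  qed
qed

context tetrahedron
begin

lemma open_lam: "open {y. 0 < lam i y}" "open {y. lam i y < lam j y}"
  by (intro open_Collect_less continuous_affn affn_lam continuous_on_const)+

lemma lam_convex_comb: "u + v = 1 \<Longrightarrow> lam i (u *\<^sub>R a + v *\<^sub>R b) = u * lam i a + v * lam i b"
proof -
  assume "u + v = 1"
  then have u: "u = 1 - v" by simp
  show ?thesis using lam_line[of i a v b] unfolding u by (simp add: algebra_simps)
qed

lemma convex_lam_le: "convex {y. lam i y \<le> lam j y}" 
  unfolding convex_def by (auto simp: lam_convex_comb intro!: add_mono mult_left_mono)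

lemma convex_lam_nonneg: "convex {y. 0 \<le> lam i y}"
  unfolding convex_def by (auto simp: lam_convex_comb)

lemma convex_lam_zero: "convex {y. lam i y = 0}"
  unfolding convex_def by (auto simp: lam_convex_comb)

text \<open>
  Faces of every dimension at once.
\<close>

lemma hull_eq:
  assumes S: "S \<subseteq> {..3}"
  shows "convex hull (x ` S) = {y. (\<forall>i\<in>S. 0 \<le> lam i y) \<and> (\<forall>i\<in>{..3} - S. lam i y = 0)}"
proof (intro equalityI)
  let ?R = "{y. (\<forall>i\<in>S. 0 \<le> lam i y) \<and> (\<forall>i\<in>{..3} - S. lam i y = 0)}"
  have "?R = (\<Inter>i\<in>S. {y. 0 \<le> lam i y}) \<inter> (\<Inter>i\<in>{..3} - S. {y. lam i y = 0})" by auto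
  then have "convex ?R" by (auto intro!: convex_Int convex_INT convex_lam_nonneg convex_lam_zero)
  moreover have "x ` S \<subseteq> ?R"
  proof
    fix z assume "z \<in> x ` S"
    then obtain k where k: "k \<in> S" "z = x k" by blast
    then have "lam i z = (if i = k then 1 else 0)" if "i \<le> 3" for i using lam_vertex[of i k] that S by auto
    then show "z \<in> ?R" using S k by auto
  qed
  ultimately show "convex hull (x ` S) \<subseteq> ?R" by (rule hull_minimal[rotated])
  show "?R \<subseteq> convex hull (x ` S)"
  proof
    fix y assume y: "y \<in> ?R"
    have s: "(\<Sum>i\<le>3. lam i y *\<^sub>R x i) = (\<Sum>i\<in>S. lam i y *\<^sub>R x i)" "(\<Sum>i\<le>3. lam i y) = (\<Sum>i\<in>S. lam i y)"
      using y S by (intro sum.mono_neutral_right; auto)+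
    have "(\<Sum>i\<in>S. lam i y *\<^sub>R x i) \<in> convex hull (x ` S)"
      using y lam_sum[of y] S finite_subset[OF S] unfolding s
      by (intro convex_sum) (auto intro: hull_inc)
    then show "y \<in> convex hull (x ` S)" using lam_expand[of y] s by simp
  qed
qed

lemma tetra_iff: "y \<in> tetra x \<longleftrightarrow> (\<forall>i\<le>3. 0 \<le> lam i y)"
  unfolding tetra_def by (subst hull_eq) auto

lemma lam_barycenter: "i \<le> 3 \<Longrightarrow> lam i (barycenter x) = 1/4"
proof -
  assume i: "i \<le> 3"
  have "barycenter x = x 0 + (1/4) *\<^sub>R (x 1 - x 0) + (1/4) *\<^sub>R (x 2 - x 0) + (1/4) *\<^sub>R (x 3 - x 0)"
  proof -
    have "x 0 = (1/4 + 1/4 + 1/4 + 1/4) *\<^sub>R x 0" by simp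
    then show ?thesis unfolding barycenter_def sum_le3 by (simp only: scaleR_add_left) (simp add: algebra_simps)
  qed
  then have "lam i (barycenter x) = lam i (x 0) + (1/4) * (h i \<bullet> (x 1 - x 0)) + (1/4) * (h i \<bullet> (x 2 - x 0)) + (1/4) * (h i \<bullet> (x 3 - x 0))"
    by (simp add: lam_diff)
  then show ?thesis using le3_cases[OF i] by (elim disjE) (simp_all add: lam_vertex h_edge)
qed

text \<open>
  Cell \<open>i\<close> consists of the points whose \<open>i\<close>-th coordinate is the smallest: the barycenter has all
  coordinates \<open>1 / 4\<close>, so with weight \<open>4 * lam i y\<close> on it the other weights are \<open>lam j y - lam i y\<close>.
\<close>

lemma alfeld_iff:
  assumes i: "i \<le> 3"
  shows "y \<in> alfeld x i \<longleftrightarrow> 0 \<le> lam i y \<and> (\<forall>j\<le>3. lam i y \<le> lam j y)"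
proof
  let ?x = "x(i := barycenter x)"
  let ?R = "{y. 0 \<le> lam i y} \<inter> (\<Inter>j\<in>{..3}. {y. lam i y \<le> lam j y})"
  have "convex ?R" by (intro convex_Int convex_INT convex_lam_nonneg convex_lam_le)
  moreover have "?x ` {..3} \<subseteq> ?R"
  proof
    fix z assume "z \<in> ?x ` {..3}"
    then obtain k where k: "k \<le> 3" "z = ?x k" by blast
    then show "z \<in> ?R" using i by (auto simp: lam_barycenter lam_vertex)
  qed
  ultimately have "convex hull (?x ` {..3}) \<subseteq> ?R" by (rule hull_minimal[rotated])
  then show "y \<in> alfeld x i \<Longrightarrow> 0 \<le> lam i y \<and> (\<forall>j\<le>3. lam i y \<le> lam j y)"
    unfolding alfeld_def tetra_def by auto
  assume y: "0 \<le> lam i y \<and> (\<forall>j\<le>3. lam i y \<le> lam j y)"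
  let ?a = "\<lambda>j. if j = i then 4 * lam i y else lam j y - lam i y"
  have "(\<Sum>j\<le>3. ?a j *\<^sub>R ?x j) \<in> convex hull (?x ` {..3})"
  proof (intro convex_sum)
    show "(\<Sum>j\<le>3. ?a j) = 1" using lam_sum[of y] le3_cases[OF i] by (elim disjE) (simp_all add: sum_le3)
  qed (use y in \<open>auto intro: hull_inc\<close>)
  moreover have "(\<Sum>j\<le>3. ?a j *\<^sub>R ?x j) = (\<Sum>j\<le>3. lam j y *\<^sub>R x j)"
    using le3_cases[OF i] unfolding barycenter_def
    by (elim disjE) (simp_all add: sum_le3 algebra_simps)
  ultimately show "y \<in> alfeld x i" using lam_expand[of y] unfolding alfeld_def tetra_def by simp
qed

text \<open>
  Used to see that an inequality defining a cell is strict in the interior: move in a direction that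
  would violate it.
\<close>

lemma interior_direction:
  assumes "y \<in> interior S" obtains t where "0 < t" "y + t *\<^sub>R d \<in> (S :: (real^3) set)"
proof -
  have "open ((\<lambda>t. y + t *\<^sub>R d) -` interior S)" by (intro open_vimage open_interior continuous_intros)
  moreover have "0 \<in> (\<lambda>t. y + t *\<^sub>R d) -` interior S" using assms by simp
  ultimately obtain e where e: "e > 0" "ball 0 e \<subseteq> (\<lambda>t. y + t *\<^sub>R d) -` interior S"
    by (meson open_contains_ball)
  then have "e/2 \<in> (\<lambda>t. y + t *\<^sub>R d) -` interior S" by (intro subsetD[OF e(2)]) (simp add: dist_real_def)
  then have "y + (e/2) *\<^sub>R d \<in> S" using interior_subset by blast
  then show ?thesis using that[of "e/2"] e by simp
qed

lemma interior_alfeld_iff: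
  assumes i: "i \<le> 3"
  shows "y \<in> interior (alfeld x i) \<longleftrightarrow> 0 < lam i y \<and> (\<forall>j\<le>3. j \<noteq> i \<longrightarrow> lam i y < lam j y)"
proof
  let ?U = "{y. 0 < lam i y} \<inter> (\<Inter>j\<in>{..3} - {i}. {y. lam i y < lam j y})"
  assume y: "0 < lam i y \<and> (\<forall>j\<le>3. j \<noteq> i \<longrightarrow> lam i y < lam j y)"
  have "open ?U" by (intro open_Int open_INT ballI open_lam) simp
  moreover have "?U \<subseteq> alfeld x i" by (auto simp: alfeld_iff[OF i]) (metis less_eq_real_def DiffI atMost_iff singletonD)
  ultimately have "?U \<subseteq> interior (alfeld x i)" by (rule interior_maximal[rotated])
  then show "y \<in> interior (alfeld x i)" using y by auto
next
  assume y: "y \<in> interior (alfeld x i)"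
  then have ya: "y \<in> alfeld x i" using interior_subset by blast
  have "lam i y < lam j y" if j: "j \<le> 3" "j \<noteq> i" for j
  proof -
    obtain t where t: "0 < t" "y + t *\<^sub>R (x i - x j) \<in> alfeld x i" by (rule interior_direction[OF y])
    then have "lam i (y + t *\<^sub>R (x i - x j)) \<le> lam j (y + t *\<^sub>R (x i - x j))" using j alfeld_iff[OF i] by blast
    then show ?thesis using t j i h_edge by (simp add: lam_diff)
  qed
  moreover have "0 < lam i y"
  proof -
    obtain j where j: "j \<le> 3" "j \<noteq> i" using ex_other[OF i i i] by blast
    obtain t where t: "0 < t" "y + t *\<^sub>R (x j - x i) \<in> alfeld x i" by (rule interior_direction[OF y])
    then have "0 \<le> lam i (y + t *\<^sub>R (x j - x i))" using alfeld_iff[OF i] by blast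
    then show ?thesis using t j i h_edge by (simp add: lam_diff)
  qed
  ultimately show "0 < lam i y \<and> (\<forall>j\<le>3. j \<noteq> i \<longrightarrow> lam i y < lam j y)" by blast
qed

lemma interior_tetra_iff: "y \<in> interior (tetra x) \<longleftrightarrow> (\<forall>i\<le>3. 0 < lam i y)"
proof
  let ?U = "\<Inter>j\<in>{..3}. {y. 0 < lam j y}"
  assume y: "\<forall>i\<le>3. 0 < lam i y"
  have "open ?U" by (intro open_INT) (auto intro: open_lam)
  moreover have "?U \<subseteq> tetra x" by (auto simp: tetra_iff less_imp_le)
  ultimately have "?U \<subseteq> interior (tetra x)" by (rule interior_maximal[rotated])
  then show "y \<in> interior (tetra x)" using y by auto
next
  assume y: "y \<in> interior (tetra x)"
  show "\<forall>i\<le>3. 0 < lam i y"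
  proof (intro allI impI)
    fix i :: nat assume i: "i \<le> 3"
    obtain j where j: "j \<le> 3" "j \<noteq> i" using ex_other[OF i i i] by blast
    obtain t where t: "0 < t" "y + t *\<^sub>R (x j - x i) \<in> tetra x" by (rule interior_direction[OF y])
    then have "0 \<le> lam i (y + t *\<^sub>R (x j - x i))" using tetra_iff i by blast
    then show "0 < lam i y" using t j i h_edge by (simp add: lam_diff)
  qed
qed

lemma compact_tetra: "compact (tetra x)"
  unfolding tetra_def by (intro compact_convex_hull finite_imp_compact) simp

lemma closed_alfeld: "closed (alfeld x i)"
  unfolding alfeld_def tetra_def by (intro compact_imp_closed compact_convex_hull finite_imp_compact) simp

lemma frontier_tetra_iff: "y \<in> frontier (tetra x) \<longleftrightarrow> y \<in> tetra x \<and> (\<exists>i\<le>3. lam i y = 0)"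
  unfolding frontier_def closure_closed[OF compact_imp_closed[OF compact_tetra]] Diff_iff interior_tetra_iff
  using tetra_iff[of y] by (auto simp: less_le)

lemma alfeld_subset: "i \<le> 3 \<Longrightarrow> alfeld x i \<subseteq> tetra x"
proof
  fix y assume "i \<le> 3" "y \<in> alfeld x i"
  then have "0 \<le> lam i y" "\<forall>j\<le>3. lam i y \<le> lam j y" using alfeld_iff by auto
  then show "y \<in> tetra x" unfolding tetra_iff by (meson order_trans)
qed

lemma alfeld_cover: assumes "y \<in> tetra x" obtains i where "i \<le> 3" "y \<in> alfeld x i"
proof -
  have f: "finite ((\<lambda>i. lam i y) ` {..3})" "(\<lambda>i. lam i y) ` {..3} \<noteq> {}" by auto
  from Min_in[OF this] obtain i where "i \<in> {..3}" "Min ((\<lambda>i. lam i y) ` {..3}) = lam i y" by (rule imageE)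
  then have i: "i \<le> 3" "lam i y = Min ((\<lambda>i. lam i y) ` {..3})" by auto
  then have "\<forall>j\<le>3. lam i y \<le> lam j y" using Min_le[OF f(1)] by auto
  then show ?thesis using that[OF i(1)] i(1) assms tetra_iff alfeld_iff by blast
qed

lemma tetra_Union: "tetra x = (\<Union>i\<in>{..3}. alfeld x i)"
proof (intro equalityI subsetI)
  fix y assume "y \<in> tetra x"
  then obtain i where "i \<le> 3" "y \<in> alfeld x i" by (rule alfeld_cover)
  then show "y \<in> (\<Union>i\<in>{..3}. alfeld x i)" by auto
next
  fix y assume "y \<in> (\<Union>i\<in>{..3}. alfeld x i)"
  then obtain i where "i \<le> 3" "y \<in> alfeld x i" by auto
  then show "y \<in> tetra x" using alfeld_subset by auto
qed

lemma point_with_lam: assumes "(\<Sum>i\<le>3. a i) = 1" obtains y where "\<And>i. i \<le> 3 \<Longrightarrow> lam i y = a i"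
proof -
  define W where "W i = a i - (if i = 0 then 1 else 0)" for i :: nat
  have W: "(\<Sum>i\<le>3. W i) = 0" using assms by (simp add: W_def sum_le3)
  have "lam i (x 0 + (\<Sum>i\<le>3. W i *\<^sub>R x i)) = a i" if "i \<le> 3" for i
    unfolding lam_diff h_comb[OF W that] using lam_vertex[OF that, of 0] by (simp add: W_def)
  then show ?thesis using that by blast
qed

lemma cell_points: assumes i: "i \<le> 3"
  obtains q where "q \<in> interior (alfeld x i)"
proof -
  obtain q where q: "\<And>j. j \<le> 3 \<Longrightarrow> lam j q = (if j = i then 1/16 else 5/16)"
    by (rule point_with_lam[of "\<lambda>j. if j = i then 1/16 else 5/16"])
      (use le3_cases[OF i] in \<open>auto simp: sum_le3\<close>)
  then show ?thesis using that[of q] interior_alfeld_iff[OF i] i by simp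
qed

lemma open_cells_iff: "y \<in> open_cells x \<longleftrightarrow> (\<exists>i\<le>3. y \<in> interior (alfeld x i))"
  unfolding open_cells_def by auto

lemma interior_alfeld_disjoint:
  "i \<le> 3 \<Longrightarrow> j \<le> 3 \<Longrightarrow> y \<in> interior (alfeld x i) \<Longrightarrow> y \<in> alfeld x j \<Longrightarrow> i = j"
  by (metis interior_alfeld_iff alfeld_iff not_less)

lemma plt_zero_cell:
  assumes "plt n p" "i \<le> 3" "\<And>y. y \<in> interior (alfeld x i) \<Longrightarrow> p y = 0" shows "p y = 0"
proof -
  obtain q where "q \<in> interior (alfeld x i)" by (rule cell_points[OF assms(2)])
  then show ?thesis using plt_zero_open[OF assms(1) open_interior, of q] assms(3) by blast
qed

text \<open>
  The common face of two cells has nonempty interior relative to the plane through it. The point \<open>q\<close>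
  below is such an interior point.
\<close>

lemma plt_zero_diagonal:
  assumes p: "plt n p" and i: "i \<le> 3" "j \<le> 3"
    and z: "\<And>y. y \<in> alfeld x i \<Longrightarrow> y \<in> alfeld x j \<Longrightarrow> p y = 0" and y: "lam i y = lam j y"
  shows "p y = 0"
proof (cases "i = j")
  case True
  then show ?thesis using plt_zero_cell[OF p i(1)] z interior_subset by blast
next
  case False
  obtain q where q: "\<And>k. k \<le> 3 \<Longrightarrow> lam k q = (if k = i \<or> k = j then 1/8 else 3/8)"
    by (rule point_with_lam[of "\<lambda>k. if k = i \<or> k = j then 1/8 else 3/8"])
      (use le3_cases[OF i(1)] le3_cases[OF i(2)] False in \<open>auto simp: sum_le3\<close>)
  let ?U = "{y. 0 < lam i y} \<inter> (\<Inter>k\<in>{..3} - {i, j}. {y. lam i y < lam k y})"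
  show ?thesis
  proof (rule plt_zero_open[OF p, of ?U q])
    show "open ?U" by (intro open_Int open_INT ballI open_lam) simp
    show "q \<in> ?U" using q i by auto
    fix t assume U: "q + t *\<^sub>R (y - q) \<in> ?U"
    let ?z = "q + t *\<^sub>R (y - q)"
    have e: "lam i ?z = lam j ?z" using q i y by (simp add: lam_line)
    have "lam i ?z \<le> lam k ?z" if "k \<le> 3" for k using U e that
      by (cases "k = i \<or> k = j") (auto intro: less_imp_le)
    then have "?z \<in> alfeld x i" "?z \<in> alfeld x j" using U e alfeld_iff i by auto
    then show "p ?z = 0" by (rule z)
  qed
qed

lemma plt_zero_face:
  assumes p: "plt n p" and i: "i \<le> 3"
    and z: "\<And>y. y \<in> tetra x \<Longrightarrow> lam i y = 0 \<Longrightarrow> p y = 0" and y: "lam i y = 0"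
  shows "p y = 0"
proof -
  obtain q where q: "\<And>k. k \<le> 3 \<Longrightarrow> lam k q = (if k = i then 0 else 1/3)"
    by (rule point_with_lam[of "\<lambda>k. if k = i then 0 else 1/3"])
      (use le3_cases[OF i] in \<open>auto simp: sum_le3\<close>)
  let ?U = "\<Inter>k\<in>{..3} - {i}. {y. 0 < lam k y}"
  show ?thesis
  proof (rule plt_zero_open[OF p, of ?U q])
    show "open ?U" by (intro open_INT) (auto intro: open_lam)
    show "q \<in> ?U" using q by auto
    fix t assume U: "q + t *\<^sub>R (y - q) \<in> ?U"
    let ?z = "q + t *\<^sub>R (y - q)"
    have e: "lam i ?z = 0" using q i y by (simp add: lam_line)
    then have "?z \<in> tetra x" using U unfolding tetra_iff by (metis DiffI INT_E atMost_iff less_eq_real_def mem_Collect_eq singletonD)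
    then show "p ?z = 0" using e z by blast
  qed
qed

section \<open>Continuous piecewise polynomials\<close>

text \<open>
  The choice of the cell does not matter for glued families, see \<open>pasted_eq\<close>.
\<close>

definition pasted :: "(nat \<Rightarrow> real^3 \<Rightarrow> 'a::zero) \<Rightarrow> real^3 \<Rightarrow> 'a"
  where "pasted p y = (if y \<in> tetra x then p (SOME i. i \<le> 3 \<and> y \<in> alfeld x i) y else 0)"

lemma glued_lam_eq:
  assumes "glued lam p" "i \<le> 3" "j \<le> 3" "y \<in> alfeld x i" "y \<in> alfeld x j" shows "p i y = p j y"
proof -
  have "lam i y = lam j y" using assms alfeld_iff by (metis order_antisym)
  then show ?thesis using assms unfolding glued_def by blast
qed

lemma pasted_eq: assumes "glued lam p" "i \<le> 3" "y \<in> alfeld x i" shows "pasted p y = p i y"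
proof -
  have "\<exists>i. i \<le> 3 \<and> y \<in> alfeld x i" using assms by blast
  from someI_ex[OF this] have "p (SOME i. i \<le> 3 \<and> y \<in> alfeld x i) y = p i y"
    using glued_lam_eq[OF assms(1)] assms by blast
  then show ?thesis unfolding pasted_def using assms alfeld_subset by auto
qed

lemma pasted_off: "y \<notin> tetra x \<Longrightarrow> pasted p y = 0"
  by (simp add: pasted_def)

lemma M0_pieces:
  assumes "w \<in> M0 n x"
  obtains p where "\<And>i. i \<le> 3 \<Longrightarrow> plt (Suc n) (p i)" "glued lam p"
    "\<And>i y. i \<le> 3 \<Longrightarrow> y \<in> alfeld x i \<Longrightarrow> w y = p i y"
proof -
  have "\<exists>p. plt (Suc n) p \<and> (\<forall>y\<in>alfeld x i. w y = p y)" if "i \<le> 3" for i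
  proof -
    have "restr (alfeld x i) w \<in> Pol n (alfeld x i)" using assms that unfolding M0_def by blast
    then obtain p where "p \<in> polys n" "restr (alfeld x i) w = restr (alfeld x i) p" unfolding Pol_def by blast
    then show ?thesis unfolding polys_iff_plt restr_def by (metis (full_types))
  qed
  then obtain p where p: "\<And>i. i \<le> 3 \<Longrightarrow> plt (Suc n) (p i)"
    "\<And>i y. i \<le> 3 \<Longrightarrow> y \<in> alfeld x i \<Longrightarrow> w y = p i y" by metis
  have "glued lam p" unfolding glued_def
  proof (intro allI impI)
    fix i j y assume ij: "i \<le> 3" "j \<le> 3" "lam i y = lam j y"
    have z: "p i y - p j y = 0" if "y \<in> alfeld x i" "y \<in> alfeld x j" for y
      using p(2)[OF ij(1) that(1)] p(2)[OF ij(2) that(2)] by simp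
    have "(\<lambda>y. p i y - p j y) y = 0"
      by (rule plt_zero_diagonal[OF plt_diff[OF p(1)[OF ij(1)] p(1)[OF ij(2)]] ij(1,2) z ij(3)])
    then show "p i y = p j y" by simp
  qed
  then show ?thesis using that p by blast
qed

lemma M0_I:
  assumes "\<And>i. i \<le> 3 \<Longrightarrow> plt (Suc n) (p i)" "\<And>y. y \<notin> tetra x \<Longrightarrow> w y = 0"
    "\<And>i y. i \<le> 3 \<Longrightarrow> y \<in> alfeld x i \<Longrightarrow> w y = p i y"
  shows "w \<in> M0 n x"
proof -
  have "continuous_on (alfeld x i) w" if "i \<le> 3" for i
  proof -
    have "continuous_on (alfeld x i) w \<longleftrightarrow> continuous_on (alfeld x i) (p i)"
      by (rule continuous_on_cong[OF refl]) (rule assms(3)[OF that])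
    then show ?thesis using plt_continuous[OF assms(1)[OF that]] by simp
  qed
  then have "continuous_on (tetra x) w"
    unfolding tetra_Union by (intro continuous_on_closed_Union) (auto intro: closed_alfeld)
  moreover have "restr (tetra x) w = w" using assms(2) by (auto simp: restr_def)
  moreover have "restr (alfeld x i) w \<in> Pol n (alfeld x i)" if "i \<le> 3" for i
    unfolding Pol_def
    by (rule image_eqI[of _ _ "p i"]) (use assms that in \<open>auto simp: restr_def polys_iff_plt\<close>)
  ultimately show ?thesis unfolding M0_def by blast
qed

lemma M0_off: "w \<in> M0 n x \<Longrightarrow> y \<notin> tetra x \<Longrightarrow> w y = 0"
proof -
  assume "w \<in> M0 n x" "y \<notin> tetra x"
  then have "restr (tetra x) w = w" unfolding M0_def by blast
  from fun_cong[OF this, of y] show "w y = 0" using \<open>y \<notin> tetra x\<close> by (simp add: restr_def)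
qed

definition bubbles :: "nat \<Rightarrow> (real^3 \<Rightarrow> real) set"
  where "bubbles n = {w \<in> M0 n x. \<forall>y\<in>frontier (tetra x). w y = 0}"

text \<open>
  Cell \<open>i\<close> meets the boundary in the face \<open>lam i = 0\<close>, so that \<open>lam i\<close> divides the polynomial there.
  Since \<open>lam i\<close> agrees with \<open>lam j\<close> on the common plane of two cells and is nonzero on most of it, the quotients are
  glued again.
\<close>

lemma bubbles_pieces:
  assumes "w \<in> bubbles n"
  obtains p where "\<And>i. i \<le> 3 \<Longrightarrow> plt n (p i)" "glued lam p"
    "\<And>i y. i \<le> 3 \<Longrightarrow> y \<in> alfeld x i \<Longrightarrow> w y = lam i y * p i y"
proof -
  have w: "w \<in> M0 n x" "\<And>y. y \<in> frontier (tetra x) \<Longrightarrow> w y = 0" using assms unfolding bubbles_def by auto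
  obtain p where p: "\<And>i. i \<le> 3 \<Longrightarrow> plt (Suc n) (p i)" "glued lam p"
    "\<And>i y. i \<le> 3 \<Longrightarrow> y \<in> alfeld x i \<Longrightarrow> w y = p i y" by (rule M0_pieces[OF w(1)]) (rule that)
  have "\<exists>q. plt n q \<and> (\<forall>y. p i y = lam i y * q y)" if i: "i \<le> 3" for i
  proof -
    have "p i y = 0" if "lam i y = 0" for y
    proof (rule plt_zero_face[OF p(1)[OF i] i _ that])
      fix y assume y: "y \<in> tetra x" "lam i y = 0"
      then have "y \<in> alfeld x i" using alfeld_iff[OF i] tetra_iff by simp
      moreover have "y \<in> frontier (tetra x)" using frontier_tetra_iff y i by blast
      ultimately show "p i y = 0" using p(3)[OF i] w(2) by metis
    qed
    from plane_divide[OF p(1)[OF i] i this] show ?thesis by (metis diff_Suc_1)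
  qed
  then obtain q where q: "\<And>i. i \<le> 3 \<Longrightarrow> plt n (q i)" "\<And>i y. i \<le> 3 \<Longrightarrow> p i y = lam i y * q i y" by metis
  have "glued lam q" unfolding glued_def
  proof (intro allI impI)
    fix i j y assume ij: "i \<le> 3" "j \<le> 3" and y: "lam i y = lam j y"
    show "q i y = q j y"
    proof (cases "i = j")
      case False
      have "(\<lambda>y. q i y - q j y) y = 0"
      proof (rule diagonal_cancel_lam[OF plt_diff[OF q(1)[OF ij(1)] q(1)[OF ij(2)]] ij False ij(1) _ y])
        fix y assume y: "lam i y = lam j y"
        then have "p i y = p j y" using p(2) ij unfolding glued_def by blast
        then show "lam i y * (q i y - q j y) = 0" using q(2) ij y by (simp add: algebra_simps)
      qed
      then show ?thesis by simp
    qed simp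
  qed
  then show ?thesis using that q p(3) by metis
qed

lemma bubbles_I:
  assumes "\<And>i. i \<le> 3 \<Longrightarrow> plt n (p i)" "\<And>y. y \<notin> tetra x \<Longrightarrow> w y = 0"
    "\<And>i y. i \<le> 3 \<Longrightarrow> y \<in> alfeld x i \<Longrightarrow> w y = lam i y * p i y"
  shows "w \<in> bubbles n"
proof -
  have "w \<in> M0 n x"
  proof (rule M0_I[of n "\<lambda>i y. lam i y * p i y"])
    show "plt (Suc n) (\<lambda>y. lam i y * p i y)" if "i \<le> 3" for i
      by (rule lam_plt_mult) (simp add: assms(1)[OF that])
  qed (rule assms(2,3); assumption)+
  moreover have "w y = 0" if fy: "y \<in> frontier (tetra x)" for y
  proof -
    obtain i where i: "i \<le> 3" "lam i y = 0" and y: "y \<in> tetra x"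
      using fy unfolding frontier_tetra_iff by blast
    have "y \<in> alfeld x i" using y i(2) unfolding alfeld_iff[OF i(1)] tetra_iff by simp
    then show ?thesis using assms(3)[OF i(1), of y] i(2) by simp
  qed
  ultimately show ?thesis unfolding bubbles_def by blast
qed

lemma vector_bubbles_pieces:
  assumes "w \<in> vec3 (bubbles n)"
  obtains p where "\<And>i. i \<le> 3 \<Longrightarrow> vplt n (p i)" "glued lam p"
    "\<And>i y. i \<le> 3 \<Longrightarrow> y \<in> alfeld x i \<Longrightarrow> w y = lam i y *\<^sub>R p i y"
proof -
  have "\<forall>k. \<exists>p. (\<forall>i\<le>3. plt n (p i)) \<and> glued lam p \<and> (\<forall>i\<le>3. \<forall>y\<in>alfeld x i. w y $ k = lam i y * p i y)"
  proof
    fix k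
    have "(\<lambda>y. w y $ k) \<in> bubbles n" using assms unfolding vec3_def by blast
    then obtain p where "\<And>i. i \<le> 3 \<Longrightarrow> plt n (p i)" "glued lam p"
      "\<And>i y. i \<le> 3 \<Longrightarrow> y \<in> alfeld x i \<Longrightarrow> w y $ k = lam i y * p i y" by (rule bubbles_pieces) (rule that)
    then show "\<exists>p. (\<forall>i\<le>3. plt n (p i)) \<and> glued lam p \<and> (\<forall>i\<le>3. \<forall>y\<in>alfeld x i. w y $ k = lam i y * p i y)"
      by blast
  qed
  from choice[OF this]
  obtain P where "\<forall>k. (\<forall>i\<le>3. plt n (P k i)) \<and> glued lam (P k) \<and> (\<forall>i\<le>3. \<forall>y\<in>alfeld x i. w y $ k = lam i y * P k i y)" ..
  then have P: "\<And>k i. i \<le> 3 \<Longrightarrow> plt n (P k i)" "\<And>k. glued lam (P k)"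
    "\<And>k i y. i \<le> 3 \<Longrightarrow> y \<in> alfeld x i \<Longrightarrow> w y $ k = lam i y * P k i y" by blast+
  show ?thesis
  proof (rule that[of "\<lambda>i y. \<chi> k. P k i y"])
    show "glued lam (\<lambda>i y. \<chi> k. P k i y)" unfolding glued_def
    proof (intro allI impI)
      fix i j y assume ij: "i \<le> (3::nat)" "j \<le> (3::nat)" "lam i y = lam j y"
      have "P k i y = P k j y" for k using P(2)[of k] ij unfolding glued_def by blast
      then show "(\<chi> k. P k i y) = (\<chi> k. P k j y)" by simp
    qed
    show "vplt n (\<lambda>y. \<chi> k. P k i y)" if "i \<le> 3" for i using P(1)[OF that] by (simp add: vplt_def)
    show "w y = lam i y *\<^sub>R (\<chi> k. P k i y)" if "i \<le> 3" "y \<in> alfeld x i" for i y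
      using P(3)[OF that] by (simp add: vec_eq_iff)
  qed
qed

lemma vector_bubbles_I:
  assumes "\<And>i. i \<le> 3 \<Longrightarrow> vplt n (p i)" "\<And>y. y \<notin> tetra x \<Longrightarrow> w y = 0"
    "\<And>i y. i \<le> 3 \<Longrightarrow> y \<in> alfeld x i \<Longrightarrow> w y = lam i y *\<^sub>R p i y"
  shows "w \<in> vec3 (bubbles n)"
  unfolding vec3_def
proof (intro CollectI allI)
  fix k
  show "(\<lambda>y. w y $ k) \<in> bubbles n"
  proof (rule bubbles_I[of n "\<lambda>i y. p i y $ k"])
    show "plt n (\<lambda>y. p i y $ k)" if "i \<le> 3" for i using assms(1)[OF that] unfolding vplt_def by blast
    show "w y $ k = 0" if "y \<notin> tetra x" for y using assms(2)[OF that] by simp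
    show "w y $ k = lam i y * p i y $ k" if "i \<le> 3" "y \<in> alfeld x i" for i y using assms(3)[OF that] by simp
  qed
qed

section \<open>Piecewise differential operators on polynomial pieces\<close>

text \<open>
  The operators of the piecewise calculus depend only on the values in an open cell, where the
  function is a polynomial.
\<close>

lemma pd_local:
  assumes "plt n p" "i \<le> 3" "y \<in> interior (alfeld x i)" "\<And>u. u \<in> interior (alfeld x i) \<Longrightarrow> f u = p u"
  shows "pd k f y = pd k p y"
  unfolding pd_def using frechet_derivative_transform_within_open[OF plt_differentiable[OF assms(1)] open_interior assms(3), of f]
    assms(4) by simp

lemma div3_local:
  assumes "vplt n p" "i \<le> 3" "y \<in> interior (alfeld x i)" "\<And>u. u \<in> interior (alfeld x i) \<Longrightarrow> w u = p u"
  shows "div3 x w y = vdiv p y"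
proof -
  have "pd k (\<lambda>u. w u $ j) y = pd k (\<lambda>u. p u $ j) y" for k j
    by (rule pd_local[OF _ assms(2,3)]) (use assms in \<open>auto simp: vplt_def\<close>)
  moreover have "y \<in> open_cells x" using assms open_cells_iff by blast
  ultimately show ?thesis unfolding div3_def vdiv_def restr_def by simp
qed

lemma curl_local:
  assumes "vplt n p" "i \<le> 3" "y \<in> interior (alfeld x i)" "\<And>u. u \<in> interior (alfeld x i) \<Longrightarrow> w u = p u"
  shows "curl x w y = vcurl p y"
proof -
  have "pd k (\<lambda>u. w u $ j) y = pd k (\<lambda>u. p u $ j) y" for k j
    by (rule pd_local[OF _ assms(2,3)]) (use assms in \<open>auto simp: vplt_def\<close>)
  moreover have "y \<in> open_cells x" using assms open_cells_iff by blast
  ultimately show ?thesis unfolding curl_def vcurl_def restr_def by simp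
qed

end

section \<open>Integrals\<close>

text \<open>
  Stated for an arbitrary Euclidean space because it serves on edges, faces and cells alike.
\<close>

lemma integral_zero_imp_zero:
  fixes f :: "'a::euclidean_space \<Rightarrow> real"
  assumes int: "integrable lborel (\<lambda>y. indicator S y * f y)"
    and nn: "\<And>y. y \<in> S \<Longrightarrow> 0 \<le> f y"
    and zero: "integral\<^sup>L lborel (\<lambda>y. indicator S y * f y) = 0"
    and U: "open U" "U \<subseteq> S" "continuous_on U f" "y \<in> U"
  shows "f y = 0"
proof (rule ccontr)
  assume "f y \<noteq> 0"
  let ?N = "{y \<in> U. f y \<noteq> 0}"
  have "AE y in lborel. 0 \<le> indicator S y * f y" using nn by (auto simp: indicator_def)
  then have "AE y in lborel. indicator S y * f y = 0"
    using integral_nonneg_eq_0_iff_AE[OF int] zero by blast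
  then have "AE y in lebesgue. indicator S y * f y = 0" by (rule AE_completion)
  then have "AE y in lebesgue. y \<notin> ?N"
    by (rule AE_mp) (use U in \<open>auto simp: indicator_def\<close>)
  moreover have op: "open ?N"
  proof -
    have "?N = U \<inter> f -` (- {0})" by auto
    then show ?thesis using continuous_open_preimage[OF U(3,1), of "- {0}"] by auto
  qed
  ultimately have "negligible ?N"
    unfolding negligible_iff_null_sets
    by (subst AE_iff_null_sets) auto
  then have "?N = {}" using open_not_negligible[OF op] by blast
  then show False using U \<open>f y \<noteq> 0\<close> by blast
qed

lemma lborel_integral_translate:
  fixes f :: "real^3 \<Rightarrow> real"
  assumes "f \<in> borel_measurable borel"
  shows "integral\<^sup>L lborel (\<lambda>y. f (y + c)) = integral\<^sup>L lborel f"
proof -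
  have "lborel = distr lborel borel (\<lambda>y. c + 1 *\<^sub>R (y :: real^3))"
    using lborel_affine[of 1 c] by (simp add: density_1 one_ennreal_def[symmetric])
  then have "lborel = distr lborel borel (\<lambda>y. c + (y :: real^3))" by simp
  then have "integral\<^sup>L lborel f = integral\<^sup>L (distr lborel borel (\<lambda>y. c + y)) f" by simp
  also have "\<dots> = integral\<^sup>L lborel (\<lambda>y. f (c + y))"
    by (rule integral_distr) (use assms in measurable)
  finally show ?thesis by (simp add: add.commute)
qed

text \<open>
  Boundedness is included so that the class is closed under products.
\<close>

definition bdlip :: "(real^3) set \<Rightarrow> (real^3 \<Rightarrow> real) \<Rightarrow> bool"
  where "bdlip B f \<longleftrightarrow> (\<exists>C\<ge>0. \<forall>y\<in>B. \<forall>z\<in>B. \<bar>f y\<bar> \<le> C \<and> \<bar>f y - f z\<bar> \<le> C * norm (y - z))"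

lemma bdlip_add: assumes "bdlip B f" "bdlip B g" shows "bdlip B (\<lambda>y. f y + g y)"
proof -
  obtain C D where C: "0 \<le> C" "0 \<le> D" "\<And>y z. y \<in> B \<Longrightarrow> z \<in> B \<Longrightarrow> \<bar>f y\<bar> \<le> C \<and> \<bar>f y - f z\<bar> \<le> C * norm (y - z)"
    "\<And>y z. y \<in> B \<Longrightarrow> z \<in> B \<Longrightarrow> \<bar>g y\<bar> \<le> D \<and> \<bar>g y - g z\<bar> \<le> D * norm (y - z)"
    using assms unfolding bdlip_def by metis
  have "\<bar>f y + g y\<bar> \<le> C + D \<and> \<bar>f y + g y - (f z + g z)\<bar> \<le> (C + D) * norm (y - z)" if "y \<in> B" "z \<in> B" for y z
    using C(3)[OF that] C(4)[OF that] by (auto simp: distrib_right)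
  then show ?thesis unfolding bdlip_def using C by (intro exI[of _ "C + D"]) auto
qed

lemma bdlip_mult: assumes "bdlip B f" "bdlip B g" shows "bdlip B (\<lambda>y. f y * g y)"
proof -
  obtain C D where C: "0 \<le> C" "0 \<le> D" "\<And>y z. y \<in> B \<Longrightarrow> z \<in> B \<Longrightarrow> \<bar>f y\<bar> \<le> C \<and> \<bar>f y - f z\<bar> \<le> C * norm (y - z)"
    "\<And>y z. y \<in> B \<Longrightarrow> z \<in> B \<Longrightarrow> \<bar>g y\<bar> \<le> D \<and> \<bar>g y - g z\<bar> \<le> D * norm (y - z)"
    using assms unfolding bdlip_def by metis
  have "\<bar>f y * g y\<bar> \<le> 2 * (C * D) \<and> \<bar>f y * g y - f z * g z\<bar> \<le> 2 * (C * D) * norm (y - z)" if yz: "y \<in> B" "z \<in> B" for y z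
  proof -
    have "\<bar>f y * g y\<bar> \<le> C * D" unfolding abs_mult using C(3)[OF yz] C(4)[OF yz] C(1) by (intro mult_mono) auto
    moreover have "\<bar>f y * (g y - g z)\<bar> \<le> C * (D * norm (y - z))"
      unfolding abs_mult using C(3)[OF yz] C(4)[OF yz] C(1) by (intro mult_mono) auto
    moreover have "\<bar>(f y - f z) * g z\<bar> \<le> (C * norm (y - z)) * D"
      unfolding abs_mult using C(3)[OF yz] C(4)[OF yz(2,1)] C(1) by (intro mult_mono) auto
    moreover have "f y * g y - f z * g z = f y * (g y - g z) + (f y - f z) * g z" by (simp add: algebra_simps)
    moreover have "0 \<le> C * D" using C by simp
    ultimately show ?thesis by (simp add: algebra_simps)
  qed
  then show ?thesis unfolding bdlip_def using C by (intro exI[of _ "2 * (C * D)"]) auto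
qed

lemma bdlip_const: "bdlip B (\<lambda>y. c)"
  unfolding bdlip_def by (intro exI[of _ "\<bar>c\<bar>"]) auto

lemma bdlip_plt: assumes "plt n p" shows "bdlip (cball 0 R) p"
  using assms
proof (induction rule: plt.induct)
  case (plt_coord n p k)
  have "bdlip (cball 0 R) (\<lambda>y. y $ k)" unfolding bdlip_def
  proof (intro exI[of _ "max 1 \<bar>R\<bar>"] conjI ballI)
    fix y z :: "real^3" assume "y \<in> cball 0 R" "z \<in> cball 0 R"
    then have "norm y \<le> R" by simp
    then show "\<bar>y $ k\<bar> \<le> max 1 \<bar>R\<bar>" using component_le_norm_cart[of y k] by linarith
    have "\<bar>y $ k - z $ k\<bar> \<le> 1 * norm (y - z)" using component_le_norm_cart[of "y - z" k] by simp
    also have "\<dots> \<le> max 1 \<bar>R\<bar> * norm (y - z)" by (intro mult_right_mono) auto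
    finally show "\<bar>y $ k - z $ k\<bar> \<le> max 1 \<bar>R\<bar> * norm (y - z)" .
  qed simp
  then show ?case using bdlip_mult plt_coord by blast
qed (auto intro: bdlip_const bdlip_add)

lemma bdlip_abs: assumes "bdlip B f" shows "bdlip B (\<lambda>y. \<bar>f y\<bar>)"
proof -
  obtain C where C: "0 \<le> C" "\<And>y z. y \<in> B \<Longrightarrow> z \<in> B \<Longrightarrow> \<bar>f y\<bar> \<le> C \<and> \<bar>f y - f z\<bar> \<le> C * norm (y - z)"
    using assms unfolding bdlip_def by blast
  have "\<bar>\<bar>f y\<bar>\<bar> \<le> C \<and> \<bar>\<bar>f y\<bar> - \<bar>f z\<bar>\<bar> \<le> C * norm (y - z)" if "y \<in> B" "z \<in> B" for y z
    using C(2)[OF that] abs_triangle_ineq3[of "f y" "f z"] by linarith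
  then show ?thesis unfolding bdlip_def using C by blast
qed

lemma bdlip_diff: "bdlip B f \<Longrightarrow> bdlip B g \<Longrightarrow> bdlip B (\<lambda>y. f y - g y)"
  using bdlip_add[of B f "\<lambda>y. (-1) * g y"] bdlip_mult[OF bdlip_const, of B g "-1"] by simp

lemma bdlip_max: assumes "bdlip B f" "bdlip B g" shows "bdlip B (\<lambda>y. max (f y) (g y))"
proof -
  have "(\<lambda>y. max (f y) (g y)) = (\<lambda>y. (1/2) * ((f y + g y) + \<bar>f y - g y\<bar>))" by (auto simp: max_def)
  moreover have "bdlip B (\<lambda>y. (1/2) * ((f y + g y) + \<bar>f y - g y\<bar>))"
    by (rule bdlip_mult[OF bdlip_const bdlip_add[OF bdlip_add[OF assms] bdlip_abs[OF bdlip_diff[OF assms]]]])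
  ultimately show ?thesis by simp
qed

lemma bdlip_min: assumes "bdlip B f" "bdlip B g" shows "bdlip B (\<lambda>y. min (f y) (g y))"
proof -
  have "(\<lambda>y. min (f y) (g y)) = (\<lambda>y. (1/2) * ((f y + g y) - \<bar>f y - g y\<bar>))" by (auto simp: min_def)
  moreover have "bdlip B (\<lambda>y. (1/2) * ((f y + g y) - \<bar>f y - g y\<bar>))"
    by (rule bdlip_mult[OF bdlip_const bdlip_diff[OF bdlip_add[OF assms] bdlip_abs[OF bdlip_diff[OF assms]]]])
  ultimately show ?thesis by simp
qed

lemma difference_quotient:
  fixes w :: "real^3 \<Rightarrow> real"
  assumes "w differentiable at y"
  shows "(\<lambda>m. (w (y + inverse (real (Suc m)) *\<^sub>R axis k 1) - w y) / inverse (real (Suc m))) \<longlonglongrightarrow> pd k w y"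
proof -
  have "(w has_derivative frechet_derivative w (at y)) (at y)"
    using assms frechet_derivative_works by blast
  then have "((\<lambda>t. w (y + t *\<^sub>R axis k 1)) has_derivative (\<lambda>t. frechet_derivative w (at y) (t *\<^sub>R axis k 1))) (at 0)"
    by (intro has_derivative_compose[where g = w and f = "\<lambda>t. y + t *\<^sub>R axis k 1"]) (auto intro!: derivative_eq_intros)
  moreover have "frechet_derivative w (at y) (t *\<^sub>R axis k 1) = pd k w y * t" for t
    using linear_scale[OF linear_frechet_derivative[OF assms]] by (simp add: pd_def mult.commute)
  ultimately have "((\<lambda>t. w (y + t *\<^sub>R axis k 1)) has_field_derivative pd k w y) (at 0)"
    unfolding has_field_derivative_def by simp
  then have "((\<lambda>t. (w (y + t *\<^sub>R axis k 1) - w y) / t) \<longlongrightarrow> pd k w y) (at 0)"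
    unfolding DERIV_def by simp
  moreover have "filterlim (\<lambda>m. inverse (real (Suc m))) (at 0) sequentially"
    unfolding filterlim_at using LIMSEQ_inverse_real_of_nat by (auto simp: eventually_sequentially)
  ultimately show ?thesis by (rule filterlim_compose)
qed

text \<open>
  The difference quotients in direction \<open>k\<close> have integral zero by translation invariance. They converge
  almost everywhere to the partial derivative, and the Lipschitz constant on a large ball bounds them by
  an integrable function.
\<close>

lemma integral_partial_derivative_zero:
  fixes w g :: "real^3 \<Rightarrow> real"
  assumes lip: "\<And>R. bdlip (cball 0 R) w" and supp: "\<And>y. R < norm y \<Longrightarrow> w y = 0" and R: "0 \<le> R"
    and cont: "continuous_on UNIV w"
    and g: "g \<in> borel_measurable borel"
    and ae: "AE y in lborel. w differentiable at y \<and> g y = pd k w y"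
  shows "integral\<^sup>L lborel g = 0"
proof -
  obtain C where C: "0 \<le> C" "\<And>y z. y \<in> cball 0 (R + 2) \<Longrightarrow> z \<in> cball 0 (R + 2) \<Longrightarrow> \<bar>w y - w z\<bar> \<le> C * norm (y - z)"
    using lip[of "R + 2"] unfolding bdlip_def by blast
  define t where "t m = inverse (real (Suc m))" for m
  have t: "0 < t m" "t m \<le> 1" for m by (auto simp: t_def field_simps)
  define s where "s m y = (w (y + t m *\<^sub>R axis k 1) - w y) / t m" for m y
  have wm: "w \<in> borel_measurable borel" using cont by (rule borel_measurable_continuous_onI)
  have wi: "integrable lborel w"
  proof -
    have "integrable lborel (\<lambda>y. indicator (cball 0 R) y *\<^sub>R w y)"
      using cont continuous_on_subset by (intro borel_integrable_compact) auto
    moreover have "(\<lambda>y. indicator (cball 0 R) y *\<^sub>R w y) = w"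
      using supp by (auto simp: indicator_def fun_eq_iff not_le)
    ultimately show ?thesis by simp
  qed
  have wti: "integrable lborel (\<lambda>y. w (y + c))" for c
  proof -
    have "integrable lborel (\<lambda>y. indicator (cball 0 (R + norm c)) y *\<^sub>R w (y + c))"
      by (intro borel_integrable_compact compact_cball continuous_on_compose2[OF cont] continuous_intros) auto
    moreover have "w (y + c) = 0" if "\<not> norm y \<le> R + norm c" for y
    proof (rule supp)
      have "norm y \<le> norm (y + c) + norm c" using norm_triangle_ineq[of "y + c" "- c"] by simp
      then show "R < norm (y + c)" using that by linarith
    qed
    then have "(\<lambda>y. indicator (cball 0 (R + norm c)) y *\<^sub>R w (y + c)) = (\<lambda>y. w (y + c))"
      by (auto simp: indicator_def fun_eq_iff)
    ultimately show ?thesis by simp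
  qed
  have s0: "integral\<^sup>L lborel (s m) = 0" for m
    unfolding s_def using wi wti by (simp add: lborel_integral_translate[OF wm])
  have "(\<lambda>m. integral\<^sup>L lborel (s m)) \<longlonglongrightarrow> integral\<^sup>L lborel g"
  proof (rule integral_dominated_convergence[where w = "\<lambda>y. indicator (cball 0 (R + 1)) y *\<^sub>R C"])
    show "g \<in> borel_measurable lborel" using g by simp
    show "s m \<in> borel_measurable lborel" for m
    proof -
      have "continuous_on UNIV (s m)" unfolding s_def
        by (intro continuous_intros continuous_on_compose2[OF cont] continuous_on_subset[OF cont]) (use t[of m] in auto)
      then show ?thesis using borel_measurable_continuous_onI by simp
    qed
    show "integrable lborel (\<lambda>y. indicator (cball 0 (R + 1)) y *\<^sub>R C)"
      by (intro borel_integrable_compact) auto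
    show "AE y in lborel. (\<lambda>m. s m y) \<longlonglongrightarrow> g y"
    proof (rule AE_mp[OF ae AE_I2], intro impI)
      fix y assume "w differentiable at y \<and> g y = pd k w y"
      then show "(\<lambda>m. s m y) \<longlonglongrightarrow> g y" using difference_quotient[of w y k] by (simp add: s_def t_def)
    qed
    show "AE y in lborel. norm (s m y) \<le> indicator (cball 0 (R + 1)) y *\<^sub>R C" for m
    proof (rule AE_I2)
      fix y :: "real^3"
      have n: "norm (t m *\<^sub>R axis k 1 :: real^3) = t m" using t[of m] by (simp add: norm_axis_1)
      show "norm (s m y) \<le> indicator (cball 0 (R + 1)) y *\<^sub>R C"
      proof (cases "norm y \<le> R + 1")
        case True
        have "norm (y + t m *\<^sub>R axis k 1) \<le> norm y + t m" using norm_triangle_ineq[of y "t m *\<^sub>R axis k 1"] n by simp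
        then have "\<bar>w (y + t m *\<^sub>R axis k 1) - w y\<bar> \<le> C * norm (y + t m *\<^sub>R axis k 1 - y)"
          using True t[of m] by (intro C(2)) auto
        then have "\<bar>w (y + t m *\<^sub>R axis k 1) - w y\<bar> \<le> C * t m" using n by simp
        then show ?thesis using True t[of m] by (simp add: s_def field_simps)
      next
        case False
        have "norm y \<le> norm (y + t m *\<^sub>R axis k 1) + t m"
          using norm_triangle_ineq[of "y + t m *\<^sub>R axis k 1" "- (t m *\<^sub>R axis k 1)"] n by simp
        then have "R < norm (y + t m *\<^sub>R axis k 1)" using False t[of m] by linarith
        then show ?thesis using supp False by (simp add: s_def)
      qed
    qed
  qed
  then show ?thesis unfolding s0 using LIMSEQ_unique[OF tendsto_const] by metis
qed

context tetrahedron
begin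

section \<open>Newton form of the bubbles\<close>

text \<open>
  Divided differences with respect to the nodes \<open>lam 0, \<dots>, lam 3\<close>: gluing is exactly what makes
  \<open>f i - f k\<close> divisible by \<open>lam i - lam k\<close>, and the quotients are glued again.
\<close>

lemma newton_step:
  assumes k: "k \<le> 3" and f': "\<forall>i\<le>3. k \<le> i \<longrightarrow> plt m (f i)"
    and fg': "\<forall>i\<le>3. \<forall>j\<le>3. \<forall>y. k \<le> i \<longrightarrow> k \<le> j \<longrightarrow> lam i y = lam j y \<longrightarrow> f i y = f j y"
  shows "\<exists>q. (\<forall>i\<le>3. k < i \<longrightarrow> plt (m - 1) (q i)) \<and>
    (\<forall>i\<le>3. \<forall>y. k < i \<longrightarrow> f i y = f k y + (lam i y - lam k y) * q i y) \<and>
    (\<forall>i\<le>3. \<forall>j\<le>3. \<forall>y. k < i \<longrightarrow> k < j \<longrightarrow> lam i y = lam j y \<longrightarrow> q i y = q j y)"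
proof -
  have f: "plt m (f i)" if "i \<le> 3" "k \<le> i" for i using f' that by blast
  have fg: "f i y = f j y" if "i \<le> 3" "j \<le> 3" "k \<le> i" "k \<le> j" "lam i y = lam j y" for i j y
    using fg' that by blast
  have "\<exists>q. plt (m - 1) q \<and> (\<forall>y. f i y = f k y + (lam i y - lam k y) * q y)" if i: "i \<le> 3" "k < i" for i
  proof -
    have d: "plt m (\<lambda>y. f i y - f k y)" using f(1) i k by (intro plt_diff) auto
    have ne: "i \<noteq> k" using i by simp
    have z: "f i y - f k y = 0" if "lam i y = lam k y" for y
      using fg[OF i(1) k _ _ that] i by simp
    obtain c where "plt (m - 1) c" "\<And>y. f i y - f k y = (lam i y - lam k y) * c y"
      using diagonal_divide[OF d i(1) k ne z] by blast
    then show ?thesis by (intro exI[of _ c]) (auto simp: diff_eq_eq)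
  qed
  then obtain q where q: "\<And>i. i \<le> 3 \<Longrightarrow> k < i \<Longrightarrow> plt (m - 1) (q i)"
    "\<And>i y. i \<le> 3 \<Longrightarrow> k < i \<Longrightarrow> f i y = f k y + (lam i y - lam k y) * q i y" by metis
  have "q i y = q j y" if ij: "i \<le> 3" "j \<le> 3" "k < i" "k < j" and y: "lam i y = lam j y" for i j y
  proof (cases "i = j")
    case False
    have "(\<lambda>y. q i y - q j y) y = 0"
    proof (rule diagonal_cancel[where l = "\<lambda>y. lam i y - lam k y" and q = "x k" and a = i and b = j])
      show "plt (m - 1) (\<lambda>y. q i y - q j y)" using q ij by (intro plt_diff) auto
      show "affn (\<lambda>y. lam i y - lam k y)" by (intro affn_diff affn_lam)
      show "lam i (x k) = lam j (x k)" "lam i (x k) - lam k (x k) \<noteq> 0" using ij k by (simp_all add: lam_vertex)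
      fix y assume e: "lam i y = lam j y"
      have "f i y = f j y" using fg[OF ij(1,2) _ _ e] ij by simp
      then show "(lam i y - lam k y) * (q i y - q j y) = 0"
        using q(2)[OF ij(1,3), of y] q(2)[OF ij(2,4), of y] e by (simp add: right_diff_distrib)
    qed (rule y)
    then show ?thesis by simp
  qed simp
  with q show ?thesis by (intro exI[of _ q] conjI allI impI)
qed

text \<open>
  Newton interpolation: the four polynomials of a glued family are the values at \<open>lam i\<close> of a cubic
  with polynomial coefficients. Thus one formula in \<open>lam i\<close> describes the function on all cells.
\<close>

lemma newton_form:
  assumes p: "\<And>i. i \<le> 3 \<Longrightarrow> plt n (p i)" and gl: "glued lam p"
  obtains b0 b1 b2 b3 where "plt n b0" "plt (n - 1) b1" "plt (n - 2) b2" "plt (n - 3) b3"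
    "\<And>i y. i \<le> 3 \<Longrightarrow> p i y = b0 y + (lam i y - lam 0 y) * (b1 y + (lam i y - lam 1 y) *
       (b2 y + (lam i y - lam 2 y) * b3 y))"
proof -
  have L: "(0::nat) \<le> 3" "(1::nat) \<le> 3" "(2::nat) \<le> 3" by simp_all
  have p': "\<forall>i\<le>3. 0 \<le> i \<longrightarrow> plt n (p i)" using p by blast
  have g': "\<forall>i\<le>3. \<forall>j\<le>3. \<forall>y. 0 \<le> i \<longrightarrow> 0 \<le> j \<longrightarrow> lam i y = lam j y \<longrightarrow> p i y = p j y"
    using gl unfolding glued_def by blast
  obtain q where q: "\<forall>i\<le>3. 0 < i \<longrightarrow> plt (n - 1) (q i)"
    "\<forall>i\<le>3. \<forall>y. 0 < i \<longrightarrow> p i y = p 0 y + (lam i y - lam 0 y) * q i y"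
    "\<forall>i\<le>3. \<forall>j\<le>3. \<forall>y. 0 < i \<longrightarrow> 0 < j \<longrightarrow> lam i y = lam j y \<longrightarrow> q i y = q j y"
    using newton_step[OF L(1) p' g'] by (elim exE conjE) (rule that)
  have c: "0 < i \<longleftrightarrow> 1 \<le> i" "1 < i \<longleftrightarrow> 2 \<le> i" "2 < i \<longleftrightarrow> 3 \<le> i" for i :: nat by auto
  obtain r where r: "\<forall>i\<le>3. 1 < i \<longrightarrow> plt (n - 1 - 1) (r i)"
    "\<forall>i\<le>3. \<forall>y. 1 < i \<longrightarrow> q i y = q 1 y + (lam i y - lam 1 y) * r i y"
    "\<forall>i\<le>3. \<forall>j\<le>3. \<forall>y. 1 < i \<longrightarrow> 1 < j \<longrightarrow> lam i y = lam j y \<longrightarrow> r i y = r j y"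
    using newton_step[OF L(2) q(1,3)[unfolded c(1)]] by (elim exE conjE) (rule that)
  obtain s where s: "\<forall>i\<le>3. 2 < i \<longrightarrow> plt (n - 1 - 1 - 1) (s i)"
    "\<forall>i\<le>3. \<forall>y. 2 < i \<longrightarrow> r i y = r 2 y + (lam i y - lam 2 y) * s i y"
    using newton_step[OF L(3) r(1,3)[unfolded c(2)]] by (elim exE conjE) (rule that)
  have n: "n - 1 - 1 = n - 2" "n - 2 - 1 = n - 3" by simp_all
  show ?thesis
  proof (rule that[of "p 0" "q 1" "r 2" "s 3"])
    show "plt n (p 0)" "plt (n - 1) (q 1)" "plt (n - 2) (r 2)" "plt (n - 3) (s 3)"
      using p[of 0] q(1) r(1) s(1) unfolding n by auto
    fix i y assume i: "i \<le> (3::nat)"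
    have e: "0 < i \<Longrightarrow> p i y = p 0 y + (lam i y - lam 0 y) * q i y"
      "1 < i \<Longrightarrow> q i y = q 1 y + (lam i y - lam 1 y) * r i y"
      "2 < i \<Longrightarrow> r i y = r 2 y + (lam i y - lam 2 y) * s i y"
      using q(2) r(2) s(2) i by blast+
    show "p i y = p 0 y + (lam i y - lam 0 y) * (q 1 y + (lam i y - lam 1 y) * (r 2 y + (lam i y - lam 2 y) * s 3 y))"
      using le3_cases[OF i] e by (elim disjE) simp_all
  qed
qed

text \<open>
  The hat function of the barycenter, scaled to the value \<open>1 / 4\<close> there and extended by zero; on cell
  \<open>i\<close> it is \<open>lam i\<close>.
\<close>

definition mu :: "real^3 \<Rightarrow> real"
  where "mu y = max 0 (min (min (lam 0 y) (lam 1 y)) (min (lam 2 y) (lam 3 y)))"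

lemma mu_alfeld: "i \<le> 3 \<Longrightarrow> y \<in> alfeld x i \<Longrightarrow> mu y = lam i y"
proof -
  assume "i \<le> 3" "y \<in> alfeld x i"
  then have "0 \<le> lam i y" "lam i y \<le> lam 0 y" "lam i y \<le> lam 1 y" "lam i y \<le> lam 2 y" "lam i y \<le> lam 3 y"
    using alfeld_iff by auto
  moreover have "i = 0 \<or> i = 1 \<or> i = 2 \<or> i = 3" using \<open>i \<le> 3\<close> by (rule le3_cases)
  ultimately show ?thesis unfolding mu_def by (elim disjE) (simp_all add: min_def max_def)
qed

lemma mu_off: "y \<notin> tetra x \<Longrightarrow> mu y = 0"
proof -
  assume "y \<notin> tetra x"
  then have "lam 0 y < 0 \<or> lam 1 y < 0 \<or> lam 2 y < 0 \<or> lam 3 y < 0"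
    unfolding tetra_iff all_le3 by auto
  then show ?thesis unfolding mu_def by (auto simp: min_def max_def)
qed

lemma continuous_mu: "continuous_on S mu"
  unfolding mu_def by (intro continuous_intros continuous_affn affn_lam)

lemma bdlip_mu: "bdlip (cball 0 R) mu"
  unfolding mu_def by (intro bdlip_max bdlip_min bdlip_const bdlip_plt[OF plt_lam])

definition newton :: "(real^3 \<Rightarrow> real) \<times> (real^3 \<Rightarrow> real) \<times> (real^3 \<Rightarrow> real) \<times> (real^3 \<Rightarrow> real) \<Rightarrow> real^3 \<Rightarrow> real"
  where "newton = (\<lambda>(b0, b1, b2, b3) y. mu y * (b0 y + (mu y - lam 0 y) * (b1 y + (mu y - lam 1 y) *
       (b2 y + (mu y - lam 2 y) * b3 y))))"

text \<open>
  Bubbles are freely parametrised by four polynomials. This gives their dimension, and shows that they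
  are Lipschitz functions on the whole space.
\<close>

lemma bubbles_newton:
  "bubbles n = newton ` ({b. plt n b} \<times> {b. plt (n - 1) b} \<times> {b. plt (n - 2) b} \<times> {b. plt (n - 3) b})"
proof (intro equalityI subsetI)
  fix w assume w: "w \<in> bubbles n"
  obtain p where p: "\<And>i. i \<le> 3 \<Longrightarrow> plt n (p i)" "glued lam p"
    "\<And>i y. i \<le> 3 \<Longrightarrow> y \<in> alfeld x i \<Longrightarrow> w y = lam i y * p i y" by (rule bubbles_pieces[OF w]) (rule that)
  obtain b0 b1 b2 b3 where b: "plt n b0" "plt (n - 1) b1" "plt (n - 2) b2" "plt (n - 3) b3"
    and pb: "\<And>i y. i \<le> 3 \<Longrightarrow> p i y = b0 y + (lam i y - lam 0 y) * (b1 y + (lam i y - lam 1 y) *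
       (b2 y + (lam i y - lam 2 y) * b3 y))" by (rule newton_form[OF p(1,2)]) (assumption, rule that)
  have "w y = newton (b0, b1, b2, b3) y" for y
  proof (cases "y \<in> tetra x")
    case True
    then obtain i where i: "i \<le> 3" "y \<in> alfeld x i" by (rule alfeld_cover)
    then show ?thesis using p(3)[OF i] pb[OF i(1)] mu_alfeld[OF i] by (simp add: newton_def)
  next
    case False
    then have "w y = 0" using w M0_off unfolding bubbles_def by blast
    then show ?thesis using mu_off[OF False] by (simp add: newton_def)
  qed
  then have "w = newton (b0, b1, b2, b3)" by blast
  then show "w \<in> newton ` ({b. plt n b} \<times> {b. plt (n - 1) b} \<times> {b. plt (n - 2) b} \<times> {b. plt (n - 3) b})"
    using b by blast
next
  fix w assume "w \<in> newton ` ({b. plt n b} \<times> {b. plt (n - 1) b} \<times> {b. plt (n - 2) b} \<times> {b. plt (n - 3) b})"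
  then obtain b0 b1 b2 b3 where b: "plt n b0" "plt (n - 1) b1" "plt (n - 2) b2" "plt (n - 3) b3"
    and w: "w = newton (b0, b1, b2, b3)" by auto
  have a: "affn (\<lambda>y. lam i y - lam j y)" for i j by (intro affn_diff affn_lam)
  have m: "plt n (\<lambda>y. (lam i y - lam j y) * q y)" if "plt (n - 1) q" for i j n q
    using affn_plt_mult'[OF a that] .
  have b': "plt (n - 1 - 1) b2" "plt (n - 1 - 1 - 1) b3" 
    using b(3,4) by (simp_all add: diff_diff_left)
  show "w \<in> bubbles n"
  proof (rule bubbles_I[of n "\<lambda>i y. b0 y + (lam i y - lam 0 y) * (b1 y + (lam i y - lam 1 y) *
       (b2 y + (lam i y - lam 2 y) * b3 y))"])
    show "plt n (\<lambda>y. b0 y + (lam i y - lam 0 y) * (b1 y + (lam i y - lam 1 y) * (b2 y + (lam i y - lam 2 y) * b3 y)))" for i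
      by (rule plt_add[OF b(1) m[OF plt_add[OF b(2) m[OF plt_add[OF b'(1) m[OF b'(2)]]]]]])
    show "w y = 0" if "y \<notin> tetra x" for y using mu_off[OF that] by (simp add: w newton_def)
    show "w y = lam i y * (b0 y + (lam i y - lam 0 y) * (b1 y + (lam i y - lam 1 y) * (b2 y + (lam i y - lam 2 y) * b3 y)))"
      if "i \<le> 3" "y \<in> alfeld x i" for i y using mu_alfeld[OF that] by (simp add: w newton_def)
  qed
qed

lemma bubbles_bdlip_continuous:
  assumes "w \<in> bubbles n" shows "bdlip (cball 0 R) w" "continuous_on S w"
proof -
  obtain b0 b1 b2 b3 where b: "plt n b0" "plt (n - 1) b1" "plt (n - 2) b2" "plt (n - 3) b3"
    and w: "w = newton (b0, b1, b2, b3)" using assms unfolding bubbles_newton by auto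
  show "bdlip (cball 0 R) w" unfolding w newton_def prod.case
    by (intro bdlip_mult bdlip_add bdlip_diff bdlip_mu bdlip_plt[OF plt_lam] bdlip_plt[OF b(1)]
        bdlip_plt[OF b(2)] bdlip_plt[OF b(3)] bdlip_plt[OF b(4)])
  show "continuous_on S w" unfolding w newton_def prod.case
    by (intro continuous_intros continuous_mu continuous_affn affn_lam plt_continuous[OF b(1)]
        plt_continuous[OF b(2)] plt_continuous[OF b(3)] plt_continuous[OF b(4)])
qed

section \<open>Discontinuous piecewise polynomials\<close>

text \<open>
  Discontinuous piecewise polynomials, in the normalisation of representatives vanishing off the open
  cells.
\<close>

definition cellwise :: "nat \<Rightarrow> (nat \<Rightarrow> real^3 \<Rightarrow> real) \<Rightarrow> (real^3 \<Rightarrow> real) \<Rightarrow> bool"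
  where "cellwise n P f \<longleftrightarrow> (\<forall>i\<le>3. plt n (P i)) \<and> (\<forall>i\<le>3. \<forall>y\<in>interior (alfeld x i). f y = P i y) \<and>
    (\<forall>y. y \<notin> open_cells x \<longrightarrow> f y = 0)"

lemma cellwise_sum:
  assumes "cellwise n P f"
  shows "f y = (\<Sum>i\<le>3. indicator (interior (alfeld x i)) y * P i y)"
proof (cases "y \<in> open_cells x")
  case True
  then obtain i where i: "i \<le> 3" "y \<in> interior (alfeld x i)" using open_cells_iff by blast
  have z: "indicator (interior (alfeld x j)) y * P j y = 0" if "j \<in> {..3} - {i}" for j
    using interior_alfeld_disjoint[OF i(1) _ i(2)] that interior_subset by (auto simp: indicator_def)
  have "(\<Sum>j\<in>{..3} - {i}. indicator (interior (alfeld x j)) y * P j y) = 0"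
    by (intro sum.neutral ballI z)
  then have "(\<Sum>j\<le>3. indicator (interior (alfeld x j)) y * P j y) = indicator (interior (alfeld x i)) y * P i y"
    using sum.remove[OF finite_atMost, of i 3 "\<lambda>j. indicator (interior (alfeld x j)) y * P j y"] i(1) by simp
  then show ?thesis using assms i unfolding cellwise_def by simp
next
  case False
  then have "indicator (interior (alfeld x j)) y = (0::real)" if "j \<in> {..3}" for j
    using open_cells_iff that by (auto simp: indicator_def)
  then show ?thesis using assms False unfolding cellwise_def by simp
qed

lemma cellwise_integrable: assumes "cellwise n P f" shows "integrable lborel f"
proof -
  have "integrable lborel (\<lambda>y. indicator (interior (alfeld x i)) y * P i y)" if i: "i \<le> 3" for i
  proof -
    have "continuous_on (tetra x) (P i)" using assms i plt_continuous unfolding cellwise_def by blast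
    then have "integrable lborel (\<lambda>y. indicator (tetra x) y *\<^sub>R P i y)"
      by (intro borel_integrable_compact compact_tetra)
    then have "integrable lborel (\<lambda>y. indicator (interior (alfeld x i)) y *\<^sub>R (indicator (tetra x) y *\<^sub>R P i y))"
      by (rule integrable_mult_indicator[rotated]) simp
    moreover have "(\<lambda>y. indicator (interior (alfeld x i)) y *\<^sub>R (indicator (tetra x) y *\<^sub>R P i y))
        = (\<lambda>y. indicator (interior (alfeld x i)) y * P i y)"
      using alfeld_subset[OF i] interior_subset by (auto simp: indicator_def fun_eq_iff)
    ultimately show ?thesis by (simp only:)
  qed
  then have "integrable lborel (\<lambda>y. \<Sum>i\<le>3. indicator (interior (alfeld x i)) y * P i y)" by (intro Bochner_Integration.integrable_sum) auto
  moreover have "(\<lambda>y. \<Sum>i\<le>3. indicator (interior (alfeld x i)) y * P i y) = f"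
    using cellwise_sum[OF assms] by auto
  ultimately show ?thesis by simp
qed

lemma open_cells_subset: "open_cells x \<subseteq> tetra x"
  using open_cells_iff alfeld_subset interior_subset by blast

lemma cellwise_LINT:
  assumes "cellwise n P f" shows "(LINT y:tetra x|lebesgue. f y) = integral\<^sup>L lborel f"
proof -
  have "(\<lambda>y. indicator (tetra x) y *\<^sub>R f y) = f"
    using assms open_cells_subset unfolding cellwise_def by (auto simp: indicator_def fun_eq_iff)
  then have "(LINT y:tetra x|lebesgue. f y) = integral\<^sup>L lebesgue f" unfolding set_lebesgue_integral_def by simp
  also have "\<dots> = integral\<^sup>L lborel f"
    using cellwise_integrable[OF assms] by (intro integral_completion) (simp add: borel_measurable_integrable)
  finally show ?thesis .
qed

lemma cellwise_mult:
  assumes "cellwise m P f" "cellwise n Q g" shows "cellwise (m + n) (\<lambda>i y. P i y * Q i y) (\<lambda>y. f y * g y)"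
  using assms unfolding cellwise_def by (auto intro: plt_mult)

lemma cellwise_diff:
  assumes "cellwise n P f" "cellwise n Q g" shows "cellwise n (\<lambda>i y. P i y - Q i y) (\<lambda>y. f y - g y)"
  using assms unfolding cellwise_def by (auto intro: plt_diff)

lemma cellwise_zero_integral:
  assumes f: "cellwise n P f" and nn: "\<And>y. 0 \<le> f y" and z: "integral\<^sup>L lborel f = 0" shows "f y = 0"
proof (cases "y \<in> open_cells x")
  case True
  then obtain i where i: "i \<le> 3" "y \<in> interior (alfeld x i)" using open_cells_iff by blast
  show ?thesis
  proof (rule integral_zero_imp_zero[where S = UNIV and U = "interior (alfeld x i)"])
    have "continuous_on (interior (alfeld x i)) f \<longleftrightarrow> continuous_on (interior (alfeld x i)) (P i)"
      by (rule continuous_on_cong[OF refl]) (use f i in \<open>auto simp: cellwise_def\<close>)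
    then show "continuous_on (interior (alfeld x i)) f"
      using f i plt_continuous unfolding cellwise_def by blast
  qed (use cellwise_integrable[OF f] nn z i in auto)
qed (use f in \<open>auto simp: cellwise_def\<close>)

lemma cellwise_square_zero:
  assumes f: "cellwise n P f" and z: "integral\<^sup>L lborel (\<lambda>y. f y * f y) = 0" shows "f y = 0"
  using cellwise_zero_integral[OF cellwise_mult[OF f f] _ z, of y] by simp

section \<open>The mean of a divergence\<close>

lemma h_nonzero: assumes "i \<le> 3" shows "h i \<noteq> 0"
proof -
  obtain j where "j \<le> 3" "j \<noteq> i" using ex_other[OF assms assms assms] by blast
  then have "h i \<bullet> (x i - x j) = 1" using h_edge assms by simp
  then show ?thesis by auto
qed

lemma negligible_off_cells: "negligible (tetra x - open_cells x)"
proof -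
  have hyper: "negligible {y. lam i y = c}" if "i \<le> 3" for i c
  proof -
    have "{y. lam i y = c} = {y. h i \<bullet> y = c + h i \<bullet> x 0 - (if i = 0 then 1 else 0)}"
      by (auto simp: lam_def inner_diff_right)
    then show ?thesis by (simp only:) (rule negligible_hyperplane, simp add: h_nonzero[OF that])
  qed
  have hyper2: "negligible {y. lam i y = lam j y}" if "i \<le> 3" "j \<le> 3" "i \<noteq> j" for i j
  proof -
    have nz: "h i - h j \<noteq> 0"
    proof
      assume "h i - h j = 0"
      then have "(h i - h j) \<bullet> (x i - x j) = 0" by simp
      then show False using that by (simp add: inner_diff_left h_edge)
    qed
    have "{y. lam i y = lam j y} = {y. (h i - h j) \<bullet> y = (h i - h j) \<bullet> x 0 - (if i = 0 then 1 else 0) + (if j = 0 then 1 else 0)}"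
      by (auto simp: lam_def inner_diff_right inner_diff_left)
    then show ?thesis by (simp only:) (rule negligible_hyperplane, rule disjI1, rule nz)
  qed
  have "tetra x - open_cells x \<subseteq> (\<Union>i\<in>{..3}. {y. lam i y = 0} \<union> (\<Union>j\<in>{..3} - {i}. {y. lam i y = lam j y}))"
  proof
    fix y assume y: "y \<in> tetra x - open_cells x"
    then obtain i where i: "i \<le> 3" "y \<in> alfeld x i" using alfeld_cover by blast
    moreover have "y \<notin> interior (alfeld x i)" using y i open_cells_iff by blast
    ultimately have "lam i y = 0 \<or> (\<exists>j\<le>3. j \<noteq> i \<and> lam i y = lam j y)"
      using alfeld_iff[OF i(1), of y] interior_alfeld_iff[OF i(1), of y] by (metis less_eq_real_def)
    then show "y \<in> (\<Union>i\<in>{..3}. {y. lam i y = 0} \<union> (\<Union>j\<in>{..3} - {i}. {y. lam i y = lam j y}))"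
      using i(1) by auto
  qed
  moreover have "negligible \<dots>"
    by (intro negligible_Union finite_imageI finite_atMost finite_Diff; elim imageE; simp only:)
      (auto intro!: negligible_Un hyper negligible_Union hyper2)
  ultimately show ?thesis using negligible_subset by blast
qed

lemma tetra_bounded: obtains R where "0 \<le> R" "\<And>y. R < norm y \<Longrightarrow> y \<notin> tetra x"
proof -
  obtain R where "0 < R" "\<forall>y\<in>tetra x. norm y \<le> R"
    using compact_imp_bounded[OF compact_tetra] unfolding bounded_pos by blast
  then show ?thesis using that[of R] by force
qed

lemma partial_derivative_cellwise:
  assumes p: "\<And>i. i \<le> 3 \<Longrightarrow> plt (Suc n) (p i)" and w: "\<And>i y. i \<le> 3 \<Longrightarrow> y \<in> alfeld x i \<Longrightarrow> w y = p i y"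
  shows "cellwise n (\<lambda>i. pd k (p i)) (restr (open_cells x) (pd k w))"
  unfolding cellwise_def
proof (intro conjI allI impI ballI)
  fix i :: nat assume i: "i \<le> 3"
  show "plt n (pd k (p i))" using plt_pd[OF p[OF i]] by simp
  fix y assume y: "y \<in> interior (alfeld x i)"
  then have "pd k w y = pd k (p i) y"
    by (rule pd_local[OF p[OF i] i]) (use w[OF i] interior_subset in blast)
  moreover have "y \<in> open_cells x" using i y open_cells_iff by blast
  ultimately show "restr (open_cells x) (pd k w) y = pd k (p i) y" by (simp add: restr_def)
qed (simp add: restr_def)

text \<open>
  A bubble extended by zero is a Lipschitz function of compact support, differentiable off the planes
  bounding the cells.
\<close>

lemma bubbles_partial_mean_zero:
  assumes w: "w \<in> bubbles n"
  shows "integral\<^sup>L lborel (restr (open_cells x) (pd k w)) = 0"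
proof -
  let ?g = "restr (open_cells x) (pd k w)"
  have w0: "w y = 0" if "y \<notin> tetra x" for y using w M0_off that unfolding bubbles_def by blast
  have "w \<in> M0 n x" using w unfolding bubbles_def by blast
  then obtain p where p: "\<And>i. i \<le> 3 \<Longrightarrow> plt (Suc n) (p i)" "glued lam p"
    "\<And>i y. i \<le> 3 \<Longrightarrow> y \<in> alfeld x i \<Longrightarrow> w y = p i y" by (rule M0_pieces) (rule that)
  have g: "cellwise n (\<lambda>i. pd k (p i)) ?g" by (rule partial_derivative_cellwise[OF p(1,3)])
  obtain R where R: "0 \<le> R" "\<And>y. R < norm y \<Longrightarrow> y \<notin> tetra x" by (rule tetra_bounded) (rule that)
  show ?thesis
  proof (rule integral_partial_derivative_zero[where w = w and R = R and k = k])
    show "bdlip (cball 0 R) w" for R by (rule bubbles_bdlip_continuous(1)[OF w])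
    show "continuous_on UNIV w" by (rule bubbles_bdlip_continuous(2)[OF w])
    show "?g \<in> borel_measurable borel" using borel_measurable_integrable[OF cellwise_integrable[OF g]] by simp
    have "AE y in lebesgue. y \<notin> tetra x - open_cells x"
      using negligible_off_cells unfolding negligible_iff_null_sets by (rule AE_not_in)
    then have "AE y in lborel. y \<notin> tetra x - open_cells x" unfolding AE_completion_iff .
    then show "AE y in lborel. w differentiable at y \<and> ?g y = pd k w y"
    proof (rule AE_mp[OF _ AE_I2], intro impI)
      fix y assume y: "y \<notin> tetra x - open_cells x"
      show "w differentiable at y \<and> ?g y = pd k w y"
      proof (cases "y \<in> tetra x")
        case True
        then have oc: "y \<in> open_cells x" using y by blast
        then obtain i where i: "i \<le> 3" "y \<in> interior (alfeld x i)" unfolding open_cells_iff by blast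
        have "(p i has_derivative frechet_derivative (p i) (at y)) (at y)"
          using plt_differentiable[OF p(1)[OF i(1)]] frechet_derivative_works by blast
        then have "(w has_derivative frechet_derivative (p i) (at y)) (at y)"
        proof (rule has_derivative_transform_within_open[OF _ open_interior i(2)])
          fix u assume "u \<in> interior (alfeld x i)"
          then show "p i u = w u" using p(3)[OF i(1)] interior_subset by (metis subsetD)
        qed
        then have "w differentiable at y" by (auto simp: differentiable_def)
        then show ?thesis using oc by (simp add: restr_def)
      next
        case False
        have o: "open (- tetra x)" using compact_imp_closed[OF compact_tetra] by blast
        have z: "((\<lambda>u. 0) has_derivative (\<lambda>u. 0)) (at y)" by simp
        have "(w has_derivative (\<lambda>u. 0)) (at y)"
          by (rule has_derivative_transform_within_open[OF z o]) (use False w0 in auto)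
        then have "w differentiable at y" "pd k w y = 0" using pd_eqI by (auto simp: differentiable_def)
        moreover have "?g y = 0" using False open_cells_subset by (auto simp: restr_def)
        ultimately show ?thesis by simp
      qed
    qed
  qed (use w0 R in auto)
qed

lemma div3_sum: "div3 x w y = restr (open_cells x) (pd 1 (\<lambda>u. w u $ 1)) y +
    restr (open_cells x) (pd 2 (\<lambda>u. w u $ 2)) y + restr (open_cells x) (pd 3 (\<lambda>u. w u $ 3)) y"
  by (simp add: div3_def restr_def sum_3)

lemma vector_M0_pieces:
  assumes "w \<in> vec3 (M0 n x)"
  obtains p where "\<And>i. i \<le> 3 \<Longrightarrow> vplt (Suc n) (p i)" "\<And>i y. i \<le> 3 \<Longrightarrow> y \<in> alfeld x i \<Longrightarrow> w y = p i y"
proof -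
  have "\<forall>k. \<exists>p. (\<forall>i\<le>3. plt (Suc n) (p i)) \<and> (\<forall>i\<le>3. \<forall>y\<in>alfeld x i. w y $ k = p i y)"
  proof
    fix k
    have "(\<lambda>y. w y $ k) \<in> M0 n x" using assms unfolding vec3_def by blast
    then obtain p where "\<And>i. i \<le> 3 \<Longrightarrow> plt (Suc n) (p i)" "glued lam p"
      "\<And>i y. i \<le> 3 \<Longrightarrow> y \<in> alfeld x i \<Longrightarrow> w y $ k = p i y" by (rule M0_pieces) (rule that)
    then show "\<exists>p. (\<forall>i\<le>3. plt (Suc n) (p i)) \<and> (\<forall>i\<le>3. \<forall>y\<in>alfeld x i. w y $ k = p i y)" by blast
  qed
  from choice[OF this]
  obtain P where "\<forall>k. (\<forall>i\<le>3. plt (Suc n) (P k i)) \<and> (\<forall>i\<le>3. \<forall>y\<in>alfeld x i. w y $ k = P k i y)" ..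
  then have P: "\<And>k i. i \<le> 3 \<Longrightarrow> plt (Suc n) (P k i)"
    "\<And>k i y. i \<le> 3 \<Longrightarrow> y \<in> alfeld x i \<Longrightarrow> w y $ k = P k i y" by blast+
  show ?thesis
  proof (rule that[of "\<lambda>i y. \<chi> k. P k i y"])
    show "vplt (Suc n) (\<lambda>y. \<chi> k. P k i y)" if "i \<le> 3" for i using P(1)[OF that] by (simp add: vplt_def)
    show "w y = (\<chi> k. P k i y)" if "i \<le> 3" "y \<in> alfeld x i" for i y
      using P(2)[OF that] by (simp add: vec_eq_iff)
  qed
qed

lemma div3_cellwise:
  assumes p: "\<And>i. i \<le> 3 \<Longrightarrow> vplt (Suc n) (p i)" and w: "\<And>i y. i \<le> 3 \<Longrightarrow> y \<in> alfeld x i \<Longrightarrow> w y = p i y"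
  shows "cellwise n (\<lambda>i. vdiv (p i)) (div3 x w)"
  unfolding cellwise_def
proof (intro conjI allI impI ballI)
  fix i :: nat assume i: "i \<le> 3"
  show "plt n (vdiv (p i))" using vplt_vdiv[OF p[OF i]] by simp
  fix y assume y: "y \<in> interior (alfeld x i)"
  then show "div3 x w y = vdiv (p i) y"
    by (rule div3_local[OF p[OF i] i]) (use w[OF i] interior_subset in blast)
qed (simp add: div3_def restr_def)

lemma div3_mean_zero:
  assumes w: "w \<in> vec3 (bubbles n)" shows "integral\<^sup>L lborel (div3 x w) = 0"
proof -
  have wk: "(\<lambda>y. w y $ k) \<in> bubbles n" for k using w unfolding vec3_def by blast
  have int: "integrable lborel (restr (open_cells x) (pd k (\<lambda>u. w u $ k)))" for k
  proof -
    have "(\<lambda>y. w y $ k) \<in> M0 n x" using wk[of k] unfolding bubbles_def by blast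
    then obtain p where p: "\<And>i. i \<le> 3 \<Longrightarrow> plt (Suc n) (p i)" "glued lam p"
      "\<And>i y. i \<le> 3 \<Longrightarrow> y \<in> alfeld x i \<Longrightarrow> w y $ k = p i y" by (rule M0_pieces) (rule that)
    show ?thesis by (rule cellwise_integrable[OF partial_derivative_cellwise[OF p(1,3)]])
  qed
  show ?thesis unfolding div3_sum[abs_def]
    using int bubbles_partial_mean_zero[OF wk] by simp
qed

text \<open>
  Cellwise polynomials are bounded with bounded support, so they are square integrable.
\<close>

lemma V3d_iff: "v \<in> V3d_bubble m x \<longleftrightarrow> (\<exists>P. cellwise (Suc m) P v) \<and> integral\<^sup>L lborel v = 0"
proof
  assume v: "v \<in> V3d_bubble m x"
  then have "\<exists>p. plt (Suc m) p \<and> (\<forall>y\<in>interior (alfeld x i). v y = p y)" if i: "i \<le> 3" for i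
  proof -
    have "restr (interior (alfeld x i)) v \<in> Pol m (interior (alfeld x i))" using v i unfolding V3d_bubble_def by blast
    then obtain p where p: "p \<in> polys m" "restr (interior (alfeld x i)) v = restr (interior (alfeld x i)) p"
      unfolding Pol_def by blast
    have "v y = p y" if "y \<in> interior (alfeld x i)" for y
      using fun_cong[OF p(2), of y] that by (simp add: restr_def)
    then show ?thesis using p(1) unfolding polys_iff_plt by blast
  qed
  then obtain P where P: "\<And>i. i \<le> 3 \<Longrightarrow> plt (Suc m) (P i) \<and> (\<forall>y\<in>interior (alfeld x i). v y = P i y)" by metis
  have e: "restr (open_cells x) v = v" using v unfolding V3d_bubble_def by blast
  have "v y = 0" if "y \<notin> open_cells x" for y
    by (subst e[symmetric]) (simp add: restr_def that)
  then have c: "cellwise (Suc m) P v" using P unfolding cellwise_def by blast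
  moreover have "(LINT y:tetra x|lebesgue. v y) = 0" using v unfolding V3d_bubble_def by blast
  ultimately show "(\<exists>P. cellwise (Suc m) P v) \<and> integral\<^sup>L lborel v = 0" using cellwise_LINT[OF c] by auto
next
  assume "(\<exists>P. cellwise (Suc m) P v) \<and> integral\<^sup>L lborel v = 0"
  then obtain P where c: "cellwise (Suc m) P v" and z: "integral\<^sup>L lborel v = 0" by blast
  have tm: "tetra x \<in> sets lebesgue" using compact_tetra lmeasurable_compact fmeasurableD by blast
  have int: "integrable lebesgue f" if "cellwise k Q f" for k Q and f :: "real^3 \<Rightarrow> real"
    using cellwise_integrable[OF that] by (simp add: integrable_completion borel_measurable_integrable)
  have "v \<in> borel_measurable (lebesgue_on (tetra x))"
    using borel_measurable_integrable[OF int[OF c]] by (rule measurable_restrict_space1)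
  moreover have "integrable (lebesgue_on (tetra x)) (\<lambda>y. (v y)\<^sup>2)"
  proof -
    have "integrable lebesgue (\<lambda>y. v y * v y)" by (rule int[OF cellwise_mult[OF c c]])
    moreover have "(\<lambda>y. v y * v y) = (\<lambda>y. indicator (tetra x) y *\<^sub>R (v y)\<^sup>2)"
      using c open_cells_subset unfolding cellwise_def by (auto simp: fun_eq_iff indicator_def power2_eq_square)
    ultimately show ?thesis using tm by (simp add: integrable_restrict_space)
  qed
  moreover have "restr (open_cells x) v = v" using c unfolding cellwise_def restr_def by auto
  moreover have "restr (interior (alfeld x i)) v \<in> Pol m (interior (alfeld x i))" if "i \<le> 3" for i
    unfolding Pol_def
    by (rule image_eqI[of _ _ "P i"]) (use c that in \<open>auto simp: cellwise_def restr_def polys_iff_plt\<close>)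
  ultimately show "v \<in> V3d_bubble m x"
    using cellwise_LINT[OF c] z unfolding V3d_bubble_def L2_def by simp
qed

lemma div3_into:
  assumes w: "w \<in> vec3 (bubbles (Suc m))" shows "div3 x w \<in> V3d_bubble m x"
proof -
  have "w \<in> vec3 (M0 (Suc m) x)" using w unfolding vec3_def bubbles_def by blast
  then obtain p where p: "\<And>i. i \<le> 3 \<Longrightarrow> vplt (Suc (Suc m)) (p i)" "\<And>i y. i \<le> 3 \<Longrightarrow> y \<in> alfeld x i \<Longrightarrow> w y = p i y"
    by (rule vector_M0_pieces) (rule that)
  have "cellwise (Suc m) (\<lambda>i. vdiv (p i)) (div3 x w)" by (rule div3_cellwise[OF p])
  then show ?thesis unfolding V3d_iff using div3_mean_zero[OF w] by blast
qed

section \<open>Exactness of the bubble complex\<close>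

lemma pasted_vector_bubble:
  assumes w: "\<And>i. i \<le> 3 \<Longrightarrow> vplt n (w i)" and gl: "glued lam w"
  defines "W \<equiv> pasted (\<lambda>i y. lam i y *\<^sub>R w i y)"
  shows "W \<in> vec3 (bubbles n)" "\<And>i y. i \<le> 3 \<Longrightarrow> y \<in> alfeld x i \<Longrightarrow> W y = lam i y *\<^sub>R w i y"
proof -
  have g: "glued lam (\<lambda>i y. lam i y *\<^sub>R w i y)" using glued_step[OF gl, of "\<lambda>y. 0"] by simp
  show W: "W y = lam i y *\<^sub>R w i y" if "i \<le> 3" "y \<in> alfeld x i" for i y
    unfolding W_def by (rule pasted_eq[OF g that])
  show "W \<in> vec3 (bubbles n)"
    by (rule vector_bubbles_I[OF w _ W]) (simp_all add: W_def pasted_off)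
qed

text \<open>
  By \<open>div_onto\<close> the function is a divergence up to \<open>c * lam 0 y ^ m\<close> on cell 0. This remainder has
  mean zero, being a difference of functions of mean zero, and it has constant sign, so it vanishes.
\<close>

theorem div3_surjective:
  assumes v: "v \<in> V3d_bubble m x"
  obtains W where "W \<in> vec3 (bubbles (Suc m))" "div3 x W = v"
proof -
  obtain P where P: "cellwise (Suc m) P v" and z: "integral\<^sup>L lborel v = 0" using v unfolding V3d_iff by blast
  have P': "plt (Suc m) (P i)" if "i \<le> 3" for i using P that unfolding cellwise_def by blast
  obtain w c where w: "\<And>i. i \<le> 3 \<Longrightarrow> vplt (Suc m) (w i)" "glued lam w"
    and d: "\<And>i y. i \<le> 3 \<Longrightarrow> vdiv (\<lambda>y. lam i y ^ Suc 0 *\<^sub>R w i y) y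
        = lam i y ^ 0 * P i y - (if i = 0 then c * lam 0 y ^ (0 + Suc m - 1) else 0)"
    by (rule div_onto[where f = P and j = 0 and n = "Suc m"]) (erule P', rule that)
  define W where "W = pasted (\<lambda>i y. lam i y *\<^sub>R w i y)"
  have Wb: "W \<in> vec3 (bubbles (Suc m))" and We: "\<And>i y. i \<le> 3 \<Longrightarrow> y \<in> alfeld x i \<Longrightarrow> W y = lam i y *\<^sub>R w i y"
    unfolding W_def by (rule pasted_vector_bubble[OF w]; assumption)+
  have lw: "vplt (Suc (Suc m)) (\<lambda>y. lam i y *\<^sub>R w i y)" if "i \<le> 3" for i
    by (rule vplt_affn[OF affn_lam]) (use w(1)[OF that] in simp)
  have dc: "cellwise (Suc m) (\<lambda>i. vdiv (\<lambda>y. lam i y *\<^sub>R w i y)) (div3 x W)"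
    by (rule div3_cellwise[OF lw We])
  let ?r = "\<lambda>y. v y - div3 x W y"
  have r: "cellwise (Suc m) (\<lambda>i y. P i y - vdiv (\<lambda>y. lam i y *\<^sub>R w i y) y) ?r" by (rule cellwise_diff[OF P dc])
  have r0: "integral\<^sup>L lborel ?r = 0"
    using cellwise_integrable[OF P] cellwise_integrable[OF dc] z div3_mean_zero[OF Wb] by simp
  have re: "?r y = (if i = 0 then c * lam 0 y ^ m else 0)" if "i \<le> 3" "y \<in> interior (alfeld x i)" for i y
    using r that d[OF that(1), of y] unfolding cellwise_def by simp
  have ro: "?r y = 0" if "y \<notin> open_cells x" for y using r that unfolding cellwise_def by blast
  have "?r y = 0" for y
  proof -
    have pos: "0 \<le> lam 0 y ^ m" if "y \<in> interior (alfeld x 0)" for y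
      using that interior_alfeld_iff[of 0 y] by simp
    have sgn: "0 \<le> sgn c * ?r y" for y
    proof (cases "y \<in> open_cells x")
      case True
      then obtain i where i: "i \<le> 3" "y \<in> interior (alfeld x i)" unfolding open_cells_iff by blast
      show ?thesis
      proof (cases "i = 0")
        case True
        have "sgn c * (c * lam 0 y ^ m) = \<bar>c\<bar> * lam 0 y ^ m" by (simp only: mult.assoc[symmetric] mult.commute[of "sgn c"] abs_sgn[symmetric])
        moreover have "0 \<le> \<bar>c\<bar> * lam 0 y ^ m" using pos i(2) True by (intro mult_nonneg_nonneg) auto
        moreover have "?r y = c * lam 0 y ^ m" using re[OF i] True by simp
        ultimately show ?thesis by (simp only:)
      qed (use re[OF i] in simp)
    qed (simp add: ro)
    have sr: "cellwise (Suc m) (\<lambda>i y. sgn c * (P i y - vdiv (\<lambda>y. lam i y *\<^sub>R w i y) y)) (\<lambda>y. sgn c * ?r y)"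
      using r unfolding cellwise_def by (auto intro: plt_cmult)
    have "sgn c * ?r y = 0" for y
      by (rule cellwise_zero_integral[OF sr sgn]) (use r0 in simp)
    moreover have "?r y = 0" if "c = 0"
    proof (cases "y \<in> open_cells x")
      case True
      then obtain i where i: "i \<le> 3" "y \<in> interior (alfeld x i)" unfolding open_cells_iff by blast
      then show ?thesis using re[OF i] that by simp
    qed (simp add: ro)
    ultimately show ?thesis by (metis mult_eq_0_iff sgn_zero_iff)
  qed
  then have "div3 x W = v" by (intro ext) (metis eq_iff_diff_eq_0)
  then show ?thesis using that Wb by blast
qed

lemma closure_interior_alfeld: assumes "i \<le> 3" shows "closure (interior (alfeld x i)) = alfeld x i"
proof -
  obtain q where "q \<in> interior (alfeld x i)" by (rule cell_points[OF assms])
  moreover have "convex (alfeld x i)" unfolding alfeld_def tetra_def by simp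
  ultimately show ?thesis using convex_closure_interior[of "alfeld x i"] closure_closed[OF closed_alfeld] by blast
qed

text \<open>
  A divergence-free bubble is \<open>lam i *\<^sub>R p i\<close> on cell \<open>i\<close>, which is the case \<open>j = 1\<close> of \<open>curl_onto\<close>; the
  continuity of \<open>p\<close> makes its jumps zero. The continuous representative of the curl of the potential is
  the bubble itself.
\<close>

theorem exactness:
  assumes w: "w \<in> vec3 (bubbles n)" and d: "\<And>y. div3 x w y = 0"
  obtains r where "r \<in> M1d_bubble (Suc n) x" "curl x r = restr (open_cells x) w"
proof -
  obtain p where p: "\<And>i. i \<le> 3 \<Longrightarrow> vplt n (p i)" "glued lam p"
    and wp: "\<And>i y. i \<le> 3 \<Longrightarrow> y \<in> alfeld x i \<Longrightarrow> w y = lam i y *\<^sub>R p i y"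
    by (rule vector_bubbles_pieces[OF w]) (rule that)
  have lp: "vplt (Suc n) (\<lambda>y. lam i y *\<^sub>R p i y)" if "i \<le> 3" for i
    by (rule vplt_affn[OF affn_lam]) (use p(1)[OF that] in simp)
  have dc: "cellwise n (\<lambda>i. vdiv (\<lambda>y. lam i y *\<^sub>R p i y)) (div3 x w)" by (rule div3_cellwise[OF lp wp])
  have Z: "real 1 * (h i \<bullet> p i y) + lam i y * vdiv (p i) y = 0" if i: "i \<le> 3" for i y
  proof -
    have "vdiv (\<lambda>y. lam i y *\<^sub>R p i y) y = 0"
    proof (rule plt_zero_cell[OF _ i])
      show "plt n (vdiv (\<lambda>y. lam i y *\<^sub>R p i y))" using dc i unfolding cellwise_def by blast
      show "vdiv (\<lambda>y. lam i y *\<^sub>R p i y) y = 0" if "y \<in> interior (alfeld x i)" for y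
        using dc i that d[of y] unfolding cellwise_def by metis
    qed
    then show ?thesis using vdiv_lam_power[OF p(1)[OF i], of i 0 y] by simp
  qed
  have N: "(h i - h k) \<bullet> (p i y - p k y) = 0" if "i \<le> 3" "k \<le> 3" "lam i y = lam k y" for i k y
  proof -
    have "p i y = p k y" using p(2) that unfolding glued_def by blast
    then show ?thesis by simp
  qed
  obtain s where s: "\<And>i. i \<le> 3 \<Longrightarrow> vplt n (s i)" "glued lam s"
    and c: "\<And>i y. i \<le> 3 \<Longrightarrow> vcurl (\<lambda>y. lam i y ^ Suc 1 *\<^sub>R s i y) y = lam i y ^ 1 *\<^sub>R p i y"
    by (rule curl_onto[where p = p and n = n and j = 1]) (erule p(1), simp, rule N, assumption+, rule Z, assumption, rule that)
  define q where "q i y = lam i y *\<^sub>R s i y" for i y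
  have q: "vplt (Suc n) (q i)" if "i \<le> 3" for i unfolding q_def
    by (rule vplt_affn[OF affn_lam]) (use s(1)[OF that] in simp)
  have gq: "glued lam q" using glued_step[OF s(2), of "\<lambda>y. 0"] unfolding q_def by simp
  define r where "r = pasted (\<lambda>i y. lam i y *\<^sub>R q i y)"
  have rb: "r \<in> vec3 (bubbles (Suc n))" and re: "\<And>i y. i \<le> 3 \<Longrightarrow> y \<in> alfeld x i \<Longrightarrow> r y = lam i y *\<^sub>R q i y"
    unfolding r_def by (rule pasted_vector_bubble[OF q gq]; assumption)+
  have lq: "vplt (Suc (Suc n)) (\<lambda>y. lam i y *\<^sub>R q i y)" if "i \<le> 3" for i
    by (rule vplt_affn[OF affn_lam]) (use q[OF that] in simp)
  have cr: "curl x r y = w y" if i: "i \<le> 3" and y: "y \<in> interior (alfeld x i)" for i y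
  proof -
    have "curl x r y = vcurl (\<lambda>y. lam i y *\<^sub>R q i y) y"
      by (rule curl_local[OF lq[OF i] i y]) (use re[OF i] interior_subset in blast)
    also have "\<dots> = lam i y *\<^sub>R p i y"
      using c[OF i, of y] by (simp add: q_def One_nat_def)
    finally show ?thesis using wp[OF i] y interior_subset by (metis subsetD)
  qed
  have wc: "continuous_on (tetra x) w"
  proof -
    have "continuous_on (tetra x) (\<lambda>y. w y $ k)" for k using w unfolding vec3_def bubbles_def M0_def by blast
    then show ?thesis by (rule continuous_on_vec_lambda[of _ "\<lambda>k y. w y $ k", simplified])
  qed
  have fr: "u y = 0" if "u \<in> vec3 (bubbles k)" "y \<in> frontier (tetra x)" for u y k
    using that unfolding vec3_def bubbles_def by (simp add: vec_eq_iff)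
  have "r \<in> M1 (Suc n) x" using rb unfolding M1_def vec3_def bubbles_def by blast
  moreover have "\<forall>y\<in>open_cells x. w y = curl x r y" using cr open_cells_iff by auto
  ultimately have "r \<in> M1d_bubble (Suc n) x"
    unfolding M1d_bubble_def using wc fr[OF rb] fr[OF w] by blast
  moreover have "curl x r = restr (open_cells x) w"
  proof
    fix y show "curl x r y = restr (open_cells x) w y"
    proof (cases "y \<in> open_cells x")
      case True then show ?thesis using cr open_cells_iff by (auto simp: restr_def)
    qed (simp add: curl_def restr_def)
  qed
  ultimately show ?thesis using that by blast
qed

text \<open>
  The converse of \<open>exactness\<close>: the continuous representative \<open>g\<close> of the curl is polynomial on each closed
  cell, because a cell is the closure of its interior.
\<close>

theorem curl_of_bubble:
  assumes r: "r \<in> M1d_bubble (Suc n) x"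
  obtains w where "w \<in> vec3 (bubbles n)" "\<And>y. div3 x w y = 0" "curl x r = restr (open_cells x) w"
proof -
  obtain g where g: "continuous_on (tetra x) g" "\<And>y. y \<in> open_cells x \<Longrightarrow> g y = curl x r y"
    "\<And>y. y \<in> frontier (tetra x) \<Longrightarrow> g y = 0" and rM: "r \<in> vec3 (M0 (Suc n) x)"
    using r unfolding M1d_bubble_def M1_def by blast
  obtain p where p: "\<And>i. i \<le> 3 \<Longrightarrow> vplt (Suc (Suc n)) (p i)" "\<And>i y. i \<le> 3 \<Longrightarrow> y \<in> alfeld x i \<Longrightarrow> r y = p i y"
    by (rule vector_M0_pieces[OF rM]) (rule that)
  have cp: "vplt (Suc n) (vcurl (p i))" if "i \<le> 3" for i using vplt_vcurl[OF p(1)[OF that]] by simp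
  define w where "w = restr (tetra x) g"
  have we: "w y = vcurl (p i) y" if i: "i \<le> 3" and y: "y \<in> alfeld x i" for i y
  proof -
    have o: "w u = vcurl (p i) u" if u: "u \<in> interior (alfeld x i)" for u
    proof -
      have "u \<in> open_cells x" using i u open_cells_iff by blast
      moreover have "curl x r u = vcurl (p i) u"
        by (rule curl_local[OF p(1)[OF i] i u]) (use p(2)[OF i] interior_subset in blast)
      ultimately show ?thesis using g(2) open_cells_subset by (auto simp: w_def restr_def)
    qed
    have "continuous_on (alfeld x i) w"
    proof -
      have "continuous_on (alfeld x i) w \<longleftrightarrow> continuous_on (alfeld x i) g"
        by (rule continuous_on_cong[OF refl]) (use alfeld_subset[OF i] in \<open>auto simp: w_def restr_def\<close>)
      then show ?thesis using continuous_on_subset[OF g(1) alfeld_subset[OF i]] by blast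
    qed
    moreover have "continuous_on (alfeld x i) (vcurl (p i))"
    proof -
      have "continuous_on (alfeld x i) (\<lambda>y. vcurl (p i) y $ k)" for k
        using cp[OF i] plt_continuous unfolding vplt_def by blast
      then show ?thesis by (rule continuous_on_vec_lambda[of _ "\<lambda>k y. vcurl (p i) y $ k", simplified])
    qed
    ultimately have "continuous_on (closure (interior (alfeld x i))) (\<lambda>y. w y - vcurl (p i) y)"
      unfolding closure_interior_alfeld[OF i] by (intro continuous_intros)
    then have "w y - vcurl (p i) y = 0"
      by (rule continuous_constant_on_closure) (use o y closure_interior_alfeld[OF i] in auto)
    then show ?thesis by simp
  qed
  have w0: "w y = 0" if "y \<notin> tetra x" for y using that by (simp add: w_def restr_def)
  have "w \<in> vec3 (bubbles n)" unfolding vec3_def bubbles_def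
  proof (intro CollectI allI conjI ballI)
    fix k
    show "(\<lambda>y. w y $ k) \<in> M0 n x"
    proof (rule M0_I[of n "\<lambda>i y. vcurl (p i) y $ k"])
      show "plt (Suc n) (\<lambda>y. vcurl (p i) y $ k)" if "i \<le> 3" for i using cp[OF that] unfolding vplt_def by blast
    qed (simp_all add: w0 we)
    fix y assume y: "y \<in> frontier (tetra x)"
    then have "g y = 0" by (rule g(3))
    then show "w y $ k = 0" by (simp add: w_def restr_def)
  qed
  moreover have "div3 x w y = 0" for y
  proof (cases "y \<in> open_cells x")
    case True
    then obtain i where i: "i \<le> 3" "y \<in> interior (alfeld x i)" unfolding open_cells_iff by blast
    have "div3 x w y = vdiv (vcurl (p i)) y"
      by (rule div3_local[OF cp[OF i(1)] i]) (use we[OF i(1)] interior_subset in blast)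
    then show ?thesis using vdiv_vcurl[OF p(1)[OF i(1)]] by simp
  qed (simp add: div3_def restr_def)
  moreover have "curl x r = restr (open_cells x) w"
    using g(2) open_cells_subset by (auto simp: fun_eq_iff w_def restr_def curl_def)
  ultimately show ?thesis using that by blast
qed

end

section \<open>Dimensions of the spaces of test functions\<close>

lemma restr_add: "restr S (f + g) = restr S f + restr S (g :: real^3 \<Rightarrow> 'a::real_vector)"
  by (auto simp: restr_def fun_eq_iff)

lemma restr_scaleR: "restr S (c *\<^sub>R f) = c *\<^sub>R restr S (f :: real^3 \<Rightarrow> 'a::real_vector)"
  by (auto simp: restr_def fun_eq_iff scaleR_fun_def)

lemma subspace_plt: "subspace {p. plt n p}"
  unfolding subspace_def plus_fun_def scaleR_fun_def zero_fun_def
  by (auto intro: plt_zero plt_add plt_cmult)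

lemma linear_on_restr: "subspace V \<Longrightarrow> linear_on V (restr S :: (real^3 \<Rightarrow> 'a::real_vector) \<Rightarrow> _)"
  unfolding linear_on_def by (simp add: restr_add restr_scaleR)

lemma subspace_linear_image: assumes "linear_on V f" shows "subspace (f ` V)"
  unfolding subspace_def
proof (intro conjI ballI allI)
  have V: "subspace V" using assms unfolding linear_on_def by blast
  show "0 \<in> f ` V" using linear_on_zero[OF assms] subspace_0[OF V] by (metis imageI)
  fix u assume "u \<in> f ` V"
  then obtain a where a: "a \<in> V" "u = f a" by blast
  show "c *\<^sub>R u \<in> f ` V" for c
  proof (rule image_eqI)
    show "c *\<^sub>R u = f (c *\<^sub>R a)" using assms a unfolding linear_on_def by simp
    show "c *\<^sub>R a \<in> V" using V a subspace_scale by blast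
  qed
  fix v assume "v \<in> f ` V"
  then obtain b where b: "b \<in> V" "v = f b" by blast
  show "u + v \<in> f ` V"
  proof (rule image_eqI)
    show "u + v = f (a + b)" using assms a b unfolding linear_on_def by simp
    show "a + b \<in> V" using V a b subspace_add by blast
  qed
qed

lemma has_dim_vec3: assumes "has_dim X n" shows "has_dim (vec3 X) (3 * n)"
proof -
  let ?F = "\<lambda>(f, g, h) y. vector [f y, g y, h y] :: real^3"
  have X: "subspace X" by (rule has_dim_subspace_of[OF assms])
  have "has_dim (?F ` (X \<times> X \<times> X)) (n + n + n)"
  proof (rule has_dim_image[OF has_dim_Times[OF assms has_dim_Times[OF assms assms]]])
    show "linear_on (X \<times> X \<times> X) ?F" unfolding linear_on_def
      using X by (auto simp: subspace_Times scaleR_fun_def fun_eq_iff vec_eq_iff forall_3)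
    fix u assume "u \<in> X \<times> X \<times> X" "?F u = 0"
    then show "u = 0" by (auto simp: zero_prod_def fun_eq_iff vec_eq_iff forall_3)
  qed
  moreover have "?F ` (X \<times> X \<times> X) = vec3 X"
  proof (intro equalityI subsetI)
    fix f assume "f \<in> ?F ` (X \<times> X \<times> X)"
    then show "f \<in> vec3 X" by (auto simp: vec3_def forall_3)
  next
    fix f assume f: "f \<in> vec3 X"
    have "f = ?F (\<lambda>y. f y $ 1, \<lambda>y. f y $ 2, \<lambda>y. f y $ 3)" by (auto simp: fun_eq_iff vec_eq_iff forall_3)
    then show "f \<in> ?F ` (X \<times> X \<times> X)" using f unfolding vec3_def by blast
  qed
  moreover have "n + n + n = 3 * n" by simp
  ultimately show ?thesis by (simp only:)
qed

text \<open>
  The dimension of the polynomials of degree less than \<open>n\<close> in \<open>s\<close> variables, by Pascal's recursion. The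
  closed forms for \<open>s \<le> 3\<close> are stated without division.
\<close>

fun pdim :: "nat \<Rightarrow> nat \<Rightarrow> nat" where
  "pdim s 0 = 0"
| "pdim 0 (Suc n) = 1"
| "pdim (Suc s) (Suc n) = pdim (Suc s) n + pdim s (Suc n)"

lemma pdim_1: "pdim 1 n = n"
  unfolding One_nat_def by (induction n) auto

lemma pdim_2: "2 * pdim 2 n = n * (n + 1)"
proof (induction n)
  case (Suc n)
  have "pdim 2 (Suc n) = pdim 2 n + pdim 1 (Suc n)" by (simp add: numeral_2_eq_2 One_nat_def)
  then show ?case using Suc pdim_1[of "Suc n"] by simp
qed simp

lemma pdim_3: "6 * pdim 3 n = n * (n + 1) * (n + 2)"
proof (induction n)
  case (Suc n)
  have "pdim 3 (Suc n) = pdim 3 n + pdim 2 (Suc n)" by (simp add: numeral_2_eq_2 numeral_3_eq_3)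
  then have "6 * pdim 3 (Suc n) = 6 * pdim 3 n + 3 * (2 * pdim 2 (Suc n))" by simp
  then show ?case unfolding Suc.IH pdim_2 by (simp add: algebra_simps)
qed simp

lemma Pol_plt: "Pol m S = restr S ` {p. plt (Suc m) p}"
  unfolding Pol_def using polys_iff_plt by (auto simp: image_iff)

context tetrahedron
begin

lemma plt_zero_hull:
  assumes p: "plt n p" and S: "S \<subseteq> {..3}" "S \<noteq> {}"
    and z: "\<And>y. y \<in> convex hull (x ` S) \<Longrightarrow> p y = 0" and y: "\<And>i. i \<in> {..3} - S \<Longrightarrow> lam i y = 0"
  shows "p y = 0"
proof -
  have fin: "finite S" using S finite_subset by blast
  have "(\<Sum>i\<le>3. if i \<in> S then 1 / real (card S) else 0) = (\<Sum>i\<in>S. 1 / real (card S))"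
    using S by (intro sum.mono_neutral_cong_right) auto
  also have "\<dots> = 1" using S fin by simp
  finally obtain q where q: "\<And>i. i \<le> 3 \<Longrightarrow> lam i q = (if i \<in> S then 1 / real (card S) else 0)"
    by (rule point_with_lam) (rule that)
  let ?U = "\<Inter>k\<in>S. {y. 0 < lam k y}"
  show ?thesis
  proof (rule plt_zero_open[OF p, of ?U q])
    show "open ?U" by (intro open_INT ballI open_lam fin)
    show "q \<in> ?U" using q S fin by (auto simp: card_gt_0_iff)
    fix t assume U: "q + t *\<^sub>R (y - q) \<in> ?U"
    have "lam i (q + t *\<^sub>R (y - q)) = 0" if "i \<in> {..3} - S" for i
      using q that y by (simp add: lam_line)
    then have "q + t *\<^sub>R (y - q) \<in> convex hull (x ` S)" using U unfolding hull_eq[OF S(1)] by (auto intro: less_imp_le)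
    then show "p (q + t *\<^sub>R (y - q)) = 0" by (rule z)
  qed
qed

text \<open>
  Pascal's recursion by restriction to the facet opposite to \<open>x a\<close>: the polynomials vanishing there
  are the multiples of \<open>lam a\<close>.
\<close>

lemma has_dim_face_step:
  assumes S: "S \<subseteq> {..3}" and a: "a \<in> S" and b: "b \<in> S" "b \<noteq> a"
    and d1: "has_dim (restr (convex hull (x ` S)) ` {p. plt n p}) d1"
    and d2: "has_dim (restr (convex hull (x ` (S - {a}))) ` {p. plt (Suc n) p}) d2"
  shows "has_dim (restr (convex hull (x ` S)) ` {p. plt (Suc n) p}) (d1 + d2)"
proof (rule has_dim_rank_nullity[where f = "restr (convex hull (x ` (S - {a})))"])
  let ?F = "convex hull (x ` S)" and ?G = "convex hull (x ` (S - {a}))"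
  have a3: "a \<le> 3" and b3: "b \<le> 3" using S a b by auto
  have GF: "?G \<subseteq> ?F" by (intro hull_mono image_mono) auto
  have S': "S - {a} \<subseteq> {..3}" using S by auto
  show "linear_on (restr ?F ` {p. plt (Suc n) p}) (restr ?G)"
    by (intro linear_on_restr subspace_linear_image subspace_plt)
  have rr: "restr ?G (restr ?F p) = restr ?G p" for p :: "real^3 \<Rightarrow> real"
    using GF by (auto simp: restr_def fun_eq_iff)
  have "restr ?G ` restr ?F ` {p. plt (Suc n) p} = restr ?G ` {p. plt (Suc n) p}"
    unfolding image_image rr ..
  then show "has_dim (restr ?G ` restr ?F ` {p. plt (Suc n) p}) d2" using d2 by simp
  let ?M = "\<lambda>q y. lam a y * (q y :: real)"
  have lin: "linear_on (restr ?F ` {p. plt n p}) ?M"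
    unfolding linear_on_def using subspace_linear_image[OF linear_on_restr[OF subspace_plt]]
    by (auto simp: scaleR_fun_def fun_eq_iff algebra_simps)
  have inj: "u = 0" if u: "u \<in> restr ?F ` {p. plt n p}" "?M u = 0" for u
  proof -
    obtain c where c: "plt n c" "u = restr ?F c" using u by blast
    have z: "lam a y * c y = 0" if "y \<in> ?F" for y
      using fun_cong[OF u(2), of y] that by (simp add: c restr_def)
    have "c y = 0" if y: "y \<in> ?F" for y
    proof (rule plt_zero_extend[OF c(1) zero_less_one, of "x a"])
      fix t :: real assume t: "0 < t" "t < 1"
      have "x a + t *\<^sub>R (y - x a) = (1 - t) *\<^sub>R x a + t *\<^sub>R y" by (simp add: algebra_simps)
      also have "\<dots> \<in> ?F" using t y a by (intro convexD[OF convex_convex_hull]) (auto intro: hull_inc)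
      finally have m: "x a + t *\<^sub>R (y - x a) \<in> ?F" .
      have "lam a (x a + t *\<^sub>R (y - x a)) = (1 - t) + t * lam a y"
        unfolding lam_line using lam_vertex[OF a3 a3] by (simp add: algebra_simps)
      moreover have "0 \<le> lam a y" using y a unfolding hull_eq[OF S] by auto
      ultimately have "lam a (x a + t *\<^sub>R (y - x a)) > 0" using t by (simp add: add_pos_nonneg)
      then show "c (x a + t *\<^sub>R (y - x a)) = 0" using z[OF m] by simp
    qed
    then show ?thesis by (auto simp: c restr_def fun_eq_iff)
  qed
  have "{u \<in> restr ?F ` {p. plt (Suc n) p}. restr ?G u = 0} = ?M ` restr ?F ` {p. plt n p}"
  proof (intro equalityI subsetI)
    fix u assume "u \<in> {u \<in> restr ?F ` {p. plt (Suc n) p}. restr ?G u = 0}"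
    then obtain p where p: "plt (Suc n) p" and u: "u = restr ?F p" and "restr ?G (restr ?F p) = 0" by blast
    then have e: "restr ?G p = 0" unfolding rr by blast
    have "p y = 0" if "y \<in> ?G" for y
      using fun_cong[OF e, of y] that by (simp add: restr_def)
    then have pz: "p y = 0" if "\<And>i. i \<in> {..3} - (S - {a}) \<Longrightarrow> lam i y = 0" for y
      using plt_zero_hull[OF p S', of y] b that by blast
    obtain c where c: "plt (Suc n - 1) c" "\<And>y. (\<And>i. i \<in> {..3} - S \<Longrightarrow> lam i y = 0) \<Longrightarrow> p y = lam a y * c y"
    proof (rule flat_divide[OF p, of "{..3} - S" a b])
      fix y assume y: "lam a y = 0" "\<And>i. i \<in> {..3} - S \<Longrightarrow> lam i y = 0"
      show "p y = 0" by (rule pz) (use y in auto)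
    qed (use a b a3 b3 in auto)
    have "u = ?M (restr ?F c)"
    proof
      fix y show "u y = ?M (restr ?F c) y"
        using c(2)[of y] by (cases "y \<in> ?F") (auto simp: u restr_def hull_eq[OF S])
    qed
    then show "u \<in> ?M ` restr ?F ` {p. plt n p}" using c(1) by auto
  next
    fix u assume "u \<in> ?M ` restr ?F ` {p. plt n p}"
    then obtain c where c: "plt n c" and u: "u = ?M (restr ?F c)" by blast
    have e: "u = restr ?F (\<lambda>y. lam a y * c y)" by (auto simp: u restr_def fun_eq_iff)
    have "plt (Suc n) (\<lambda>y. lam a y * c y)" by (rule lam_plt_mult) (simp add: c)
    moreover have "lam a y = 0" if "y \<in> ?G" for y using that a a3 unfolding hull_eq[OF S'] by auto
    then have "restr ?G u = 0" by (auto simp: u restr_def fun_eq_iff)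
    ultimately show "u \<in> {u \<in> restr ?F ` {p. plt (Suc n) p}. restr ?G u = 0}" using e by blast
  qed
  then show "has_dim {u \<in> restr ?F ` {p. plt (Suc n) p}. restr ?G u = 0} d1"
    using has_dim_image[OF d1 lin inj] by simp
qed

lemma has_dim_face:
  "S \<subseteq> {..3} \<Longrightarrow> card S = Suc s \<Longrightarrow> has_dim (restr (convex hull (x ` S)) ` {p. plt n p}) (pdim s n)"
proof (induction s arbitrary: S n)
  case 0
  then obtain a where a: "S = {a}" by (auto simp: card_1_singleton_iff)
  show ?case
  proof (cases n)
    case 0
    have "restr (convex hull (x ` S)) ` {p. plt n p} = {0}"
      using plt_0 plt_zero unfolding 0 by (auto simp: restr_def fun_eq_iff image_iff intro!: exI[of _ "\<lambda>y. 0"])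
    then show ?thesis using 0 has_dim_0 by simp
  next
    case (Suc m)
    have "restr (convex hull (x ` S)) ` {p. plt n p} = (\<lambda>c::real. restr {x a} (\<lambda>y. c)) ` UNIV"
    proof (intro equalityI subsetI)
      fix u assume "u \<in> restr (convex hull (x ` S)) ` {p. plt n p}"
      then obtain p where "u = restr {x a} p" unfolding a by auto
      then have "u = restr {x a} (\<lambda>y. p (x a))" by (auto simp: restr_def fun_eq_iff)
      then show "u \<in> (\<lambda>c::real. restr {x a} (\<lambda>y. c)) ` UNIV" by blast
    next
      fix u assume "u \<in> (\<lambda>c::real. restr {x a} (\<lambda>y. c)) ` UNIV"
      then obtain c where "u = restr {x a} (\<lambda>y. c)" by blast
      then show "u \<in> restr (convex hull (x ` S)) ` {p. plt n p}" using plt_const[of m c] unfolding Suc a by auto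
    qed
    moreover have "has_dim (UNIV :: real set) 1"
      unfolding has_dim_def by (intro exI[of _ "\<lambda>_. 1"]) (auto simp: One_nat_def)
    then have "has_dim ((\<lambda>c::real. restr {x a} (\<lambda>y. c)) ` UNIV) 1"
    proof (rule has_dim_image)
      show "linear_on UNIV (\<lambda>c::real. restr {x a} (\<lambda>y. c))"
        unfolding linear_on_def by (auto simp: restr_def fun_eq_iff scaleR_fun_def)
      show "u = 0" if "restr {x a} (\<lambda>y. u) = 0" for u :: real
        using fun_cong[OF that, of "x a"] by (simp add: restr_def)
    qed
    ultimately show ?thesis by (simp add: Suc)
  qed
next
  case (Suc s)
  note IH = Suc.IH and prems = Suc.prems
  have fin: "finite S" using Suc.prems finite_subset by blast
  obtain a where a: "a \<in> S" using Suc.prems by fastforce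
  have card: "card (S - {a}) = Suc s" using Suc.prems a fin by simp
  then obtain b where b: "b \<in> S" "b \<noteq> a" by (metis Diff_iff card.empty ex_in_conv insertI1 nat.distinct(1))
  show ?case
  proof (induction n)
    case 0
    have "restr (convex hull (x ` S)) ` {p. plt 0 p} = {0}"
      using plt_0 plt_zero by (auto simp: restr_def fun_eq_iff image_iff intro!: exI[of _ "\<lambda>y. 0"])
    then show ?case using has_dim_0 by simp
  next
    case (Suc n)
    have "has_dim (restr (convex hull (x ` (S - {a}))) ` {p. plt (Suc n) p}) (pdim s (Suc n))"
      by (rule IH[OF _ card]) (use prems in auto)
    from has_dim_face_step[OF prems(1) a b Suc.IH this] show ?case by simp
  qed
qed

lemma has_dim_plt: "has_dim {p. plt n p} (pdim 3 n)"
proof -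
  have im: "has_dim (restr (convex hull (x ` {..3})) ` {p. plt n p}) (pdim 3 n)"
    by (rule has_dim_face) simp_all
  have "{u \<in> {p. plt n p}. restr (convex hull (x ` {..3})) u = 0} = {0}"
  proof (intro equalityI subsetI)
    fix u assume u: "u \<in> {u \<in> {p. plt n p}. restr (convex hull (x ` {..3})) u = 0}"
    then have p: "plt n u" and e: "restr (convex hull (x ` {..3})) u = 0" by auto
    have "u y = 0" for y
    proof (rule plt_zero_hull[OF p, of "{..3}"])
      fix y assume "y \<in> convex hull (x ` {..3})"
      then show "u y = 0" using fun_cong[OF e, of y] by (simp add: restr_def)
    qed auto
    then show "u \<in> {0}" by auto
  qed (auto simp: zero_fun_def plt_zero restr_def)
  then have ker: "has_dim {u \<in> {p. plt n p}. restr (convex hull (x ` {..3})) u = 0} 0" using has_dim_0 by simp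
  show ?thesis using has_dim_rank_nullity[OF linear_on_restr[OF subspace_plt] ker im] by simp
qed

text \<open>
  The Newton coefficients are determined successively on cells 0, 1, 2, 3, since on cell \<open>i\<close> all
  terms after the \<open>i\<close>-th contain the factor \<open>mu - lam i = 0\<close>.
\<close>

lemma has_dim_bubbles:
  "has_dim (bubbles n) (pdim 3 n + pdim 3 (n - 1) + pdim 3 (n - 2) + pdim 3 (n - 3))"
proof -
  let ?B = "{b. plt n b} \<times> {b. plt (n - 1) b} \<times> {b. plt (n - 2) b} \<times> {b. plt (n - 3) b}"
  have d: "has_dim ?B (((pdim 3 (n - 3) + pdim 3 (n - 2)) + pdim 3 (n - 1)) + pdim 3 n)"
    by (intro has_dim_Times has_dim_plt)
  have "linear_on ?B newton"
    unfolding linear_on_def using has_dim_subspace_of[OF d]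
    by (auto simp: newton_def fun_eq_iff scaleR_fun_def algebra_simps)
  moreover have "u = 0" if u: "u \<in> ?B" "newton u = 0" for u
  proof -
    obtain b0 b1 b2 b3 where ub: "u = (b0, b1, b2, b3)" by (cases u) auto
    have b: "plt n b0" "plt (n - 1) b1" "plt (n - 2) b2" "plt (n - 3) b3" using u ub by auto
    have z: "b0 y + (lam i y - lam 0 y) * (b1 y + (lam i y - lam 1 y) * (b2 y + (lam i y - lam 2 y) * b3 y)) = 0"
      and ne: "\<And>j. j \<le> 3 \<Longrightarrow> j \<noteq> i \<Longrightarrow> lam i y - lam j y \<noteq> 0"
      if i: "i \<le> 3" and y: "y \<in> interior (alfeld x i)" for i y
    proof -
      have "mu y = lam i y" using mu_alfeld[OF i] y interior_subset by blast
      moreover have "lam i y \<noteq> 0" using y interior_alfeld_iff[OF i] by auto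
      ultimately show "b0 y + (lam i y - lam 0 y) * (b1 y + (lam i y - lam 1 y) * (b2 y + (lam i y - lam 2 y) * b3 y)) = 0"
        using fun_cong[OF u(2), of y] by (simp add: ub newton_def)
      show "lam i y - lam j y \<noteq> 0" if "j \<le> 3" "j \<noteq> i" for j using y interior_alfeld_iff[OF i, of y] that by force
    qed
    have b0: "b0 y = 0" for y by (rule plt_zero_cell[OF b(1), of 0]) (use z[of 0] in simp_all)
    have b1: "b1 y = 0" for y
      by (rule plt_zero_cell[OF b(2), of 1]) (use z[of 1] ne[of 1 _ 0] in \<open>simp_all add: b0\<close>)
    have b2: "b2 y = 0" for y
      by (rule plt_zero_cell[OF b(3), of 2]) (use z[of 2] ne[of 2 _ 0] ne[of 2 _ 1] in \<open>simp_all add: b0 b1\<close>)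
    have b3: "b3 y = 0" for y
      by (rule plt_zero_cell[OF b(4), of 3]) (use z[of 3] ne[of 3 _ 0] ne[of 3 _ 1] ne[of 3 _ 2] in \<open>simp_all add: b0 b1 b2\<close>)
    show ?thesis using b0 b1 b2 b3 by (auto simp: ub zero_prod_def fun_eq_iff)
  qed
  ultimately have "has_dim (newton ` ?B) (((pdim 3 (n - 3) + pdim 3 (n - 2)) + pdim 3 (n - 1)) + pdim 3 n)"
    by (rule has_dim_image[OF d])
  then show ?thesis unfolding bubbles_newton by (simp add: algebra_simps)
qed

lemma has_dim_cellwise: "has_dim {v. \<exists>P. cellwise n P v} (4 * pdim 3 n)"
proof -
  let ?Q = "{p. plt n p}"
  let ?J = "\<lambda>(p0, p1, p2, p3) y. indicator (interior (alfeld x 0)) y * p0 y + indicator (interior (alfeld x 1)) y * p1 y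
    + indicator (interior (alfeld x 2)) y * p2 y + (indicator (interior (alfeld x 3)) y * p3 y :: real)"
  have d: "has_dim (?Q \<times> ?Q \<times> ?Q \<times> ?Q) (((pdim 3 n + pdim 3 n) + pdim 3 n) + pdim 3 n)"
    by (intro has_dim_Times has_dim_plt)
  have lin: "linear_on (?Q \<times> ?Q \<times> ?Q \<times> ?Q) ?J"
    unfolding linear_on_def using has_dim_subspace_of[OF d]
    by (auto simp: fun_eq_iff scaleR_fun_def algebra_simps)
  have cell: "cellwise n (\<lambda>i. [p0, p1, p2, p3] ! i) (?J (p0, p1, p2, p3))"
    if "plt n p0" "plt n p1" "plt n p2" "plt n p3" for p0 p1 p2 p3
    unfolding cellwise_def
  proof (intro conjI allI impI ballI)
    fix i :: nat assume i: "i \<le> 3"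
    show "plt n ([p0, p1, p2, p3] ! i)" using le3_cases[OF i] that by auto
    fix y assume y: "y \<in> interior (alfeld x i)"
    have "indicator (interior (alfeld x j)) y = (if j = i then 1 else 0 :: real)" if "j \<le> 3" for j
      using interior_alfeld_disjoint[OF i that y] y interior_subset by (auto simp: indicator_def)
    then show "?J (p0, p1, p2, p3) y = ([p0, p1, p2, p3] ! i) y"
      using le3_cases[OF i] by (elim disjE) simp_all
  next
    fix y assume "y \<notin> open_cells x"
    then have "indicator (interior (alfeld x j)) y = (0 :: real)" if "j \<le> 3" for j
      using that open_cells_iff by (auto simp: indicator_def)
    then show "?J (p0, p1, p2, p3) y = 0" by simp
  qed
  have "has_dim (?J ` (?Q \<times> ?Q \<times> ?Q \<times> ?Q)) (((pdim 3 n + pdim 3 n) + pdim 3 n) + pdim 3 n)"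
  proof (rule has_dim_image[OF d lin])
    fix u assume u: "u \<in> ?Q \<times> ?Q \<times> ?Q \<times> ?Q" "?J u = 0"
    obtain p0 p1 p2 p3 where up: "u = (p0, p1, p2, p3)" by (cases u) auto
    have p: "plt n p0" "plt n p1" "plt n p2" "plt n p3" using u up by auto
    have z: "([p0, p1, p2, p3] ! i) y = 0" if i: "i \<le> 3" for i y
    proof (rule plt_zero_cell[OF _ i])
      show "plt n ([p0, p1, p2, p3] ! i)" using cell[OF p] i unfolding cellwise_def by blast
      fix y assume y: "y \<in> interior (alfeld x i)"
      have a: "?J (p0, p1, p2, p3) y = ([p0, p1, p2, p3] ! i) y"
        using cell[OF p] i y unfolding cellwise_def by blast
      have b: "?J (p0, p1, p2, p3) = 0" using u(2) unfolding up .
      show "([p0, p1, p2, p3] ! i) y = 0"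
        using trans[OF a[symmetric] fun_cong[OF b, of y]] by (simp only: zero_fun_def)
    qed
    show "u = 0" using z[of 0] z[of 1] z[of 2] z[of 3] by (auto simp: up zero_prod_def fun_eq_iff)
  qed
  moreover have "?J ` (?Q \<times> ?Q \<times> ?Q \<times> ?Q) = {v. \<exists>P. cellwise n P v}"
  proof (intro equalityI subsetI)
    fix v assume "v \<in> ?J ` (?Q \<times> ?Q \<times> ?Q \<times> ?Q)"
    then obtain p0 p1 p2 p3 where "v = ?J (p0, p1, p2, p3)" "plt n p0" "plt n p1" "plt n p2" "plt n p3" by blast
    then show "v \<in> {v. \<exists>P. cellwise n P v}" using cell by blast
  next
    fix v assume "v \<in> {v. \<exists>P. cellwise n P v}"
    then obtain P where P: "cellwise n P v" by blast
    then have "plt n (P i)" if "i \<le> 3" for i using that unfolding cellwise_def by blast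
    then have "(P 0, P 1, P 2, P 3) \<in> ?Q \<times> ?Q \<times> ?Q \<times> ?Q" by simp
    moreover have "v = ?J (P 0, P 1, P 2, P 3)"
      using cellwise_sum[OF P] by (auto simp: fun_eq_iff sum_le3)
    ultimately show "v \<in> ?J ` (?Q \<times> ?Q \<times> ?Q \<times> ?Q)" by (rule rev_image_eqI)
  qed
  moreover have "pdim 3 n + pdim 3 n + pdim 3 n + pdim 3 n = 4 * pdim 3 n" by simp
  ultimately show ?thesis by (simp only:)
qed

text \<open>
  The kernel of the integral, a nonzero functional.
\<close>

lemma has_dim_V3d: "has_dim (V3d_bubble m x) (4 * pdim 3 (Suc m) - 1)"
proof -
  let ?C = "{v. \<exists>P. cellwise (Suc m) P v}"
  have C: "subspace ?C" by (rule has_dim_subspace_of[OF has_dim_cellwise])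
  have int: "integrable lborel v" if "v \<in> ?C" for v using that cellwise_integrable by blast
  have lin: "linear_on ?C (integral\<^sup>L lborel :: _ \<Rightarrow> real)"
    unfolding linear_on_def plus_fun_def scaleR_fun_def using C int by auto
  have "integral\<^sup>L lborel ` ?C = (UNIV :: real set)"
  proof -
    define e where "e = restr (open_cells x) (\<lambda>y. 1 :: real)"
    have e: "cellwise (Suc m) (\<lambda>i y. 1) e"
      using open_cells_iff plt_const by (auto simp: cellwise_def e_def restr_def)
    obtain q where q: "q \<in> interior (alfeld x 0)" by (rule cell_points[of 0]) simp_all
    have "integral\<^sup>L lborel e \<noteq> 0"
    proof
      assume "integral\<^sup>L lborel e = 0"
      then have "e q = 0" by (rule cellwise_zero_integral[OF e, rotated]) (simp add: e_def restr_def)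
      moreover have "q \<in> open_cells x" unfolding open_cells_iff using q by blast
      ultimately show False by (simp add: e_def restr_def)
    qed
    moreover have "integral\<^sup>L lborel (t *\<^sub>R e) = t *\<^sub>R integral\<^sup>L lborel e" for t
      using lin e unfolding linear_on_def by blast
    ultimately have "c = integral\<^sup>L lborel ((c / integral\<^sup>L lborel e) *\<^sub>R e)" for c
      by simp
    moreover have "(c / integral\<^sup>L lborel e) *\<^sub>R e \<in> ?C" for c
      by (rule subspace_scale[OF C]) (use e in blast)
    ultimately show ?thesis by blast
  qed
  moreover have "has_dim (UNIV :: real set) 1"
    unfolding has_dim_def by (intro exI[of _ "\<lambda>_. 1"]) (auto simp: One_nat_def)
  ultimately have "has_dim {v \<in> ?C. integral\<^sup>L lborel v = 0} (4 * pdim 3 (Suc m) - 1)"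
    using has_dim_kernel(1)[OF lin has_dim_cellwise] by simp
  moreover have "{v \<in> ?C. integral\<^sup>L lborel v = 0} = V3d_bubble m x" using V3d_iff by blast
  ultimately show ?thesis by simp
qed

lemma linear_on_div3: "linear_on (vec3 (bubbles n)) (div3 x)"
proof -
  have sub: "subspace (vec3 (bubbles n))" by (rule has_dim_subspace_of[OF has_dim_vec3[OF has_dim_bubbles]])
  have "\<exists>p. (\<forall>i\<le>3. vplt (Suc n) (p i)) \<and> (\<forall>i\<le>3. \<forall>y\<in>interior (alfeld x i). w y = p i y)" if w: "w \<in> vec3 (bubbles n)" for w
  proof -
    have "w \<in> vec3 (M0 n x)" using w unfolding vec3_def bubbles_def by blast
    then obtain p where p: "\<And>i. i \<le> 3 \<Longrightarrow> vplt (Suc n) (p i)" "\<And>i y. i \<le> 3 \<Longrightarrow> y \<in> alfeld x i \<Longrightarrow> w y = p i y"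
      by (rule vector_M0_pieces) (rule that)
    then show ?thesis using interior_subset by (intro exI[of _ p]) blast
  qed
  then obtain p where p: "\<And>w i. w \<in> vec3 (bubbles n) \<Longrightarrow> i \<le> 3 \<Longrightarrow> vplt (Suc n) (p w i)"
    "\<And>w i y. w \<in> vec3 (bubbles n) \<Longrightarrow> i \<le> 3 \<Longrightarrow> y \<in> interior (alfeld x i) \<Longrightarrow> w y = p w i y" by metis
  have loc: "div3 x w y = vdiv (p w i) y" if "w \<in> vec3 (bubbles n)" "i \<le> 3" "y \<in> interior (alfeld x i)" for w i y
    by (rule div3_local[OF p(1)[OF that(1,2)] that(2,3)]) (rule p(2)[OF that(1,2)])
  have off: "div3 x w y = 0" if "y \<notin> open_cells x" for w y using that by (simp add: div3_def restr_def)
  have "div3 x (u + v) y = div3 x u y + div3 x v y" if u: "u \<in> vec3 (bubbles n)" and v: "v \<in> vec3 (bubbles n)" for u v y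
  proof (cases "y \<in> open_cells x")
    case True
    then obtain i where i: "i \<le> 3" "y \<in> interior (alfeld x i)" unfolding open_cells_iff by blast
    have "div3 x (u + v) y = vdiv (\<lambda>y. p u i y + p v i y) y"
      by (rule div3_local[OF vplt_add[OF p(1)[OF u i(1)] p(1)[OF v i(1)]] i])
        (simp add: p(2)[OF u i(1)] p(2)[OF v i(1)])
    also have "\<dots> = vdiv (p u i) y + vdiv (p v i) y"
      by (rule vdiv_add) (use vplt_differentiable p(1) u v i(1) in blast)+
    finally show ?thesis using loc[OF u i] loc[OF v i] by simp
  qed (simp add: off)
  moreover have "div3 x (c *\<^sub>R u) y = c * div3 x u y" if u: "u \<in> vec3 (bubbles n)" for u c y
  proof (cases "y \<in> open_cells x")
    case True
    then obtain i where i: "i \<le> 3" "y \<in> interior (alfeld x i)" unfolding open_cells_iff by blast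
    have "div3 x (c *\<^sub>R u) y = vdiv (\<lambda>y. c *\<^sub>R p u i y) y"
      by (rule div3_local[OF vplt_cmult[OF p(1)[OF u i(1)]] i])
        (simp add: scaleR_fun_def p(2)[OF u i(1)])
    also have "\<dots> = c * vdiv (p u i) y"
      by (subst vdiv_scaleR) (use vplt_differentiable[OF p(1)[OF u i(1)]] in \<open>auto simp: grad_def inner_3\<close>)
    finally show ?thesis using loc[OF u i] by simp
  qed (simp add: off)
  ultimately show ?thesis using sub unfolding linear_on_def by (auto simp: fun_eq_iff scaleR_fun_def)
qed

lemma bubbles_zero_of_cells:
  assumes w: "w \<in> vec3 (bubbles n)" and z: "\<And>y. y \<in> open_cells x \<Longrightarrow> w y = 0" shows "w y = 0"
proof (cases "y \<in> tetra x")
  case True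
  then obtain i where i: "i \<le> 3" "y \<in> alfeld x i" by (rule alfeld_cover)
  have "w \<in> vec3 (M0 n x)" using w unfolding vec3_def bubbles_def by blast
  then obtain p where p: "\<And>i. i \<le> 3 \<Longrightarrow> vplt (Suc n) (p i)" "\<And>i y. i \<le> 3 \<Longrightarrow> y \<in> alfeld x i \<Longrightarrow> w y = p i y"
    by (rule vector_M0_pieces) (rule that)
  have "p i y $ k = 0" for k
  proof (rule plt_zero_cell[where p = "\<lambda>y. p i y $ k" and n = "Suc n" and i = i])
    show "plt (Suc n) (\<lambda>y. p i y $ k)" using p(1)[OF i(1)] unfolding vplt_def by blast
    fix u assume u: "u \<in> interior (alfeld x i)"
    then have "u \<in> open_cells x" using open_cells_iff i(1) by blast
    then have "w u = 0" by (rule z)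
    moreover have "w u = p i u" using p(2)[OF i(1)] u interior_subset by blast
    ultimately show "p i u $ k = 0" by simp
  qed (rule i(1))
  then show ?thesis using p(2)[OF i] by (simp add: vec_eq_iff)
next
  case False
  then have "w y $ k = 0" for k using w M0_off[of "\<lambda>y. w y $ k" n y] unfolding vec3_def bubbles_def by blast
  then show ?thesis by (simp add: vec_eq_iff)
qed

text \<open>
  By \<open>exactness\<close> and \<open>curl_of_bubble\<close> the curls are the divergence-free bubbles, restricted to the open
  cells; by \<open>div3_surjective\<close> these are the kernel of a map of known rank. The inequality is recorded because
  the dimension is a truncated difference.
\<close>

lemma has_dim_curl:
  "has_dim (curl x ` M1d_bubble (Suc (Suc m)) x)
    (3 * (pdim 3 (Suc m) + pdim 3 m + pdim 3 (m - 1) + pdim 3 (m - 2)) - (4 * pdim 3 (Suc m) - 1))"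
    "4 * pdim 3 (Suc m) - 1 \<le> 3 * (pdim 3 (Suc m) + pdim 3 m + pdim 3 (m - 1) + pdim 3 (m - 2))"
proof -
  let ?B = "vec3 (bubbles (Suc m))"
  let ?d = "3 * (pdim 3 (Suc m) + pdim 3 m + pdim 3 (m - 1) + pdim 3 (m - 2))"
  let ?K = "{w \<in> ?B. div3 x w = 0}"
  have "Suc m - 2 = m - 1" "Suc m - 3 = m - 2" by simp_all
  then have B: "has_dim ?B ?d" using has_dim_vec3[OF has_dim_bubbles[of "Suc m"]] by simp
  have "div3 x ` ?B = V3d_bubble m x"
  proof (intro equalityI subsetI)
    fix v assume "v \<in> V3d_bubble m x"
    then obtain W where "W \<in> ?B" "div3 x W = v" by (rule div3_surjective)
    then show "v \<in> div3 x ` ?B" by blast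
  qed (use div3_into in blast)
  then have V: "has_dim (div3 x ` ?B) (4 * pdim 3 (Suc m) - 1)" using has_dim_V3d by simp
  have K: "has_dim ?K (?d - (4 * pdim 3 (Suc m) - 1))" and le: "4 * pdim 3 (Suc m) - 1 \<le> ?d"
    by (rule has_dim_kernel[OF linear_on_div3 B V])+
  have "has_dim (restr (open_cells x) ` ?K) (?d - (4 * pdim 3 (Suc m) - 1))"
  proof (rule has_dim_image[OF K linear_on_restr[OF has_dim_subspace_of[OF K]]])
    fix u assume u: "u \<in> ?K" "restr (open_cells x) u = 0"
    have "u y = 0" if "y \<in> open_cells x" for y using fun_cong[OF u(2), of y] that by (simp add: restr_def)
    then have "u y = 0" for y using bubbles_zero_of_cells[of u "Suc m"] u(1) by blast
    then show "u = 0" by auto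
  qed
  moreover have "curl x ` M1d_bubble (Suc (Suc m)) x = restr (open_cells x) ` ?K"
  proof (intro equalityI subsetI)
    fix v assume "v \<in> curl x ` M1d_bubble (Suc (Suc m)) x"
    then obtain r where r: "r \<in> M1d_bubble (Suc (Suc m)) x" "v = curl x r" by blast
    obtain w where "w \<in> ?B" "\<And>y. div3 x w y = 0" "curl x r = restr (open_cells x) w" by (rule curl_of_bubble[OF r(1)]) (rule that)
    then show "v \<in> restr (open_cells x) ` ?K" using r(2) by (auto simp: fun_eq_iff)
  next
    fix v assume "v \<in> restr (open_cells x) ` ?K"
    then obtain w where w: "w \<in> ?B" "div3 x w = 0" "v = restr (open_cells x) w" by blast
    obtain r where "r \<in> M1d_bubble (Suc (Suc m)) x" "curl x r = restr (open_cells x) w"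
      by (rule exactness[OF w(1)]) (simp add: w(2), rule that)
    then show "v \<in> curl x ` M1d_bubble (Suc (Suc m)) x" using w(3) by (intro image_eqI[of _ _ r]) simp_all
  qed
  ultimately show "has_dim (curl x ` M1d_bubble (Suc (Suc m)) x) (?d - (4 * pdim 3 (Suc m) - 1))" by simp
  show "4 * pdim 3 (Suc m) - 1 \<le> ?d" by (rule le)
qed

lemma has_dim_edge: "i \<le> 3 \<Longrightarrow> j \<le> 3 \<Longrightarrow> i \<noteq> j \<Longrightarrow> has_dim (vec3 (Pol m (edge x i j))) (3 * Suc m)"
  using has_dim_vec3[OF has_dim_face[of "{i, j}" 1 "Suc m"]] pdim_1
  unfolding Pol_plt edge_def by (simp add: One_nat_def)

lemma has_dim_triangle:
  "i \<le> 3 \<Longrightarrow> j \<le> 3 \<Longrightarrow> k \<le> 3 \<Longrightarrow> i \<noteq> j \<Longrightarrow> i \<noteq> k \<Longrightarrow> j \<noteq> k \<Longrightarrow>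
    has_dim (vec3 (Pol m (face x i j k))) (3 * pdim 2 (Suc m))"
  using has_dim_vec3[OF has_dim_face[of "{i, j, k}" 2 "Suc m"]]
  unfolding Pol_plt face_def by (simp add: numeral_2_eq_2)

end

section \<open>Traces on edges and faces\<close>

lemma edge_integral_cong:
  assumes "\<And>t. 0 \<le> t \<Longrightarrow> t \<le> 1 \<Longrightarrow> f (a + t *\<^sub>R (b - a)) = g (a + t *\<^sub>R (b - a))"
  shows "edge_integral a b f = edge_integral a b g"
proof -
  have "(LINT t:{0..1}|lborel. f (a + t *\<^sub>R (b - a))) = (LINT t:{0..1}|lborel. g (a + t *\<^sub>R (b - a)))"
    by (rule set_lebesgue_integral_cong) (use assms in auto)
  then show ?thesis unfolding edge_integral_def by simp
qed

lemma plt_edge_integrable: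
  assumes "plt n f" shows "integrable lborel (\<lambda>t. indicator {0..1} t *\<^sub>R f (a + t *\<^sub>R (b - a)))"
  by (intro borel_integrable_compact compact_Icc continuous_on_compose2[OF plt_continuous[OF assms, of UNIV]] continuous_intros) auto

lemma edge_integral_diff:
  assumes "plt m f" "plt n g"
  shows "edge_integral a b (\<lambda>y. f y - g y) = edge_integral a b f - edge_integral a b g"
  using plt_edge_integrable[OF assms(1), of a b] plt_edge_integrable[OF assms(2), of a b]
  unfolding edge_integral_def set_lebesgue_integral_def by (simp add: right_diff_distrib)

abbreviation triangle :: "(real \<times> real) set"
  where "triangle \<equiv> {p. 0 \<le> fst p \<and> 0 \<le> snd p \<and> fst p + snd p \<le> 1}"

lemma compact_triangle: "compact triangle"
proof -
  have "closed triangle"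
    by (intro closed_Collect_conj closed_Collect_le continuous_intros)
  moreover have "triangle \<subseteq> {0..1} \<times> {0..1}" by auto
  then have "bounded triangle" 
    by (rule bounded_subset[OF compact_imp_bounded[OF compact_Times[OF compact_Icc compact_Icc]]])
  ultimately show ?thesis unfolding compact_eq_bounded_closed by (rule conjI[rotated])
qed

lemma face_integral_cong:
  assumes "\<And>s t. 0 \<le> s \<Longrightarrow> 0 \<le> t \<Longrightarrow> s + t \<le> 1 \<Longrightarrow>
    f (a + s *\<^sub>R (b - a) + t *\<^sub>R (c - a)) = g (a + s *\<^sub>R (b - a) + t *\<^sub>R (c - a))"
  shows "face_integral a b c f = face_integral a b c g"
proof -
  have "(LINT p:triangle|lborel. f (a + fst p *\<^sub>R (b - a) + snd p *\<^sub>R (c - a)))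
      = (LINT p:triangle|lborel. g (a + fst p *\<^sub>R (b - a) + snd p *\<^sub>R (c - a)))"
    by (rule set_lebesgue_integral_cong) (use assms compact_triangle in \<open>auto intro: borel_compact\<close>)
  then show ?thesis unfolding face_integral_def by simp
qed

lemma plt_face_integrable:
  assumes "plt n f"
  shows "integrable lborel (\<lambda>p. indicator triangle p *\<^sub>R f (a + fst p *\<^sub>R (b - a) + snd p *\<^sub>R (c - a)))"
  by (intro borel_integrable_compact compact_triangle continuous_on_compose2[OF plt_continuous[OF assms, of UNIV]] continuous_intros) auto

lemma face_integral_diff:
  assumes "plt m f" "plt n g"
  shows "face_integral a b c (\<lambda>y. f y - g y) = face_integral a b c f - face_integral a b c g"
  using plt_face_integrable[OF assms(1), of a b c] plt_face_integrable[OF assms(2), of a b c]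
  unfolding face_integral_def set_lebesgue_integral_def by (simp add: right_diff_distrib)

context tetrahedron
begin

lemma edge_points:
  assumes ij: "i \<le> 3" "j \<le> 3" "i \<noteq> j" and k: "k \<le> 3"
  shows "lam k (x i + t *\<^sub>R (x j - x i)) = (if k = i then 1 - t else if k = j then t else 0)"
  using ij k by (simp add: lam_line lam_vertex)

lemma face_points:
  assumes ij: "i \<le> 3" "j \<le> 3" "k \<le> 3" "i \<noteq> j" "i \<noteq> k" "j \<noteq> k" and l: "l \<le> 3"
  shows "lam l (x i + s *\<^sub>R (x j - x i) + t *\<^sub>R (x k - x i))
    = (if l = i then 1 - s - t else if l = j then s else if l = k then t else 0)"
  using ij l by (simp add: lam_diff lam_vertex h_edge)

lemma edge_hull_point:
  assumes ij: "i \<le> 3" "j \<le> 3" "i \<noteq> j" and y: "\<And>k. k \<in> {..3} - {i, j} \<Longrightarrow> lam k y = 0"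
  shows "y = x i + lam j y *\<^sub>R (x j - x i)"
proof -
  have s: "(\<Sum>k\<le>3. lam k y *\<^sub>R x k) = (\<Sum>k\<in>{i, j}. lam k y *\<^sub>R x k)" "(\<Sum>k\<le>3. lam k y) = (\<Sum>k\<in>{i, j}. lam k y)"
    using ij y by (intro sum.mono_neutral_right; auto)+
  then have l: "lam i y = 1 - lam j y" using lam_sum[of y] ij by simp
  have "y = lam i y *\<^sub>R x i + lam j y *\<^sub>R x j" using lam_expand[of y] s(1) ij by simp
  then show ?thesis unfolding l by (simp add: algebra_simps)
qed

lemma face_hull_point:
  assumes ij: "i \<le> 3" "j \<le> 3" "k \<le> 3" "i \<noteq> j" "i \<noteq> k" "j \<noteq> k"
    and y: "\<And>l. l \<in> {..3} - {i, j, k} \<Longrightarrow> lam l y = 0"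
  shows "y = x i + lam j y *\<^sub>R (x j - x i) + lam k y *\<^sub>R (x k - x i)" "lam i y + lam j y + lam k y = 1"
proof -
  have s: "(\<Sum>l\<le>3. lam l y *\<^sub>R x l) = (\<Sum>l\<in>{i, j, k}. lam l y *\<^sub>R x l)" "(\<Sum>l\<le>3. lam l y) = (\<Sum>l\<in>{i, j, k}. lam l y)"
    using ij y by (intro sum.mono_neutral_right; auto)+
  then show l: "lam i y + lam j y + lam k y = 1" using lam_sum[of y] ij by (simp add: add.assoc)
  then have li: "lam i y = 1 - lam j y - lam k y" by simp
  have "y = lam i y *\<^sub>R x i + lam j y *\<^sub>R x j + lam k y *\<^sub>R x k" using lam_expand[of y] s(1) ij by (simp add: add.assoc)
  then show "y = x i + lam j y *\<^sub>R (x j - x i) + lam k y *\<^sub>R (x k - x i)" unfolding li by (simp add: algebra_simps)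
qed

text \<open>
  A polynomial vanishing at both ends of an edge equals \<open>lam i * lam j * d\<close> on it. Testing
  with \<open>d\<close> gives the integral of a nonnegative function.
\<close>

lemma zero_on_edge:
  assumes P: "plt n P" and ij: "i \<le> 3" "j \<le> 3" "i \<noteq> j"
    and v: "P (x i) = 0" "P (x j) = 0"
    and int: "\<And>d. plt (n - 2) d \<Longrightarrow> edge_integral (x i) (x j) (\<lambda>y. P y * d y) = 0"
    and y: "\<And>k. k \<in> {..3} - {i, j} \<Longrightarrow> lam k y = 0"
  shows "P y = 0"
proof -
  let ?Z = "{..3} - {i, j}"
  have Z: "?Z \<subseteq> {..3}" "i \<notin> ?Z" "j \<notin> ?Z" by auto
  have P0: "P y = 0" if "lam i y = 0" "\<And>k. k \<in> ?Z \<Longrightarrow> lam k y = 0" for y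
  proof -
    have "y = x j + lam i y *\<^sub>R (x i - x j)" by (rule edge_hull_point) (use that ij in auto)
    then show ?thesis using v that(1) by simp
  qed
  obtain c where c: "plt (n - 1) c" "\<And>y. (\<And>k. k \<in> ?Z \<Longrightarrow> lam k y = 0) \<Longrightarrow> P y = lam i y * c y"
    using flat_divide[OF P Z(1) ij(1) Z(2) ij(2) Z(3) ij(3)[symmetric] P0] by blast
  have c0: "c y = 0" if "lam j y = 0" "\<And>k. k \<in> ?Z \<Longrightarrow> lam k y = 0" for y
  proof -
    have e: "y = x i + lam j y *\<^sub>R (x j - x i)" by (rule edge_hull_point[OF ij that(2)])
    then have "y = x i" using that(1) by simp
    then show ?thesis using c(2)[of y] that(2) v(1) lam_vertex[OF ij(1,1)] by simp
  qed
  obtain d where d: "plt (n - 1 - 1) d" "\<And>y. (\<And>k. k \<in> ?Z \<Longrightarrow> lam k y = 0) \<Longrightarrow> c y = lam j y * d y"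
    using flat_divide[OF c(1) Z(1) ij(2) Z(3) ij(1) Z(2) ij(3) c0] by blast
  let ?y = "\<lambda>t. x i + t *\<^sub>R (x j - x i)"
  have Pd: "P (?y t) * d (?y t) = (1 - t) * t * (d (?y t))\<^sup>2" and Pe: "P (?y t) = (1 - t) * t * d (?y t)" for t
  proof -
    have "lam k (?y t) = 0" if "k \<in> ?Z" for k using edge_points[OF ij] that by auto
    then have "P (?y t) = lam i (?y t) * (lam j (?y t) * d (?y t))" using c(2) d(2) by simp
    then show "P (?y t) = (1 - t) * t * d (?y t)" using edge_points[OF ij] ij by simp
    then show "P (?y t) * d (?y t) = (1 - t) * t * (d (?y t))\<^sup>2" by (simp add: power2_eq_square)
  qed
  have dn: "plt (n - 2) d" using d(1) by (simp add: diff_diff_left)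
  have Pdp: "plt (n + (n - 2)) (\<lambda>y. P y * d y)" by (rule plt_mult[OF P dn])
  have "x j \<noteq> x i" using lam_vertex[OF ij(1,1)] lam_vertex[OF ij(1,2)] ij(3) by auto
  then have z: "integral\<^sup>L lborel (\<lambda>t. indicator {0..1} t * (P (?y t) * d (?y t))) = 0"
    using int[OF dn] unfolding edge_integral_def set_lebesgue_integral_def by simp
  have dz: "P (?y t) * d (?y t) = 0" if t: "t \<in> {0<..<1}" for t
  proof (rule integral_zero_imp_zero[OF _ _ z open_greaterThanLessThan _ _ t])
    show "integrable lborel (\<lambda>t. indicator {0..1} t * (P (?y t) * d (?y t)))"
      using plt_edge_integrable[OF Pdp, of "x i" "x j"] by simp
    show "0 \<le> P (?y t) * d (?y t)" if "t \<in> {0..1}" for t unfolding Pd using that by simp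
    show "continuous_on {0<..<1} (\<lambda>t. P (?y t) * d (?y t))"
      by (intro continuous_on_compose2[OF plt_continuous[OF Pdp, of UNIV]] continuous_intros) auto
  qed auto
  show ?thesis
  proof (rule plt_zero_hull[OF P, of "{i, j}"])
    show S: "{i, j} \<subseteq> {..3}" using ij by simp
    fix u assume "u \<in> convex hull (x ` {i, j})"
    then have u: "0 \<le> lam i u" "0 \<le> lam j u" "\<And>k. k \<in> ?Z \<Longrightarrow> lam k u = 0"
      unfolding hull_eq[OF S] by auto
    have e: "u = ?y (lam j u)" by (rule edge_hull_point[OF ij u(3)])
    have "lam i u = 1 - lam j u" using edge_points[OF ij ij(1), of "lam j u"] e by simp
    then have "lam j u = 0 \<or> lam j u = 1 \<or> lam j u \<in> {0<..<1}" using u by auto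
    then show "P u = 0"
    proof (elim disjE)
      assume "lam j u \<in> {0<..<1}"
      \<comment> \<open>inside the edge the weight \<open>(1 - t) * t\<close> is positive\<close>
      from dz[OF this] this have "d (?y (lam j u)) = 0" unfolding Pd by simp
      then show ?thesis using Pe[of "lam j u"] e by simp
    qed (use Pe[of "lam j u"] e in simp_all)
  next
    show "lam k y = 0" if "k \<in> {..3} - {i, j}" for k by (rule y[OF that])
  qed simp
qed

text \<open>
  As on edges: a polynomial vanishing on the three edges of a face equals \<open>lam i * lam j * lam k * d\<close> on it,
  and testing with \<open>d\<close> gives the integral of a nonnegative function.
\<close>

lemma zero_on_face:
  assumes P: "plt n P" and ij: "i \<le> 3" "j \<le> 3" "k \<le> 3" "i \<noteq> j" "i \<noteq> k" "j \<noteq> k"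
    and m: "m \<le> 3" "m \<notin> {i, j, k}"
    and e: "\<And>l y. l \<in> {i, j, k} \<Longrightarrow> lam m y = 0 \<Longrightarrow> lam l y = 0 \<Longrightarrow> P y = 0"
    and int: "\<And>d. plt (n - 3) d \<Longrightarrow> face_integral (x i) (x j) (x k) (\<lambda>y. P y * d y) = 0"
    and y: "lam m y = 0"
  shows "P y = 0"
proof -
  have Zm: "{..3} - {i, j, k} = {m}"
  proof -
    have "card {i, j, k, m} = 4" using ij m by simp
    then have "{i, j, k, m} = {..3}" using ij m by (intro card_subset_eq) auto
    then show ?thesis using m by auto
  qed
  have M: "{m} \<subseteq> {..3}" using m by simp
  have ni: "i \<notin> {m}" "j \<notin> {m}" "k \<notin> {m}" using m by auto
  have P0: "P y = 0" if "lam i y = 0" "\<And>l. l \<in> {m} \<Longrightarrow> lam l y = 0" for y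
    using e[of i y] that by simp
  obtain c where c: "plt (n - 1) c" "\<And>y. (\<And>l. l \<in> {m} \<Longrightarrow> lam l y = 0) \<Longrightarrow> P y = lam i y * c y"
    using flat_divide[OF P M ij(1) ni(1) ij(2) ni(2) ij(4)[symmetric] P0] by blast
  have c0: "c y = 0" if y: "lam j y = 0" "\<And>l. l \<in> {m} \<Longrightarrow> lam l y = 0" for y
  proof (rule flat_cancel[OF c(1), of "{m, j}" i])
    show "lam i y * c y = 0" if "\<And>l. l \<in> {m, j} \<Longrightarrow> lam l y = 0" for y
      using c(2)[of y] e[of j y] that by simp
  qed (use ij m y in auto)
  obtain d where d: "plt (n - 1 - 1) d" "\<And>y. (\<And>l. l \<in> {m} \<Longrightarrow> lam l y = 0) \<Longrightarrow> c y = lam j y * d y"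
    using flat_divide[OF c(1) M ij(2) ni(2) ij(1) ni(1) ij(4) c0] by blast
  have d0: "d y = 0" if y: "lam k y = 0" "\<And>l. l \<in> {m} \<Longrightarrow> lam l y = 0" for y
  proof (rule flat_cancel[OF d(1), of "{m, k}" j])
    show "lam j y * d y = 0" if z: "\<And>l. l \<in> {m, k} \<Longrightarrow> lam l y = 0" for y
    proof -
      have "c y = 0"
      proof (rule flat_cancel[OF c(1), of "{m, k}" i])
        show "lam i y * c y = 0" if "\<And>l. l \<in> {m, k} \<Longrightarrow> lam l y = 0" for y
          using c(2)[of y] e[of k y] that by simp
      qed (use ij m z in auto)
      then show ?thesis using d(2)[of y] z by simp
    qed
  qed (use ij m y in auto)
  obtain f where f: "plt (n - 1 - 1 - 1) f" "\<And>y. (\<And>l. l \<in> {m} \<Longrightarrow> lam l y = 0) \<Longrightarrow> d y = lam k y * f y"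
    using flat_divide[OF d(1) M ij(3) ni(3) ij(1) ni(1) ij(5) d0] by blast
  let ?y = "\<lambda>p. x i + fst p *\<^sub>R (x j - x i) + snd p *\<^sub>R (x k - x i)"
  have Pe: "P (?y p) = (1 - fst p - snd p) * fst p * snd p * f (?y p)"
    and Pf: "P (?y p) * f (?y p) = (1 - fst p - snd p) * fst p * snd p * (f (?y p))\<^sup>2" for p
  proof -
    have "lam m (?y p) = 0" using face_points[OF ij m(1)] m(2) by simp
    then have "P (?y p) = lam i (?y p) * (lam j (?y p) * (lam k (?y p) * f (?y p)))" using c(2) d(2) f(2) by simp
    then show "P (?y p) = (1 - fst p - snd p) * fst p * snd p * f (?y p)"
      using face_points[OF ij ij(1)] face_points[OF ij ij(2)] face_points[OF ij ij(3)] ij by simp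
    then show "P (?y p) * f (?y p) = (1 - fst p - snd p) * fst p * snd p * (f (?y p))\<^sup>2" by (simp add: power2_eq_square)
  qed
  have fn: "plt (n - 3) f" using f(1) by (simp add: diff_diff_left)
  have Pfp: "plt (n + (n - 3)) (\<lambda>y. P y * f y)" by (rule plt_mult[OF P fn])
  have "cross3 (x j - x i) (x k - x i) \<noteq> 0"
  proof
    assume "cross3 (x j - x i) (x k - x i) = 0"
    then have col: "x j - x i = 0 \<or> x k - x i = 0 \<or> (\<exists>c. x k - x i = c *\<^sub>R (x j - x i))"
      unfolding cross_eq_0 collinear_lemma .
    have "h j \<bullet> (x j - x i) = 1" "h k \<bullet> (x k - x i) = 1" "h k \<bullet> (x j - x i) = 0" using ij by (simp_all add: h_edge)
    then show False using col by auto
  qed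
  then have z: "integral\<^sup>L lborel (\<lambda>p. indicator triangle p * (P (?y p) * f (?y p))) = 0"
    using int[OF fn] unfolding face_integral_def set_lebesgue_integral_def by simp
  let ?U = "{p :: real \<times> real. 0 < fst p \<and> 0 < snd p \<and> fst p + snd p < 1}"
  have op: "open ?U" by (intro open_Collect_conj open_Collect_less continuous_intros)
  have sub: "?U \<subseteq> triangle" by auto
  have fz: "P (?y p) * f (?y p) = 0" if p: "p \<in> ?U" for p
  proof (rule integral_zero_imp_zero[OF _ _ z op sub _ p])
    show "integrable lborel (\<lambda>p. indicator triangle p * (P (?y p) * f (?y p)))"
      using plt_face_integrable[OF Pfp, of "x i" "x j" "x k"] by simp
    show "0 \<le> P (?y p) * f (?y p)" if "p \<in> triangle" for p unfolding Pf using that by simp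
    show "continuous_on ?U (\<lambda>p. P (?y p) * f (?y p))"
      by (intro continuous_on_compose2[OF plt_continuous[OF Pfp, of UNIV]] continuous_intros) auto
  qed
  show ?thesis
  proof (rule plt_zero_hull[OF P, of "{i, j, k}"])
    show S: "{i, j, k} \<subseteq> {..3}" using ij by simp
    fix u assume "u \<in> convex hull (x ` {i, j, k})"
    then have u: "0 \<le> lam i u" "0 \<le> lam j u" "0 \<le> lam k u" "lam m u = 0"
      unfolding hull_eq[OF S] Zm by auto
    have um: "lam l u = 0" if "l \<in> {..3} - {i, j, k}" for l using that u(4) unfolding Zm by simp
    show "P u = 0"
    proof (cases "lam i u = 0 \<or> lam j u = 0 \<or> lam k u = 0")
      case True
      then show ?thesis using e[of i u] e[of j u] e[of k u] u(4) by auto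
    next
      case False
      have uy: "u = ?y (lam j u, lam k u)" and s: "lam i u + lam j u + lam k u = 1"
        using face_hull_point[OF ij um] by auto
      have "(lam j u, lam k u) \<in> ?U" using False u s by (auto simp: less_le)
      from fz[OF this] this have "f (?y (lam j u, lam k u)) = 0" unfolding Pf by simp
      then have "P (?y (lam j u, lam k u)) = 0" using Pe[of "(lam j u, lam k u)"] by simp
      then show ?thesis using uy by simp
    qed
  next
    fix l assume "l \<in> {..3} - {i, j, k}"
    then show "lam l y = 0" using y unfolding Zm by simp
  qed simp
qed

lemma edges_eq: "edges = {(0, 1), (0, 2), (0, 3), (1, 2), (1, 3), (2, 3)}"
  unfolding edges_def by auto

lemma faces_eq: "faces = {(0, 1, 2), (0, 1, 3), (0, 2, 3), (1, 2, 3)}"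
  unfolding faces_def by auto

lemma alfeld_edge:
  assumes "i \<le> 3" "j \<le> 3" "m \<le> 3" "m \<noteq> i" "m \<noteq> j" "i \<noteq> j" "0 \<le> t" "t \<le> 1"
  shows "x i + t *\<^sub>R (x j - x i) \<in> alfeld x m" "x i + t *\<^sub>R (x j - x i) \<in> edge x i j"
proof -
  show "x i + t *\<^sub>R (x j - x i) \<in> alfeld x m"
    unfolding alfeld_iff[OF assms(3)] using edge_points[OF assms(1,2,6), of _ t] assms by simp
  have "(1 - t) *\<^sub>R x i + t *\<^sub>R x j \<in> edge x i j"
    unfolding edge_def using assms by (intro convexD[OF convex_convex_hull]) (auto intro: hull_inc)
  then show "x i + t *\<^sub>R (x j - x i) \<in> edge x i j" by (simp add: algebra_simps)
qed

lemma alfeld_face: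
  assumes ij: "i \<le> 3" "j \<le> 3" "k \<le> 3" "i \<noteq> j" "i \<noteq> k" "j \<noteq> k" and m: "m \<le> 3" "m \<notin> {i, j, k}"
    and st: "0 \<le> s" "0 \<le> t" "s + t \<le> 1"
  shows "x i + s *\<^sub>R (x j - x i) + t *\<^sub>R (x k - x i) \<in> alfeld x m"
    "x i + s *\<^sub>R (x j - x i) + t *\<^sub>R (x k - x i) \<in> face x i j k"
proof -
  show "x i + s *\<^sub>R (x j - x i) + t *\<^sub>R (x k - x i) \<in> alfeld x m"
    unfolding alfeld_iff[OF m(1)] using face_points[OF ij, of _ s t] m st by simp
  have S: "{i, j, k} \<subseteq> {..3}" using ij by simp
  have "face x i j k = convex hull (x ` {i, j, k})" by (simp add: face_def)
  then show "x i + s *\<^sub>R (x j - x i) + t *\<^sub>R (x k - x i) \<in> face x i j k"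
    unfolding hull_eq[OF S] using face_points[OF ij, of _ s t] st ij by auto
qed

text \<open>
  Scalar test functions are placed into one component, so that each component of the field can be
  treated separately.
\<close>

lemma axis_test: assumes "plt (Suc m) d" shows "(\<lambda>y. axis k (restr S d y)) \<in> vec3 (Pol m S)"
proof -
  have z: "(\<lambda>y. 0) \<in> Pol m S" unfolding Pol_plt
    by (rule image_eqI[of _ _ "\<lambda>y. 0"]) (auto simp: restr_def plt_zero)
  have "(\<lambda>y. axis k (restr S d y) $ i) = (if i = k then restr S d else (\<lambda>y. 0))" for i
    by (auto simp: axis_def)
  moreover have "restr S d \<in> Pol m S" unfolding Pol_plt using assms by blast
  ultimately show ?thesis using z unfolding vec3_def by simp
qed

lemma M0_diff:
  assumes "v \<in> M0 n x" "w \<in> M0 n x" shows "(\<lambda>y. v y - w y) \<in> M0 n x"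
proof -
  obtain p where p: "\<And>i. i \<le> 3 \<Longrightarrow> plt (Suc n) (p i)" "glued lam p" "\<And>i y. i \<le> 3 \<Longrightarrow> y \<in> alfeld x i \<Longrightarrow> v y = p i y"
    by (rule M0_pieces[OF assms(1)]) (rule that)
  obtain q where q: "\<And>i. i \<le> 3 \<Longrightarrow> plt (Suc n) (q i)" "glued lam q" "\<And>i y. i \<le> 3 \<Longrightarrow> y \<in> alfeld x i \<Longrightarrow> w y = q i y"
    by (rule M0_pieces[OF assms(2)]) (rule that)
  show ?thesis
    by (rule M0_I[of n "\<lambda>i y. p i y - q i y"])
      (simp_all add: p(1,3) q(1,3) plt_diff M0_off[OF assms(1)] M0_off[OF assms(2)])
qed

text \<open>
  Every boundary face belongs to one cell, so on it the difference is a single polynomial, to which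
  \<open>zero_on_edge\<close> and then \<open>zero_on_face\<close> apply.
\<close>

lemma difference_bubble:
  assumes n: "3 \<le> n" and w: "w \<in> M2 n x" "w' \<in> M2 n x"
    and a: "\<forall>i\<le>3. w (x i) = w' (x i)"
    and b: "\<forall>(i, j)\<in>edges. \<forall>\<kappa>\<in>vec3 (Pol (n - 2) (edge x i j)).
       edge_integral (x i) (x j) (\<lambda>y. w y \<bullet> \<kappa> y) = edge_integral (x i) (x j) (\<lambda>y. w' y \<bullet> \<kappa> y)"
    and c: "\<forall>(i, j, k)\<in>faces. \<forall>\<kappa>\<in>vec3 (Pol (n - 3) (face x i j k)).
       face_integral (x i) (x j) (x k) (\<lambda>y. w y \<bullet> \<kappa> y) = face_integral (x i) (x j) (x k) (\<lambda>y. w' y \<bullet> \<kappa> y)"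
  shows "(\<lambda>y. w y - w' y) \<in> vec3 (bubbles n)"
  unfolding vec3_def
proof (intro CollectI allI)
  fix l
  have wl: "(\<lambda>y. w y $ l) \<in> M0 n x" "(\<lambda>y. w' y $ l) \<in> M0 n x" using w unfolding M2_def vec3_def by auto
  obtain p where p: "\<And>i. i \<le> 3 \<Longrightarrow> plt (Suc n) (p i)" "glued lam p" "\<And>i y. i \<le> 3 \<Longrightarrow> y \<in> alfeld x i \<Longrightarrow> w y $ l = p i y"
    by (rule M0_pieces[OF wl(1)]) (rule that)
  obtain q where q: "\<And>i. i \<le> 3 \<Longrightarrow> plt (Suc n) (q i)" "glued lam q" "\<And>i y. i \<le> 3 \<Longrightarrow> y \<in> alfeld x i \<Longrightarrow> w' y $ l = q i y"
    by (rule M0_pieces[OF wl(2)]) (rule that)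
  define P where "P i y = p i y - q i y" for i y
  have P: "plt (Suc n) (P i)" if "i \<le> 3" for i unfolding P_def by (intro plt_diff p q that)
  have vert: "P m (x i) = 0" if "i \<le> 3" "m \<le> 3" "m \<noteq> i" for i m
  proof -
    have "x i \<in> alfeld x m" unfolding alfeld_iff[OF that(2)] using that by (simp add: lam_vertex)
    then show ?thesis using p(3)[OF that(2)] q(3)[OF that(2)] a that(1) unfolding P_def by (metis diff_self)
  qed
  have edge: "P m y = 0" if ij: "(i, j) \<in> edges" and m: "m \<le> 3" "m \<noteq> i" "m \<noteq> j"
    and y: "\<And>k. k \<in> {..3} - {i, j} \<Longrightarrow> lam k y = 0" for i j m y
  proof -
    have ij': "i \<le> 3" "j \<le> 3" "i \<noteq> j" using ij unfolding edges_def by auto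
    show ?thesis
    proof (rule zero_on_edge[OF P[OF m(1)] ij' vert[OF ij'(1) m(1,2)] vert[OF ij'(2) m(1,3)] _ y])
      fix d assume "plt (Suc n - 2) d"
      moreover have "Suc n - 2 = Suc (n - 2)" using n by simp
      ultimately have d: "plt (Suc (n - 2)) d" by simp
      let ?k = "\<lambda>y. axis l (restr (edge x i j) d y) :: real^3"
      have pd: "plt (Suc n + Suc (n - 2)) (\<lambda>y. p m y * d y)" "plt (Suc n + Suc (n - 2)) (\<lambda>y. q m y * d y)"
        by (intro plt_mult p q m d)+
      have "edge_integral (x i) (x j) (\<lambda>y. p m y * d y) = edge_integral (x i) (x j) (\<lambda>y. w y \<bullet> ?k y)"
        by (rule edge_integral_cong)
          (use alfeld_edge[OF ij'(1,2) m ij'(3)] p(3)[OF m(1)] in \<open>simp add: inner_axis restr_def\<close>)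
      moreover have "edge_integral (x i) (x j) (\<lambda>y. q m y * d y) = edge_integral (x i) (x j) (\<lambda>y. w' y \<bullet> ?k y)"
        by (rule edge_integral_cong)
          (use alfeld_edge[OF ij'(1,2) m ij'(3)] q(3)[OF m(1)] in \<open>simp add: inner_axis restr_def\<close>)
      moreover have "edge_integral (x i) (x j) (\<lambda>y. w y \<bullet> ?k y) = edge_integral (x i) (x j) (\<lambda>y. w' y \<bullet> ?k y)"
        by (rule bspec[OF bspec[OF b ij, unfolded prod.case] axis_test[OF d]])
      ultimately show "edge_integral (x i) (x j) (\<lambda>y. P m y * d y) = 0"
        using edge_integral_diff[OF pd, of "x i" "x j"] by (simp add: P_def left_diff_distrib)
    qed
  qed
  have face: "P m y = 0" if ijk: "(i, j, k) \<in> faces" and m: "m \<le> 3" "m \<notin> {i, j, k}" and y: "lam m y = 0" for i j k m y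
  proof -
    have ij': "i \<le> 3" "j \<le> 3" "k \<le> 3" "i \<noteq> j" "i \<noteq> k" "j \<noteq> k" using ijk unfolding faces_def by auto
    have E: "(i, j) \<in> edges" "(i, k) \<in> edges" "(j, k) \<in> edges" using ijk unfolding faces_def edges_def by auto
    have ms: "m \<noteq> i" "m \<noteq> j" "m \<noteq> k" using m by auto
    have Zm: "l = m" if "l \<in> {..3}" "l \<noteq> i" "l \<noteq> j" "l \<noteq> k" for l
      using that ij' m le3_cases[of l] le3_cases[of i] le3_cases[of j] le3_cases[of k] le3_cases[of m] by auto
    show ?thesis
    proof (rule zero_on_face[OF P[OF m(1)] ij' m _ _ y])
      fix l y assume l: "l \<in> {i, j, k}" and z: "lam m y = 0" "lam l y = 0"
      have "P m y = 0" if "l = i" by (rule edge[OF E(3) m(1) ms(2,3)]) (use Zm z that in \<open>auto; metis\<close>)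
      moreover have "P m y = 0" if "l = j" by (rule edge[OF E(2) m(1) ms(1,3)]) (use Zm z that in \<open>auto; metis\<close>)
      moreover have "P m y = 0" if "l = k" by (rule edge[OF E(1) m(1) ms(1,2)]) (use Zm z that in \<open>auto; metis\<close>)
      ultimately show "P m y = 0" using l by blast
    next
      fix d assume "plt (Suc n - 3) d"
      moreover have "Suc n - 3 = Suc (n - 3)" using n by simp
      ultimately have d: "plt (Suc (n - 3)) d" by simp
      let ?k = "\<lambda>y. axis l (restr (face x i j k) d y) :: real^3"
      have pd: "plt (Suc n + Suc (n - 3)) (\<lambda>y. p m y * d y)" "plt (Suc n + Suc (n - 3)) (\<lambda>y. q m y * d y)"
        by (intro plt_mult p q m d)+
      have "face_integral (x i) (x j) (x k) (\<lambda>y. p m y * d y) = face_integral (x i) (x j) (x k) (\<lambda>y. w y \<bullet> ?k y)"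
        by (rule face_integral_cong)
          (use alfeld_face[OF ij' m] p(3)[OF m(1)] in \<open>simp add: inner_axis restr_def\<close>)
      moreover have "face_integral (x i) (x j) (x k) (\<lambda>y. q m y * d y) = face_integral (x i) (x j) (x k) (\<lambda>y. w' y \<bullet> ?k y)"
        by (rule face_integral_cong)
          (use alfeld_face[OF ij' m] q(3)[OF m(1)] in \<open>simp add: inner_axis restr_def\<close>)
      moreover have "face_integral (x i) (x j) (x k) (\<lambda>y. w y \<bullet> ?k y) = face_integral (x i) (x j) (x k) (\<lambda>y. w' y \<bullet> ?k y)"
        by (rule bspec[OF bspec[OF c ijk, unfolded prod.case] axis_test[OF d]])
      ultimately show "face_integral (x i) (x j) (x k) (\<lambda>y. P m y * d y) = 0"
        using face_integral_diff[OF pd, of "x i" "x j" "x k"] by (simp add: P_def left_diff_distrib)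
    qed
  qed
  have "(w y - w' y) $ l = 0" if fy: "y \<in> frontier (tetra x)" for y
  proof -
    obtain m where m: "m \<le> 3" "lam m y = 0" and y: "y \<in> tetra x" using fy unfolding frontier_tetra_iff by blast
    have ym: "y \<in> alfeld x m" using y m(2) unfolding alfeld_iff[OF m(1)] tetra_iff by simp
    have "\<exists>(i, j, k)\<in>faces. m \<notin> {i, j, k}"
      using le3_cases[OF m(1)] unfolding faces_eq by (elim disjE) auto
    then obtain i j k where "(i, j, k) \<in> faces" "m \<notin> {i, j, k}" by blast
    then have "P m y = 0" using face m by blast
    then show ?thesis using p(3)[OF m(1) ym] q(3)[OF m(1) ym] by (simp add: P_def)
  qed
  then show "(\<lambda>y. (w y - w' y) $ l) \<in> bubbles n"
    using M0_diff[OF wl] unfolding bubbles_def by simp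
qed

section \<open>Unisolvence\<close>

lemma plt_inner_fields: "vplt m v \<Longrightarrow> vplt n w \<Longrightarrow> plt (m + n) (\<lambda>y. v y \<bullet> w y)"
  unfolding vplt_def inner_3 by (intro plt_add plt_mult) auto

text \<open>
  The difference \<open>u\<close> of the two fields is a bubble. Its divergence is an admissible test function in (e),
  hence zero; then \<open>u\<close> is itself a curl by \<open>exactness\<close>, hence an admissible test function in (d), hence zero.
\<close>

lemma unisolvent:
  assumes n: "n = Suc m" and w: "w \<in> M2 n x" "w' \<in> M2 n x"
    and u: "(\<lambda>y. w y - w' y) \<in> vec3 (bubbles n)"
    and d: "\<And>\<kappa>. \<kappa> \<in> curl x ` M1d_bubble (Suc n) x \<Longrightarrow>
      (LINT y:tetra x|lebesgue. w y \<bullet> \<kappa> y) = (LINT y:tetra x|lebesgue. w' y \<bullet> \<kappa> y)"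
    and e: "\<And>\<kappa>. \<kappa> \<in> V3d_bubble m x \<Longrightarrow>
      (LINT y:tetra x|lebesgue. div3 x w y * \<kappa> y) = (LINT y:tetra x|lebesgue. div3 x w' y * \<kappa> y)"
  shows "w = w'"
proof -
  let ?u = "\<lambda>y. w y - w' y"
  obtain p where p: "\<And>i. i \<le> 3 \<Longrightarrow> vplt (Suc n) (p i)" "\<And>i y. i \<le> 3 \<Longrightarrow> y \<in> alfeld x i \<Longrightarrow> w y = p i y"
    using w(1) unfolding M2_def by (rule vector_M0_pieces) (rule that)
  obtain q where q: "\<And>i. i \<le> 3 \<Longrightarrow> vplt (Suc n) (q i)" "\<And>i y. i \<le> 3 \<Longrightarrow> y \<in> alfeld x i \<Longrightarrow> w' y = q i y"
    using w(2) unfolding M2_def by (rule vector_M0_pieces) (rule that)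
  have pq: "vplt (Suc n) (\<lambda>y. p i y - q i y)" "\<And>y. y \<in> alfeld x i \<Longrightarrow> ?u y = p i y - q i y" if "i \<le> 3" for i
    using vplt_diff[OF p(1)[OF that] q(1)[OF that]] p(2)[OF that] q(2)[OF that] by simp_all
  have cw: "cellwise n (\<lambda>i. vdiv (p i)) (div3 x w)" by (rule div3_cellwise[OF p])
  have cw': "cellwise n (\<lambda>i. vdiv (q i)) (div3 x w')" by (rule div3_cellwise[OF q])
  have cu: "cellwise n (\<lambda>i. vdiv (\<lambda>y. p i y - q i y)) (div3 x ?u)" by (rule div3_cellwise[OF pq])
  have du: "div3 x ?u y = div3 x w y - div3 x w' y" for y
  proof (cases "y \<in> open_cells x")
    case True
    then obtain i where i: "i \<le> 3" "y \<in> interior (alfeld x i)" unfolding open_cells_iff by blast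
    have "vdiv (\<lambda>y. p i y - q i y) y = vdiv (p i) y - vdiv (q i) y"
      by (rule vdiv_diff) (use vplt_differentiable p(1) q(1) i(1) in blast)+
    moreover have "div3 x ?u y = vdiv (\<lambda>y. p i y - q i y) y" "div3 x w y = vdiv (p i) y" "div3 x w' y = vdiv (q i) y"
      using cu cw cw' i unfolding cellwise_def by blast+
    ultimately show ?thesis by simp
  qed (simp add: div3_def restr_def)
  have div0: "div3 x ?u y = 0" for y
  proof (rule cellwise_square_zero[OF cu])
    have "div3 x ?u \<in> V3d_bubble m x" using div3_into u unfolding n by blast
    then have "integral\<^sup>L lborel (\<lambda>y. div3 x w y * div3 x ?u y) = integral\<^sup>L lborel (\<lambda>y. div3 x w' y * div3 x ?u y)"
      using e cellwise_LINT[OF cellwise_mult[OF cw cu]] cellwise_LINT[OF cellwise_mult[OF cw' cu]] by simp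
    then show "integral\<^sup>L lborel (\<lambda>y. div3 x ?u y * div3 x ?u y) = 0"
      using cellwise_integrable[OF cellwise_mult[OF cw cu]] cellwise_integrable[OF cellwise_mult[OF cw' cu]]
      by (subst (1) du) (simp add: left_diff_distrib)
  qed
  obtain r where r: "r \<in> M1d_bubble (Suc n) x" "curl x r = restr (open_cells x) ?u"
    by (rule exactness[OF u div0]) (rule that)
  let ?k = "curl x r"
  have ck: "cellwise (Suc n + Suc n) (\<lambda>i y. v i y \<bullet> (p i y - q i y)) (\<lambda>y. z y \<bullet> ?k y)"
    if v: "\<And>i. i \<le> 3 \<Longrightarrow> vplt (Suc n) (v i)" "\<And>i y. i \<le> 3 \<Longrightarrow> y \<in> alfeld x i \<Longrightarrow> z y = v i y" for v z
    unfolding cellwise_def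
  proof (intro conjI allI impI ballI)
    fix i :: nat assume i: "i \<le> 3"
    show "plt (Suc n + Suc n) (\<lambda>y. v i y \<bullet> (p i y - q i y))" by (rule plt_inner_fields[OF v(1)[OF i] pq(1)[OF i]])
    fix y assume y: "y \<in> interior (alfeld x i)"
    then have "y \<in> open_cells x" using i open_cells_iff by blast
    moreover have "y \<in> alfeld x i" using y interior_subset by blast
    ultimately show "z y \<bullet> ?k y = v i y \<bullet> (p i y - q i y)" using pq(2)[OF i] v(2)[OF i] by (simp add: r(2) restr_def)
  qed (simp add: r(2) restr_def)
  have "integral\<^sup>L lborel (\<lambda>y. w y \<bullet> ?k y) = integral\<^sup>L lborel (\<lambda>y. w' y \<bullet> ?k y)"
    using d[of ?k] r(1) cellwise_LINT[OF ck[OF p]] cellwise_LINT[OF ck[OF q]] by simp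
  then have z: "integral\<^sup>L lborel (\<lambda>y. ?u y \<bullet> ?k y) = 0"
    using cellwise_integrable[OF ck[OF p]] cellwise_integrable[OF ck[OF q]] by (simp add: inner_diff_left)
  have nn: "0 \<le> ?u y \<bullet> ?k y" for y by (simp add: r(2) restr_def)
  have uk: "?u y \<bullet> ?k y = 0" for y by (rule cellwise_zero_integral[OF ck[OF pq] nn z])
  have "?u y = 0" if "y \<in> open_cells x" for y
  proof -
    have "?k y = ?u y" using that by (simp add: r(2) restr_def)
    then have "?u y \<bullet> ?u y = 0" using uk[of y] by (simp only:)
    then show ?thesis by (simp only: inner_eq_zero_iff)
  qed
  then have "?u y = 0" for y by (rule bubbles_zero_of_cells[OF u])
  then show ?thesis by (auto simp: fun_eq_iff)
qed

end

theorem lemma4p16: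
  fixes x :: "nat \<Rightarrow> real^3" and r :: nat
  assumes "nondegenerate x" and "5 \<le> r"
  shows
    "(\<forall>\<omega>\<in>M2 (r - 2) x. \<forall>\<omega>'\<in>M2 (r - 2) x.
        (\<forall>i\<le>3. \<omega> (x i) = \<omega>' (x i)) \<and>
        (\<forall>(i, j)\<in>edges. \<forall>\<kappa>\<in>vec3 (Pol (r - 4) (edge x i j)).
           edge_integral (x i) (x j) (\<lambda>y. \<omega> y \<bullet> \<kappa> y) =
           edge_integral (x i) (x j) (\<lambda>y. \<omega>' y \<bullet> \<kappa> y)) \<and>
        (\<forall>(i, j, k)\<in>faces. \<forall>\<kappa>\<in>vec3 (Pol (r - 5) (face x i j k)).
           face_integral (x i) (x j) (x k) (\<lambda>y. \<omega> y \<bullet> \<kappa> y) =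
           face_integral (x i) (x j) (x k) (\<lambda>y. \<omega>' y \<bullet> \<kappa> y)) \<and>
        (\<forall>\<kappa>\<in>curl x ` M1d_bubble (r - 1) x.
           (LINT y:tetra x|lebesgue. \<omega> y \<bullet> \<kappa> y) =
           (LINT y:tetra x|lebesgue. \<omega>' y \<bullet> \<kappa> y)) \<and>
        (\<forall>\<kappa>\<in>V3d_bubble (r - 3) x.
           (LINT y:tetra x|lebesgue. div3 x \<omega> y * \<kappa> y) =
           (LINT y:tetra x|lebesgue. div3 x \<omega>' y * \<kappa> y))
        \<longrightarrow> \<omega> = \<omega>') \<and>
     card (x ` {..3}) * DIM(real^3) = 12 \<and>
     (\<Sum>(i, j)\<in>edges. dim (vec3 (Pol (r - 4) (edge x i j)))) = 18 * (r - 3) \<and>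
     (\<Sum>(i, j, k)\<in>faces. dim (vec3 (Pol (r - 5) (face x i j k)))) = 6 * (r - 4) * (r - 3) \<and>
     real (dim (curl x ` M1d_bubble (r - 1) x)) =
       (real r - 4) * (real r - 3) * (4 * real r - 11) / 3 \<and>
     real (dim (V3d_bubble (r - 3) x)) = 2 * (real r - 2) * (real r - 1) * real r / 3 - 1"
proof -
  interpret tetrahedron x by unfold_locales (rule assms(1))
  obtain s where s: "r = s + 5" using assms(2) by (metis le_add_diff_inverse2)
  have r: "r - 1 = Suc (Suc (s + 2))" "r - 2 = Suc (s + 2)" "r - 3 = s + 2" "r - 4 = s + 1" "r - 5 = s"
    by (simp_all add: s)
  have p3: "real (pdim 3 k) = real k * (real k + 1) * (real k + 2) / 6" for k
  proof -
    have f: "6 * real (pdim 3 k) = real k * (real k + 1) * (real k + 2)"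
      using arg_cong[OF pdim_3[of k], of real] by (simp only: of_nat_mult of_nat_add of_nat_numeral of_nat_1)
    have "real (pdim 3 k) = 6 * real (pdim 3 k) / 6" by simp
    then show ?thesis unfolding f .
  qed
  show ?thesis
  proof (intro conjI ballI impI; (elim conjE)?)
    fix \<omega> \<omega>'
    assume w: "\<omega> \<in> M2 (r - 2) x" "\<omega>' \<in> M2 (r - 2) x"
      and a: "\<forall>i\<le>3. \<omega> (x i) = \<omega>' (x i)"
      and b: "\<forall>(i, j)\<in>edges. \<forall>\<kappa>\<in>vec3 (Pol (r - 4) (edge x i j)).
           edge_integral (x i) (x j) (\<lambda>y. \<omega> y \<bullet> \<kappa> y) = edge_integral (x i) (x j) (\<lambda>y. \<omega>' y \<bullet> \<kappa> y)"
      and c: "\<forall>(i, j, k)\<in>faces. \<forall>\<kappa>\<in>vec3 (Pol (r - 5) (face x i j k)).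
           face_integral (x i) (x j) (x k) (\<lambda>y. \<omega> y \<bullet> \<kappa> y) = face_integral (x i) (x j) (x k) (\<lambda>y. \<omega>' y \<bullet> \<kappa> y)"
      and d: "\<forall>\<kappa>\<in>curl x ` M1d_bubble (r - 1) x.
           (LINT y:tetra x|lebesgue. \<omega> y \<bullet> \<kappa> y) = (LINT y:tetra x|lebesgue. \<omega>' y \<bullet> \<kappa> y)"
      and e: "\<forall>\<kappa>\<in>V3d_bubble (r - 3) x.
           (LINT y:tetra x|lebesgue. div3 x \<omega> y * \<kappa> y) = (LINT y:tetra x|lebesgue. div3 x \<omega>' y * \<kappa> y)"
    have n: "3 \<le> r - 2" "r - 2 - 2 = r - 4" "r - 2 - 3 = r - 5" "Suc (r - 2) = r - 1" "r - 2 = Suc (r - 3)"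
      using assms(2) by auto
    have u: "(\<lambda>y. \<omega> y - \<omega>' y) \<in> vec3 (bubbles (r - 2))"
      by (rule difference_bubble[OF n(1) w a]) (use b c in \<open>simp_all only: n(2,3)\<close>)
    show "\<omega> = \<omega>'"
      by (rule unisolvent[OF n(5) w u]) (use d e in \<open>simp_all only: n(4)\<close>)
  next
    have "inj_on x {..3}" using assms(1) unfolding nondegenerate_def by blast
    then show "card (x ` {..3}) * DIM(real^3) = 12" by (simp add: card_image)
  next
    have "(\<Sum>(i, j)\<in>edges. dim (vec3 (Pol (r - 4) (edge x i j)))) = (\<Sum>(i, j)\<in>edges. 3 * Suc (r - 4))"
      by (rule sum.cong) (auto simp: edges_def simp del: mult_Suc_right intro!: has_dim_dim has_dim_edge)
    then show "(\<Sum>(i, j)\<in>edges. dim (vec3 (Pol (r - 4) (edge x i j)))) = 18 * (r - 3)"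
      unfolding r by (simp add: edges_eq)
  next
    have "(\<Sum>(i, j, k)\<in>faces. dim (vec3 (Pol (r - 5) (face x i j k)))) = (\<Sum>(i, j, k)\<in>faces. 3 * pdim 2 (Suc (r - 5)))"
      by (rule sum.cong) (auto simp: faces_def intro!: has_dim_dim has_dim_triangle)
    also have "\<dots> = 6 * (2 * pdim 2 (Suc (r - 5)))" by (simp add: faces_eq)
    also have "\<dots> = 6 * (r - 4) * (r - 3)" unfolding pdim_2 r by simp
    finally show "(\<Sum>(i, j, k)\<in>faces. dim (vec3 (Pol (r - 5) (face x i j k)))) = 6 * (r - 4) * (r - 3)" .
  next
    have le: "1 \<le> 4 * pdim 3 (Suc (s + 2))" using p3[of "Suc (s + 2)"] by (cases "pdim 3 (Suc (s + 2))") auto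
    have "real (dim (curl x ` M1d_bubble (r - 1) x)) =
      3 * (real (pdim 3 (Suc (s + 2))) + real (pdim 3 (s + 2)) + real (pdim 3 (s + 1)) + real (pdim 3 s)) - (4 * real (pdim 3 (Suc (s + 2))) - 1)"
      unfolding r has_dim_dim[OF has_dim_curl(1)] of_nat_diff[OF has_dim_curl(2)] using le
      by (simp add: of_nat_diff One_nat_def)
    also have "\<dots> = (real r - 4) * (real r - 3) * (4 * real r - 11) / 3"
      unfolding p3 by (simp add: s field_simps)
    finally show "real (dim (curl x ` M1d_bubble (r - 1) x)) = (real r - 4) * (real r - 3) * (4 * real r - 11) / 3" .
    show "real (dim (V3d_bubble (r - 3) x)) = 2 * (real r - 2) * (real r - 1) * real r / 3 - 1"
      unfolding r(3) has_dim_dim[OF has_dim_V3d] of_nat_diff[OF le] using p3[of "Suc (s + 2)"]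
      by (simp add: s field_simps)
  qed
qed

end
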